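(* Let $d\geq2$ and $\kappa<0$. Let $\Delta^d_\infty(\kappa)\subseteq\mathbb{R}^d$ be a Euclidean regular $d$-dimensional simplex all of whose vertices lie on the sphere $\{x\in\mathbb{R}^d:\|x\|=1/\sqrt{-\kappa}\}$ (the ideal regular hyperbolic simplex in the Klein model $\bar{\mathbb{B}}^d(\kappa)$). Then $$\mathrm{Vol}_{d,\kappa}(\Delta^d_\infty(\kappa))=\frac{\omega_{d+1}}{i^d|\kappa|^{d/2}}\frac{1}{\sqrt{2\pi}}\int_0^{(1-i)\infty}\Big(\Phi^{d+1}\Big(\frac{ix}{\sqrt d}\Big)+\Phi^{d+1}\Big(-\frac{ix}{\sqrt d}\Big)\Big)e^{-x^2/2}\,dx.$$
   Context: $\Phi(z)=\frac12+\frac{1}{\sqrt{2\pi}}\int_0^z e^{-x^2/2}dx$ for $z\in\mathbb{C}$. For $\omega\ne0$, $\int_0^{\omega\infty}f(x)dx:=\lim_{B\to+\infty}\int_0^Bf(\omega y)\omega\,dy$. $\omega_{d+1}=2\pi^{(d+1)/2}/\Gamma((d+1)/2)$. For $\kappa<0$ and a Borel set $A\subseteq\{x\in\mathbb{R}^d:\|x\|\le1/\sqrt{-\kappa}\}$, the hyperbolic volume is $\mathrm{Vol}_{d,\kappa}(A)=\int_A(1+\kappa\|y\|^2)^{-(d+1)/2}dy$. *)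

theory Defs
  imports "HOL-Complex_Analysis.Complex_Analysis"
begin

text \<open>Standard normal CDF extended to the complex plane; the integral from 0 to z
  is the contour integral along the straight segment (integrand is entire).\<close>
definition Phi :: "complex \<Rightarrow> complex" where
  "Phi z = 1/2 + (1 / complex_of_real (sqrt (2*pi))) *
     contour_integral (linepath 0 z) (\<lambda>x. exp (- (x^2) / 2))"

text \<open>Surface area of the unit sphere in R^(d+1).\<close>
definition omega :: "nat \<Rightarrow> real" where
  "omega m = 2 * pi powr (real m / 2) / Gamma (real m / 2)"

definition ray_integral_tendsto :: "complex \<Rightarrow> (complex \<Rightarrow> complex) \<Rightarrow> complex \<Rightarrow> bool" where
  "ray_integral_tendsto w f L \<longleftrightarrow>
     ((\<lambda>B. integral {0..B} (\<lambda>y::real. f (w * complex_of_real y) * w)) \<longlongrightarrow> L) at_top"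

text \<open>Hyperbolic volume (Klein model of curvature kappa) of a Borel set A in R^n.\<close>
definition hyp_vol :: "real \<Rightarrow> (real^'n) set \<Rightarrow> real" where
  "hyp_vol \<kappa> A = (LINT y:A|lborel. (1 + \<kappa> * (norm y)^2) powr (- (real CARD('n) + 1) / 2))"

definition regular_simplex_vertices :: "(real^'n) set \<Rightarrow> bool" where
  "regular_simplex_vertices V \<longleftrightarrow> finite V \<and> card V = CARD('n) + 1 \<and>
     (\<exists>s>0. \<forall>u\<in>V. \<forall>v\<in>V. u \<noteq> v \<longrightarrow> dist u v = s)"

end

theory Submission
  imports Defs "HOL-Probability.Probability" "HOL-Real_Asymp.Real_Asymp"
begin

text \<open>
  In barycentric coordinates \<open>s\<close> the volume is a multiple of the integral of \<open>(1 - Q)\<close> to the power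
  \<open>-(d + 1) / 2\<close> over the standard simplex, where \<open>Q\<close> is the sum of the \<open>s\<^sub>i\<^sup>2\<close>; below, \<open>S\<close> is the sum
  of the \<open>s\<^sub>i\<close>, which is a free radial variable on the positive orthant of dimension \<open>d + 1\<close>.
  For \<open>w\<close> on the unit circle with \<open>0 < arg w < \<pi> / 4\<close> the integral of
  \<open>exp (-(w\<^sup>2 Q + S\<^sup>2 / w\<^sup>2) / 2)\<close> over the orthant converges absolutely. Linearising \<open>S\<^sup>2\<close> by the
  Fourier transform of a Gaussian makes it factor, and each factor is a value of \<open>Phi\<close>; in polar form it
  is the integral of \<open>(w\<^sup>2 Q + 1 / w\<^sup>2)\<close> to the power \<open>-(d + 1) / 2\<close>. As \<open>arg w \<rightarrow> \<pi> / 4\<close> the first form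
  tends to the ray integral, because the tails of the oscillating integrals are \<open>O(1 / B)\<close> uniformly
  in \<open>w\<close>, and the second tends, by domination with a Dirichlet density, to a multiple of the volume.
\<close>

section \<open>The normal distribution function in the complex plane\<close>

text \<open>The form behind the simplex is S^2 - Q, of Lorentzian signature. The real Gaussian exp
  (-(S^2 - Q) / 2) would suit the polar form, but the integral factors only once S^2 and Q are
  separated, and exp (Q / 2) alone diverges. The weights w^2 for Q and 1 / w^2 for S^2 both have
  positive real part when |arg w| < \<pi> / 4, and at w^2 = \<i> the exponent becomes \<i> (S^2 - Q)
  / 2: the Lorentzian form is reached from the domain of absolute convergence. The price is that the
  one-dimensional integral converges only conditionally at the end point, so its tails need bounds
  valid up to the boundary. There each of the d + 1 factors carries exp (\<i> \<xi>^2 / 2) and the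
  Fourier kernel is exp (-\<i> \<xi>^2 / 2). What remains is exp (\<i> d \<xi>^2 / 2), the origin of
  sqrt d in the argument of \<open>Phi\<close>. The condition d \<ge> 2 enters twice: it makes (1 -
  Q) to the power -(d + 1) / 2 integrable at the vertices, and it gives d + 1 \<ge> 3 factors, as
  the tail bounds require.\<close>

lemma Phi_has_field_derivative:
  "(Phi has_field_derivative exp (- (z\<^sup>2) / 2) / complex_of_real (sqrt (2*pi))) (at z)"
proof -
  obtain F where F: "\<And>x::complex. (F has_field_derivative exp (- (x\<^sup>2) / 2)) (at x)"
  proof (rule holomorphic_convex_primitive'[of UNIV "\<lambda>x::complex. exp (- (x\<^sup>2) / 2)"])
  qed (auto intro!: holomorphic_intros)
  have "contour_integral (linepath 0 z) (\<lambda>x. exp (- (x\<^sup>2) / 2)) = F z - F 0" for z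
    using contour_integral_primitive[of UNIV F "\<lambda>x. exp (- (x\<^sup>2) / 2)" "linepath 0 z"] F
    by (auto intro!: contour_integral_unique)
  hence Phi_eq: "Phi = (\<lambda>z. 1/2 + (F z - F 0) / complex_of_real (sqrt (2*pi)))"
    by (auto simp: Phi_def)
  show ?thesis
    unfolding Phi_eq by (auto intro!: derivative_eq_intros F)
qed

lemmas Phi_has_field_derivative' [derivative_intros] =
  DERIV_chain2[OF Phi_has_field_derivative]

lemma continuous_on_Phi [continuous_intros]:
  "continuous_on A f \<Longrightarrow> continuous_on A (\<lambda>x. Phi (f x))"
  using continuous_on_compose2[of UNIV Phi A f]
    DERIV_continuous_on[of UNIV Phi, OF has_field_derivative_at_within[OF Phi_has_field_derivative]]
  by auto

lemma Phi_0 [simp]: "Phi 0 = 1/2"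
  by (simp add: Phi_def)

text \<open>The integrand is even, so the sum of the two values has derivative zero; its constant is
  found at the origin.\<close>

lemma Phi_minus: "Phi (-z) = 1 - Phi z"
proof -
  have "\<exists>c. \<forall>z\<in>UNIV. Phi z + Phi (-z) = c"
    by (rule has_field_derivative_zero_constant) (auto intro!: derivative_eq_intros)
  then obtain c where c: "\<And>z. Phi z + Phi (-z) = c" by auto
  from c[of 0] have "c = 1" by simp
  with c[of z] show ?thesis by (simp add: eq_diff_eq add.commute)
qed

text \<open>A complex integrand leaves no room for monotone convergence, so absolute integrability
  is a hypothesis of its own; the limit of \<open>F\<close> then only identifies the value.\<close>

lemma set_integral_FTC_atLeast:
  fixes F f :: "real \<Rightarrow> complex"
  assumes F: "\<And>x. x \<ge> a \<Longrightarrow> (F has_vector_derivative f x) (at x)"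
    and cont: "continuous_on {a..} f"
    and int: "set_integrable lborel {a..} f"
    and lim: "(F \<longlongrightarrow> L) at_top"
  shows "(LINT x:{a..}|lborel. f x) = L - F a"
proof (rule tendsto_unique[OF trivial_limit_at_top_linorder])
  show "((\<lambda>b. LINT x:{a..b}|lborel. f x) \<longlongrightarrow> (LINT x:{a..}|lborel. f x)) at_top"
    by (intro tendsto_set_lebesgue_integral_at_top int) auto
  have "eventually (\<lambda>b. F b - F a = (LINT x:{a..b}|lborel. f x)) at_top"
    using eventually_ge_at_top[of a]
  proof eventually_elim
    case (elim b)
    show ?case
      unfolding set_lebesgue_integral_def
      by (rule integral_FTC_Icc[symmetric])
        (use elim F cont in \<open>auto intro: has_vector_derivative_at_within continuous_on_subset\<close>)
  qed
  moreover have "((\<lambda>b. F b - F a) \<longlongrightarrow> L - F a) at_top"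
    by (intro tendsto_intros lim)
  ultimately show "((\<lambda>b. LINT x:{a..b}|lborel. f x) \<longlongrightarrow> L - F a) at_top"
    by (rule Lim_transform_eventually[rotated])
qed

text \<open>The normalisation 1 / sqrt (2 \<pi>) matters here: the Gaussian integral makes
  \<open>Phi\<close> tend to 1 along the positive axis, and reflection turns this into 0 along the
  negative one.\<close>

lemma Phi_neg_real_tendsto_0: "((\<lambda>t. Phi (- complex_of_real t)) \<longlongrightarrow> 0) at_top"
proof -
  define f where "f = (\<lambda>x::real. exp (- (x\<^sup>2)))"
  have int: "set_integrable lborel {0..} f" and val: "(LINT x:{0..}|lborel. f x) = sqrt pi / 2"
    using gaussian_moment_0 unfolding has_bochner_integral_iff set_integrable_def set_lebesgue_integral_def f_def
    by auto
  have eq: "Phi (complex_of_real t) = 1/2 + complex_of_real ((LINT x:{0..t / sqrt 2}|lborel. f x) / sqrt pi)"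
    if "t \<ge> 0" for t
  proof -
    \<comment> \<open>The scaling by sqrt 2 relates exp (-x^2), whose half-line integral is sqrt
      \<pi> / 2, to the density exp (-x^2 / 2) behind \<open>Phi\<close>.\<close>
    have "(LINT x:{0..t/sqrt 2}|lborel. complex_of_real (f x)) =
        complex_of_real (sqrt pi) * Phi (complex_of_real (sqrt 2 * (t / sqrt 2))) - complex_of_real (sqrt pi) * Phi (complex_of_real (sqrt 2 * 0))"
      unfolding set_lebesgue_integral_def
    proof (rule integral_FTC_Icc)
      fix x :: real
      have "((\<lambda>x. complex_of_real (sqrt pi) * Phi (complex_of_real (sqrt 2) * x)) has_field_derivative
         complex_of_real (sqrt pi) * (exp (- ((complex_of_real (sqrt 2) * complex_of_real x)\<^sup>2) / 2) /
           complex_of_real (sqrt (2 * pi)) * complex_of_real (sqrt 2))) (at (complex_of_real x))"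
        by (auto intro!: derivative_eq_intros)
      hence "((\<lambda>x. complex_of_real (sqrt pi) * Phi (complex_of_real (sqrt 2) * complex_of_real x)) has_vector_derivative
         complex_of_real (sqrt pi) * (exp (- ((complex_of_real (sqrt 2) * complex_of_real x)\<^sup>2) / 2) /
           complex_of_real (sqrt (2 * pi)) * complex_of_real (sqrt 2))) (at x within {0..t/sqrt 2})"
        by (intro has_vector_derivative_real_field)
      also have "complex_of_real (sqrt pi) * (exp (- ((complex_of_real (sqrt 2) * complex_of_real x)\<^sup>2) / 2) /
           complex_of_real (sqrt (2 * pi)) * complex_of_real (sqrt 2)) = complex_of_real (f x)"
        by (simp add: f_def real_sqrt_mult power_mult_distrib exp_of_real flip: of_real_power of_real_mult)
           (simp flip: exp_of_real)?
      finally show "((\<lambda>x. complex_of_real (sqrt pi) * Phi (complex_of_real (sqrt 2 * x))) has_vector_derivative complex_of_real (f x))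
                      (at x within {0..t/sqrt 2})" by simp
    next
      show "continuous_on {0..t / sqrt 2} (\<lambda>x. complex_of_real (f x))"
        unfolding f_def by (intro continuous_intros)
    qed (use that in auto)
    thus ?thesis
      by (simp add: set_integral_complex_of_real field_simps)
  qed
  have "((\<lambda>b. LINT x:{0..b}|lborel. f x) \<longlongrightarrow> sqrt pi / 2) at_top"
    using tendsto_set_lebesgue_integral_at_top[OF _ int] val by simp
  hence "((\<lambda>t. LINT x:{0..t / sqrt 2}|lborel. f x) \<longlongrightarrow> sqrt pi / 2) at_top"
    by (rule filterlim_compose) real_asymp
  hence "((\<lambda>t. 1 - (1/2 + complex_of_real ((LINT x:{0..t / sqrt 2}|lborel. f x) / sqrt pi)))
           \<longlongrightarrow> 1 - (1/2 + complex_of_real ((sqrt pi / 2) / sqrt pi))) at_top"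
    by (intro tendsto_intros) auto
  hence "((\<lambda>t. 1 - (1/2 + complex_of_real ((LINT x:{0..t / sqrt 2}|lborel. f x) / sqrt pi)))
           \<longlongrightarrow> 0) at_top"
    by simp
  moreover have "eventually (\<lambda>t. 1 - (1/2 + complex_of_real ((LINT x:{0..t / sqrt 2}|lborel. f x) / sqrt pi)) = Phi (- complex_of_real t)) at_top"
    using eventually_ge_at_top[of 0] by eventually_elim (simp only: Phi_minus eq)
  ultimately show ?thesis
    by (rule Lim_transform_eventually)
qed

text \<open>The points \<open>z - w * s\<close> are compared with points of the negative real axis,
  where the limit is known. Up to the bounded shift \<open>z\<close>, the segment between them stays
  in the sector |Im u| < |Re u|, so Re (u^2) grows like s^2. The derivative of \<open>Phi\<close> is
  thus Gaussian small on a segment whose length is only O(s).\<close>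

lemma Phi_tendsto_0:
  assumes w: "Re w > 0" "\<bar>Im w\<bar> < Re w"
  shows "((\<lambda>s. Phi (z - w * complex_of_real s)) \<longlongrightarrow> 0) at_top"
proof -
  define a b c where "a = Re w" and "b = \<bar>Im w\<bar>" and "c = norm z"
  have ab: "b < a" "0 \<le> b" "0 < a" "c \<ge> 0" using w by (auto simp: a_def b_def c_def)
  have bound: "norm (Phi (z - w * complex_of_real s) - Phi (- complex_of_real (a * s)))
     \<le> exp (- (((a - b) * s - 2 * c) * ((a + b) * s)) / 2) / sqrt (2*pi) * (c + b * s)"
    if s: "s \<ge> 0" "a * s \<ge> c" "(a - b) * s \<ge> 2 * c" for s
  proof -
    define S where "S = closed_segment (z - w * complex_of_real s) (- complex_of_real (a * s))"
    have "norm (Phi (z - w * complex_of_real s) - Phi (- complex_of_real (a * s)))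
     \<le> exp (- (((a - b) * s - 2 * c) * ((a + b) * s)) / 2) / sqrt (2*pi) * norm (z - w * complex_of_real s - (- complex_of_real (a * s)))"
    proof (rule field_differentiable_bound[of S])
      fix u assume "u \<in> S"
      then obtain l where l: "0 \<le> l" "l \<le> 1" "u = (1 - l) *\<^sub>R (z - w * complex_of_real s) + l *\<^sub>R (- complex_of_real (a * s))"
        by (auto simp: S_def closed_segment_def)
      define k where "k = 1 - l"
      have k: "0 \<le> k" "k \<le> 1" "l = 1 - k" using l by (auto simp: k_def)
      have Reu: "Re u = - (a * s - k * Re z)" and Imu: "Im u = k * (Im z - Im w * s)"
        unfolding l(3) k(3) by (auto simp: a_def algebra_simps)
      have "k * Re z \<le> 1 * norm z"
        using k abs_Re_le_cmod[of z] by (meson abs_ge_self abs_ge_zero mult_mono norm_ge_zero order.trans mult_left_mono mult_right_mono)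
      hence "(a * s - k * Re z)\<^sup>2 \<ge> (a * s - c)\<^sup>2"
        using s by (intro power_mono) (auto simp: c_def)
      moreover have "\<bar>k * (Im z - Im w * s)\<bar> \<le> \<bar>c + b * s\<bar>"
      proof -
        have "\<bar>k * (Im z - Im w * s)\<bar> \<le> \<bar>Im z - Im w * s\<bar>"
          using k by (auto simp: abs_mult intro!: mult_left_le_one_le)
        also have "\<dots> \<le> \<bar>Im z\<bar> + \<bar>Im w * s\<bar>" by linarith
        also have "\<dots> \<le> c + b * s" using abs_Im_le_cmod[of z] s by (auto simp: b_def c_def abs_mult)
        finally show ?thesis by linarith
      qed
      hence "(k * (Im z - Im w * s))\<^sup>2 \<le> (c + b * s)\<^sup>2"
        by (rule abs_le_square_iff[THEN iffD1])
      moreover have "Re (u\<^sup>2) = (a * s - k * Re z)\<^sup>2 - (k * (Im z - Im w * s))\<^sup>2"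
        by (simp add: power2_eq_square Reu Imu algebra_simps)
      ultimately have "Re (u\<^sup>2) \<ge> (a * s - c)\<^sup>2 - (c + b * s)\<^sup>2" by linarith
      \<comment> \<open>Since b < a, both factors grow linearly in \<open>s\<close>; this is the
        quadratic growth of the exponent.\<close>
      also have "(a * s - c)\<^sup>2 - (c + b * s)\<^sup>2 = ((a - b) * s - 2 * c) * ((a + b) * s)"
        by (simp add: power2_eq_square algebra_simps)
      finally show "norm (exp (- (u\<^sup>2) / 2) / complex_of_real (sqrt (2*pi))) \<le> exp (- (((a - b) * s - 2 * c) * ((a + b) * s)) / 2) / sqrt (2*pi)"
        by (simp add: norm_divide divide_right_mono)
    qed (auto simp: S_def intro!: derivative_eq_intros)
    also have "\<dots> \<le> exp (- (((a - b) * s - 2 * c) * ((a + b) * s)) / 2) / sqrt (2*pi) * (c + b * s)"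
    proof (intro mult_left_mono)
      have "z - w * complex_of_real s - (- complex_of_real (a * s)) = z - \<i> * complex_of_real (Im w * s)"
        by (simp add: complex_eq_iff a_def)
      also have "norm \<dots> \<le> norm z + norm (\<i> * complex_of_real (Im w * s))" by (rule norm_triangle_ineq4)
      also have "\<dots> = c + b * s" using s by (simp add: c_def b_def norm_mult abs_mult)
      finally show "norm (z - w * complex_of_real s - (- complex_of_real (a * s))) \<le> c + b * s" .
    qed auto
    finally show ?thesis .
  qed
  have "((\<lambda>s. exp (- ((e * s - 2 * c) * (f * s)) / 2) / sqrt (2*pi) * (c + b * s)) \<longlongrightarrow> 0) at_top"
    if "e > 0" "f > 0" for e f :: real
    using that by real_asymp
  from this[of "a-b" "a+b"] ab have lim: "((\<lambda>s. exp (- (((a - b) * s - 2 * c) * ((a + b) * s)) / 2) / sqrt (2*pi) * (c + b * s)) \<longlongrightarrow> 0) at_top"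
    by auto
  have "eventually (\<lambda>s. norm (Phi (z - w * complex_of_real s) - Phi (- complex_of_real (a * s)))
     \<le> exp (- (((a - b) * s - 2 * c) * ((a + b) * s)) / 2) / sqrt (2*pi) * (c + b * s)) at_top"
    using eventually_ge_at_top[of 0] eventually_ge_at_top[of "c / a"] eventually_ge_at_top[of "2 * c / (a - b)"]
    by eventually_elim (rule bound, use ab in \<open>auto simp: field_simps\<close>)
  hence "((\<lambda>s. Phi (z - w * complex_of_real s) - Phi (- complex_of_real (a * s))) \<longlongrightarrow> 0) at_top"
    by (rule Lim_null_comparison[OF _ lim])
  moreover have "((\<lambda>s. Phi (- complex_of_real (a * s))) \<longlongrightarrow> 0) at_top"
    by (rule filterlim_compose[OF Phi_neg_real_tendsto_0])
       (use ab in real_asymp)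
  ultimately have "((\<lambda>s. Phi (z - w * complex_of_real s) - Phi (- complex_of_real (a * s)) + Phi (- complex_of_real (a * s))) \<longlongrightarrow> 0 + 0) at_top"
    by (rule tendsto_add)
  thus ?thesis by simp
qed

section \<open>Gaussian integrals with a complex parameter\<close>

lemma abs_Im_less_Re:
  assumes "Re w > 0" "Re (w\<^sup>2) > 0"
  shows "\<bar>Im w\<bar> < Re w"
proof -
  have "(Im w)\<^sup>2 < (Re w)\<^sup>2" using assms(2) by (simp add: power2_eq_square)
  hence "\<bar>Im w\<bar> < \<bar>Re w\<bar>" using abs_le_square_iff[of "Re w" "Im w"] by linarith
  thus ?thesis using assms by simp
qed

lemma set_integrable_power_exp:
  "set_integrable lborel {0..} (\<lambda>s::real. s ^ k * exp (- s))"
proof -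
  have "integrable lborel (\<lambda>x::real. x ^ k * exp (- x) * indicator {0..} x)"
  proof (rule integrableI_nonneg)
    have "(\<integral>\<^sup>+x. ennreal (x ^ k * exp (- x) * indicator {0..} x) \<partial>lborel)
        = (\<integral>\<^sup>+x. ennreal (x^k * exp (-x)) * indicator {0 ..} x \<partial>lborel)"
      by (intro nn_integral_cong) (auto simp: indicator_def)
    also have "\<dots> < \<infinity>" by (subst nn_intergal_power_times_exp_Ici) auto
    finally show "(\<integral>\<^sup>+x. ennreal (x ^ k * exp (- x) * indicator {0..} x) \<partial>lborel) < \<infinity>" .
  qed (auto simp: indicator_def)
  thus ?thesis unfolding set_integrable_def by (simp add: mult_ac)
qed

lemma set_integrable_power_gaussian_real:
  assumes "a > 0"
  shows "set_integrable lborel {0..} (\<lambda>s::real. s ^ k * exp (- a * s\<^sup>2 + b * s))"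
proof (rule set_integrable_bound)
  \<comment> \<open>\<open>C\<close> is the maximum over s of exp (-a s^2 + (b + 1) s), so the
    Gaussian is dominated by C exp (-s).\<close>
  define C where "C = exp ((b + 1)\<^sup>2 / (4 * a))"
  show "set_integrable lborel {0..} (\<lambda>s::real. C * (s ^ k * exp (- s)))"
    by (rule set_integrable_mult_right) (rule set_integrable_power_exp)
  have le: "exp (- a * s\<^sup>2 + b * s) \<le> C * exp (- s)" for s :: real
  proof -
    have "0 \<le> a * (s - (b + 1) / (2 * a))\<^sup>2" using assms by simp
    also have "\<dots> = a * s\<^sup>2 - (b + 1) * s + (b + 1)\<^sup>2 / (4 * a)"
      using assms by (simp add: power2_eq_square field_simps)
    finally show ?thesis unfolding C_def by (simp add: algebra_simps flip: exp_add)
  qed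
  have "x ^ k * exp (- a * x\<^sup>2 + b * x) \<le> C * (x ^ k * exp (- x))" if "x \<ge> 0" for x :: real
    using mult_left_mono[OF le[of x], of "x ^ k"] that by (simp add: mult_ac)
  thus "AE x in lborel. x \<in> {0..} \<longrightarrow>
     norm (x ^ k * exp (- a * x\<^sup>2 + b * x)) \<le> norm (C * (x ^ k * exp (- x)))"
    by (auto simp: abs_mult C_def)
qed (auto simp: set_borel_measurable_def)

lemma set_integrable_power_gaussian:
  assumes "Re c > 0"
  shows "set_integrable lborel {0..} (\<lambda>s::real. complex_of_real s ^ k * exp (- c * complex_of_real s ^ 2 / 2 + z * complex_of_real s))"
proof (rule set_integrable_bound)
  show "set_integrable lborel {0..} (\<lambda>s::real. s ^ k * exp (- (Re c / 2) * s\<^sup>2 + Re z * s))"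
    by (rule set_integrable_power_gaussian_real) (use assms in auto)
  show "set_borel_measurable lborel {0..} (\<lambda>s::real. complex_of_real s ^ k * exp (- c * complex_of_real s ^ 2 / 2 + z * complex_of_real s))"
    unfolding set_borel_measurable_def by measurable
qed (auto simp: norm_mult norm_power abs_mult power_abs mult_ac simp flip: of_real_power)

text \<open>Completing the square exhibits a multiple of \<open>Phi (z / w - w * s)\<close> as an
  antiderivative. The hypotheses place \<open>w\<close> in the open sector |arg w| < \<pi> / 4,
  where it vanishes at infinity, so only its value at 0 remains.\<close>

lemma
  assumes w: "Re w > 0" "Re (w\<^sup>2) > 0"
  shows set_integrable_gaussian_half_line:
      "set_integrable lborel {0..} (\<lambda>s::real. exp (- (w\<^sup>2) * complex_of_real s ^ 2 / 2 + z * complex_of_real s))"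
    and set_integral_gaussian_half_line:
      "(LINT s:{0..}|lborel. exp (- (w\<^sup>2) * complex_of_real s ^ 2 / 2 + z * complex_of_real s)) =
         complex_of_real (sqrt (2*pi)) / w * exp (z\<^sup>2 / (2 * w\<^sup>2)) * Phi (z / w)"
proof -
  have w0: "w \<noteq> 0" using w by auto
  show int: "set_integrable lborel {0..} (\<lambda>s::real. exp (- (w\<^sup>2) * complex_of_real s ^ 2 / 2 + z * complex_of_real s))"
    using set_integrable_power_gaussian[OF w(2), of 0 z] by simp
  define C where "C = complex_of_real (sqrt (2*pi)) / w * exp (z\<^sup>2 / (2 * w\<^sup>2))"
  have "(LINT s:{0..}|lborel. exp (- (w\<^sup>2) * complex_of_real s ^ 2 / 2 + z * complex_of_real s)) =
    - C * 0 - (- C * Phi (z / w - w * complex_of_real 0))"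
  proof (rule set_integral_FTC_atLeast)
    fix x :: real
    have e: "exp (z\<^sup>2 / (2 * w\<^sup>2)) * exp (- ((z / w - w * complex_of_real x)\<^sup>2) / 2) =
        exp (- (w\<^sup>2) * complex_of_real x ^ 2 / 2 + z * complex_of_real x)"
      unfolding exp_add[symmetric] using w0 by (intro arg_cong[where f=exp]) (simp add: field_simps power2_eq_square)
    have "((\<lambda>x. - C * Phi (z / w - w * x)) has_field_derivative
        - C * (exp (- ((z / w - w * complex_of_real x)\<^sup>2) / 2) / complex_of_real (sqrt (2*pi)) * (- w))) (at (complex_of_real x))"
      by (auto intro!: derivative_eq_intros)
    also have "- C * (exp (- ((z / w - w * complex_of_real x)\<^sup>2) / 2) / complex_of_real (sqrt (2*pi)) * (- w)) =
      exp (- (w\<^sup>2) * complex_of_real x ^ 2 / 2 + z * complex_of_real x)"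
      using w0 e by (simp add: C_def)
    finally show "((\<lambda>x. - C * Phi (z / w - w * complex_of_real x)) has_vector_derivative
        exp (- (w\<^sup>2) * complex_of_real x ^ 2 / 2 + z * complex_of_real x)) (at x)"
      by (rule has_vector_derivative_real_field)
  next
    show "((\<lambda>x. - C * Phi (z / w - w * complex_of_real x)) \<longlongrightarrow> - C * 0) at_top"
      by (intro tendsto_mult tendsto_const Phi_tendsto_0 w abs_Im_less_Re)
  qed (use int in \<open>auto intro!: continuous_intros\<close>)
  thus "(LINT s:{0..}|lborel. exp (- (w\<^sup>2) * complex_of_real s ^ 2 / 2 + z * complex_of_real s)) =
         complex_of_real (sqrt (2*pi)) / w * exp (z\<^sup>2 / (2 * w\<^sup>2)) * Phi (z / w)"
    by (simp add: C_def)
qed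

lemma has_bochner_integral_split_half_lines:
  fixes f :: "real \<Rightarrow> complex"
  assumes [measurable]: "f \<in> borel_measurable borel"
    and "set_integrable lborel {0..} f" "set_integrable lborel {0..} (\<lambda>x. f (-x))"
  shows "has_bochner_integral lborel f ((LINT x:{0..}|lborel. f x) + (LINT x:{0..}|lborel. f (-x)))"
proof -
  let ?g = "\<lambda>x. indicat_real {0..} x *\<^sub>R f x" and ?h = "\<lambda>x. indicat_real {0..} x *\<^sub>R f (-x)"
  have 1: "has_bochner_integral lborel ?g (LINT x:{0..}|lborel. f x)"
    using assms(2) by (simp add: has_bochner_integral_iff set_integrable_def set_lebesgue_integral_def)
  have h: "integrable lborel ?h" using assms(3) by (simp add: set_integrable_def)
  have 2: "has_bochner_integral lborel (\<lambda>x. ?h (-x)) (LINT x:{0..}|lborel. f (-x))"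
    using lborel_integrable_real_affine[OF h, of "-1" 0] lborel_integral_real_affine[of "-1" ?h 0]
    by (simp add: has_bochner_integral_iff set_lebesgue_integral_def)
  have "has_bochner_integral lborel (\<lambda>x. ?g x + ?h (-x))
          ((LINT x:{0..}|lborel. f x) + (LINT x:{0..}|lborel. f (-x)))"
    by (rule has_bochner_integral_add[OF 1 2])
  \<comment> \<open>The origin belongs to both half-lines and is removed as a null set.\<close>
  moreover have "AE x in lborel. ?g x + ?h (-x) = f x"
    using AE_lborel_singleton[of "0::real"] by eventually_elim (auto simp: indicator_def)
  ultimately show ?thesis
    by (subst (asm) has_bochner_integral_cong_AE[where g=f]) auto
qed

text \<open>Both half-lines give the same prefactor, once with \<open>Phi (z / w)\<close> and once
  with \<open>Phi (- z / w)\<close>, and these add up to 1. For imaginary \<open>z\<close> this is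
  the Fourier transform that linearises a square.\<close>

lemma has_bochner_integral_gaussian_fourier:
  assumes w: "Re w > 0" "Re (w\<^sup>2) > 0"
  shows "has_bochner_integral lborel (\<lambda>x::real. exp (- (w\<^sup>2) * complex_of_real x ^ 2 / 2 + z * complex_of_real x))
          (complex_of_real (sqrt (2*pi)) / w * exp (z\<^sup>2 / (2 * w\<^sup>2)))"
proof -
  let ?f = "\<lambda>z (x::real). exp (- (w\<^sup>2) * complex_of_real x ^ 2 / 2 + z * complex_of_real x)"
  have eq: "?f z (-x) = ?f (-z) x" for x by simp
  have "has_bochner_integral lborel (?f z) ((LINT x:{0..}|lborel. ?f z x) + (LINT x:{0..}|lborel. ?f z (-x)))"
    by (rule has_bochner_integral_split_half_lines)
       (use set_integrable_gaussian_half_line[OF w, of z] set_integrable_gaussian_half_line[OF w, of "-z"] in \<open>auto\<close>)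
  also have "(LINT x:{0..}|lborel. ?f z x) + (LINT x:{0..}|lborel. ?f z (-x)) =
      complex_of_real (sqrt (2*pi)) / w * exp (z\<^sup>2 / (2 * w\<^sup>2))"
    unfolding eq set_integral_gaussian_half_line[OF w]
    by (simp add: Phi_minus ring_distribs flip: add_divide_distrib)
  finally show ?thesis .
qed

text \<open>For real \<open>c\<close> a substitution leads to the Gamma integral; for complex
  \<open>c\<close> it would rotate the contour. A recursion in steps of two avoids this: k = 0 is
  the half-line Gaussian with the principal root of \<open>c\<close>, k = 1 has an elementary
  antiderivative, and the step matches the functional equation of Gamma.\<close>

lemma set_integral_gaussian_moment:
  assumes c: "Re c > 0"
  shows "(LINT r:{0..}|lborel. complex_of_real r ^ k * exp (- c * complex_of_real r ^ 2 / 2)) =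
     complex_of_real (2 powr ((real k - 1) / 2) * Gamma ((real k + 1) / 2)) * c powr (- (complex_of_nat k + 1) / 2)"
proof (induction k rule: less_induct)
  case (less k)
  have c0: "c \<noteq> 0" using c by auto
  have int: "set_integrable lborel {0..} (\<lambda>r. complex_of_real r ^ k * exp (- c * complex_of_real r ^ 2 / 2))" for k
    using set_integrable_power_gaussian[OF c, of k 0] by simp
  have lim: "((\<lambda>r. complex_of_real r ^ k * exp (- c * complex_of_real r ^ 2 / 2)) \<longlongrightarrow> 0) at_top" for k
  proof -
    have "((\<lambda>r::real. r ^ k * exp (- Re c * r ^ 2 / 2)) \<longlongrightarrow> 0) at_top"
      using c by real_asymp
    moreover have "eventually (\<lambda>r::real. r ^ k * exp (- Re c * r ^ 2 / 2) =
                      norm (complex_of_real r ^ k * exp (- c * complex_of_real r ^ 2 / 2))) at_top"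
      using eventually_ge_at_top[of 0]
      by eventually_elim (auto simp: norm_mult norm_power simp flip: of_real_power)
    ultimately have "((\<lambda>r. norm (complex_of_real r ^ k * exp (- c * complex_of_real r ^ 2 / 2))) \<longlongrightarrow> 0) at_top"
      by (rule Lim_transform_eventually)
    thus ?thesis by (simp only: tendsto_norm_zero_iff)
  qed
  consider "k = 0" | "k = 1" | m where "k = m + 2"
    by (metis One_nat_def add_2_eq_Suc' not0_implies_Suc)
  thus ?case
  proof cases
    case 1
    have w: "Re (csqrt c) > 0" "Re ((csqrt c)\<^sup>2) > 0"
      using c norm_ge_zero[of c] by (auto simp del: norm_ge_zero intro: add_nonneg_pos)
    have "csqrt c = c powr (1/2)" using csqrt_conv_powr[of c] c0 by simp
    hence "1 / csqrt c = c powr (-1/2)"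
      by (simp add: powr_minus divide_simps)
    moreover have "sqrt (2 * pi) / 2 = 2 powr (-1/2) * Gamma (1/2)"
      by (simp add: Gamma_one_half_real powr_minus powr_half_sqrt real_sqrt_mult field_simps)
    moreover have "complex_of_real (sqrt (2*pi)) / csqrt c * (1/2) = complex_of_real (sqrt (2*pi) / 2) * (1 / csqrt c)"
      by simp
    ultimately have "complex_of_real (sqrt (2*pi)) / csqrt c * (1/2) = complex_of_real (2 powr (-1/2) * Gamma (1/2)) * c powr (-1/2)"
      by (simp only:)
    thus ?thesis
      using set_integral_gaussian_half_line[OF w, of 0] 1 by simp
  next
    case 2
    have "(LINT r:{0..}|lborel. complex_of_real r ^ 1 * exp (- c * complex_of_real r ^ 2 / 2)) =
       - (1/c) * 0 - (- (1 / c) * (complex_of_real 0 ^ 0 * exp (- c * complex_of_real 0 ^ 2 / 2)))"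
    proof (rule set_integral_FTC_atLeast)
      fix r :: real
      have "((\<lambda>r. - (1 / c) * exp (- c * r ^ 2 / 2)) has_field_derivative
         complex_of_real r ^ 1 * exp (- c * complex_of_real r ^ 2 / 2)) (at (complex_of_real r))"
        using c0 by (auto intro!: derivative_eq_intros)
      thus "((\<lambda>r. - (1 / c) * (complex_of_real r ^ 0 * exp (- c * complex_of_real r ^ 2 / 2))) has_vector_derivative
         complex_of_real r ^ 1 * exp (- c * complex_of_real r ^ 2 / 2)) (at r)"
        using has_vector_derivative_real_field by force
    next
      show "((\<lambda>r. - (1 / c) * (complex_of_real r ^ 0 * exp (- c * complex_of_real r ^ 2 / 2))) \<longlongrightarrow> - (1 / c) * 0) at_top"
        by (intro tendsto_mult tendsto_const lim)
    qed (auto intro!: continuous_intros int[of 1, simplified])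
    thus ?thesis using c0 2 by (simp add: powr_minus field_simps)
  next
    case (3 m)
    let ?I = "\<lambda>k. (LINT r:{0..}|lborel. complex_of_real r ^ k * exp (- c * complex_of_real r ^ 2 / 2))"
    \<comment> \<open>\<open>?f\<close> is the derivative of r^(m+1) exp (-c r^2 / 2) / c, which
      vanishes at 0 and at infinity.\<close>
    let ?f = "\<lambda>r. of_nat (m + 1) / c * (complex_of_real r ^ m * exp (- c * complex_of_real r ^ 2 / 2))
         - complex_of_real r ^ (m+2) * exp (- c * complex_of_real r ^ 2 / 2)"
    have i1: "set_integrable lborel {0..} (\<lambda>r. of_nat (m + 1) / c * (complex_of_real r ^ m * exp (- c * complex_of_real r ^ 2 / 2)))"
      by (intro set_integrable_mult_right int)
    have "(LINT r:{0..}|lborel. ?f r) =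
       1 / c * 0 - 1 / c * (complex_of_real 0 ^ (m+1) * exp (- c * complex_of_real 0 ^ 2 / 2))"
    proof (rule set_integral_FTC_atLeast)
      fix r :: real
      have "((\<lambda>r. 1 / c * (r ^ (m+1) * exp (- c * r ^ 2 / 2))) has_field_derivative ?f r) (at (complex_of_real r))"
        using c0 by (cases "m = 0") (auto intro!: derivative_eq_intros simp: field_simps power_minus_mult simp flip: power_Suc, simp_all)
      thus "((\<lambda>r. 1 / c * (complex_of_real r ^ (m+1) * exp (- c * complex_of_real r ^ 2 / 2))) has_vector_derivative
         ?f r) (at r)"
        by (rule has_vector_derivative_real_field)
    next
      show "((\<lambda>r. 1 / c * (complex_of_real r ^ (m+1) * exp (- c * complex_of_real r ^ 2 / 2))) \<longlongrightarrow> 1 / c * 0) at_top"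
        by (intro tendsto_mult tendsto_const lim)
      show "set_integrable lborel {0..} ?f"
        by (intro set_integral_diff(1) i1 int)
    qed (use c0 in \<open>auto intro!: continuous_intros\<close>)
    hence "of_nat (m + 1) / c * ?I m - ?I (m+2) = 0"
      by (subst (asm) set_integral_diff(2)[OF i1 int]) (simp only: set_integral_mult_right, simp)
    hence "?I (m+2) = of_nat (m + 1) / c * ?I m" by simp
    also have "?I m = complex_of_real (2 powr ((real m - 1) / 2) * Gamma ((real m + 1) / 2)) * c powr (- (complex_of_nat m + 1) / 2)"
      using 3 by (intro less.IH) auto
    also have "of_nat (m + 1) / c * \<dots> = complex_of_real (real (m + 1) * 2 powr ((real m - 1) / 2) * Gamma ((real m + 1) / 2)) * (c powr (- (complex_of_nat m + 1) / 2) / c)"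
      by simp
    also have "real (m + 1) * 2 powr ((real m - 1) / 2) * Gamma ((real m + 1) / 2) = 2 powr ((real (m+2) - 1) / 2) * Gamma ((real (m+2) + 1) / 2)"
    proof -
      have "Gamma ((real (m+2) + 1) / 2) = Gamma ((real m + 1) / 2 + 1)" by (simp add: field_simps)
      also have "\<dots> = (real m + 1) / 2 * Gamma ((real m + 1) / 2)"
        by (rule Gamma_plus1) (auto dest!: nonpos_Ints_nonpos)
      finally have 1: "Gamma ((real (m+2) + 1) / 2) = (real m + 1) / 2 * Gamma ((real m + 1) / 2)" .
      have "(real (m+2) - 1) / 2 = (real m - 1) / 2 + 1" by (simp add: field_simps)
      hence 2: "2 powr ((real (m+2) - 1) / 2) = 2 * 2 powr ((real m - 1) / 2)" by (simp only: powr_add) simp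
      show ?thesis unfolding 1 2 by simp
    qed
    also have "c powr (- (complex_of_nat m + 1) / 2) / c = c powr (- (complex_of_nat m + 1) / 2 - 1)"
      using c0 by (simp add: powr_diff)
    also have "- (complex_of_nat m + 1) / 2 - 1 = - (complex_of_nat (m+2) + 1) / 2"
      by (simp add: field_simps)
    finally show ?thesis by (simp only: 3)
  qed
qed

section \<open>Polar coordinates on the orthant\<close>

definition corner_simplex :: "(real^'n) set" where
  "corner_simplex = {t. (\<forall>i. 0 \<le> t $ i) \<and> (\<Sum>i\<in>UNIV. t $ i) \<le> 1}"

definition pos_orthant :: "'a::euclidean_space set" where
  "pos_orthant = {x. \<forall>b\<in>Basis. 0 \<le> x \<bullet> b}"

lemma borel_pos_orthant [measurable]: "(pos_orthant :: 'a::euclidean_space set) \<in> sets borel"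
proof -
  have "pos_orthant = (\<Inter>b\<in>Basis. {x::'a. 0 \<le> x \<bullet> b})" by (auto simp: pos_orthant_def)
  also have "closed \<dots>" by (intro closed_INT ballI closed_Collect_le continuous_intros)
  finally have "closed (pos_orthant :: 'a set)" .
  thus ?thesis by (rule borel_closed)
qed

lemma mem_pos_orthant_iff:
  "(x :: (real^'n) \<times> real) \<in> pos_orthant \<longleftrightarrow> (\<forall>i. 0 \<le> fst x $ i) \<and> 0 \<le> snd x"
proof -
  have "(\<forall>b\<in>Basis. 0 \<le> t \<bullet> b) \<longleftrightarrow> (\<forall>i. 0 \<le> t $ i)" for t :: "real^'n"
    by (auto simp: Basis_vec_def inner_axis)
  thus ?thesis
    by (auto simp: pos_orthant_def Basis_prod_def inner_prod_def)
qed

text \<open>Polar coordinates whose radius r is the sum of the d + 1 coordinates: the direction is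
  given by d barycentric coordinates t, the remaining one being 1 minus their sum. The pair type
  provides the space of dimension d + 1.\<close>

definition cone_map :: "(real^'n) \<times> real \<Rightarrow> (real^'n) \<times> real" where
  "cone_map x = (snd x *\<^sub>R fst x, snd x * (1 - (\<Sum>i\<in>UNIV. fst x $ i)))"

text \<open>The Jacobian r^d of \<open>cone_map\<close>, cut off outside the parameter domain.
  Excluding the apex r = 0 changes no integral.\<close>

definition cone_density :: "(real^'n) \<times> real \<Rightarrow> real" where
  "cone_density x = indicator (corner_simplex \<times> {0<..}) x * snd x ^ CARD('n)"

lemma closed_corner_simplex: "closed (corner_simplex :: (real^'n) set)"
  unfolding corner_simplex_def by (intro closed_Collect_conj closed_Collect_all closed_Collect_le continuous_intros)

lemma borel_corner_simplex [measurable]: "(corner_simplex :: (real^'n) set) \<in> sets borel"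
  by (intro borel_closed closed_corner_simplex)

lemma borel_cone_map [measurable]: "(cone_map :: ((real^'n) \<times> real) \<Rightarrow> _) \<in> borel \<rightarrow>\<^sub>M borel"
  unfolding cone_map_def by (intro borel_measurable_continuous_onI continuous_intros)

lemma borel_cone_density [measurable]: "(cone_density :: ((real^'n) \<times> real) \<Rightarrow> real) \<in> borel \<rightarrow>\<^sub>M borel"
proof -
  have "corner_simplex \<times> {0<..} \<in> sets (borel \<Otimes>\<^sub>M borel :: ((real^'n) \<times> real) measure)"
    by (intro pair_measureI) auto
  hence [measurable]: "(corner_simplex \<times> {0<..} :: ((real^'n) \<times> real) set) \<in> sets borel"
    by (simp only: borel_prod)
  have [measurable]: "(snd :: ((real^'n) \<times> real) \<Rightarrow> real) \<in> borel \<rightarrow>\<^sub>M borel"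
    by (intro borel_measurable_continuous_onI continuous_intros)
  show ?thesis unfolding cone_density_def by measurable
qed

lemma cone_density_nonneg: "cone_density x \<ge> 0"
  by (auto simp: cone_density_def indicator_def)

lemma nn_integral_lborel_scaleR:
  fixes f :: "'a::euclidean_space \<Rightarrow> ennreal"
  assumes [measurable]: "f \<in> borel_measurable borel" and c: "c > 0"
  shows "(\<integral>\<^sup>+x. f x \<partial>lborel) = ennreal (c ^ DIM('a)) * (\<integral>\<^sup>+x. f (c *\<^sub>R x) \<partial>lborel)"
proof -
  have "(\<integral>\<^sup>+x. f x \<partial>lborel) = (\<integral>\<^sup>+x. f x \<partial>density (distr lborel borel (\<lambda>x. 0 + c *\<^sub>R x)) (\<lambda>_. \<bar>c\<bar>^DIM('a)))"
    using c by (subst lborel_affine[of c 0]) auto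
  also have "\<dots> = ennreal (c ^ DIM('a)) * (\<integral>\<^sup>+x. f (c *\<^sub>R x) \<partial>lborel)"
    using c by (simp add: nn_integral_density nn_integral_distr nn_integral_cmult)
  finally show ?thesis .
qed

text \<open>The Jacobian arises from two elementary maps. The shear that replaces the last
  coordinate by the sum of all of them preserves the measure; for fixed r > 0, scaling the other d
  coordinates by r contributes r^d.\<close>

lemma nn_integral_orthant:
  fixes G :: "(real^'n) \<times> real \<Rightarrow> ennreal"
  assumes G [measurable]: "G \<in> borel_measurable borel"
  shows "(\<integral>\<^sup>+x. indicator pos_orthant x * G x \<partial>lborel) =
         (\<integral>\<^sup>+x. ennreal (cone_density x) * G (cone_map x) \<partial>lborel)"
proof -
  have [measurable]: "(\<lambda>t::real^'n. \<Sum>i\<in>UNIV. t $ i) \<in> borel_measurable borel"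
    by (intro borel_measurable_continuous_onI continuous_intros)
  have [measurable]: "G \<in> borel_measurable (borel \<Otimes>\<^sub>M borel)" "G \<in> borel_measurable (lborel \<Otimes>\<^sub>M lborel)"
    "(indicator pos_orthant :: ((real^'n) \<times> real) \<Rightarrow> ennreal) \<in> borel_measurable (borel \<Otimes>\<^sub>M borel)"
    "(cone_density :: ((real^'n) \<times> real) \<Rightarrow> real) \<in> borel_measurable (borel \<Otimes>\<^sub>M borel)"
    "(cone_map :: ((real^'n) \<times> real) \<Rightarrow> _) \<in> (borel \<Otimes>\<^sub>M borel) \<rightarrow>\<^sub>M (borel \<Otimes>\<^sub>M borel)"
    "(pos_orthant :: ((real^'n) \<times> real) set) \<in> sets (borel \<Otimes>\<^sub>M borel)"
    by (simp_all only: borel_prod lborel_prod borel_pos_orthant borel_cone_map borel_cone_density assms measurable_lborel2 borel_measurable_indicator)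
  have [measurable]: "(\<lambda>p. fst p - (\<Sum>i\<in>UNIV. snd p $ i)) \<in> borel_measurable (borel \<Otimes>\<^sub>M (borel :: (real^'n) measure))"
    "(\<lambda>p. snd p - (\<Sum>i\<in>UNIV. fst p $ i)) \<in> borel_measurable ((borel :: (real^'n) measure) \<Otimes>\<^sub>M borel)"
    by measurable
  define H where "H = (\<lambda>t r. indicator pos_orthant (t, r - (\<Sum>i\<in>UNIV. t $ i)) * G (t, r - (\<Sum>i\<in>UNIV. t $ i)))"
  have H_meas [measurable]: "(\<lambda>p. H (fst p) (snd p)) \<in> borel_measurable (lborel \<Otimes>\<^sub>M lborel)"
    "\<And>r. (\<lambda>t. H t r) \<in> borel_measurable borel"
    unfolding H_def by measurable
  have "(\<integral>\<^sup>+x. indicator pos_orthant x * G x \<partial>lborel) = (\<integral>\<^sup>+t. \<integral>\<^sup>+t0. indicator pos_orthant (t,t0) * G (t,t0) \<partial>lborel \<partial>lborel)"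
    using lborel.nn_integral_fst[of "\<lambda>x. indicator pos_orthant x * G x" "lborel :: (real^'n) measure"]
    by (simp add: lborel_prod)
  also have "\<dots> = (\<integral>\<^sup>+t. \<integral>\<^sup>+r. H t r \<partial>lborel \<partial>lborel)"
  proof (rule nn_integral_cong)
    fix t :: "real^'n"
    show "(\<integral>\<^sup>+t0. indicator pos_orthant (t,t0) * G (t,t0) \<partial>lborel) = (\<integral>\<^sup>+r. H t r \<partial>lborel)"
      unfolding H_def
      by (subst nn_integral_real_affine[where c=1 and t="-(\<Sum>i\<in>UNIV. t $ i)"]) (auto simp: algebra_simps)
  qed
  also have "\<dots> = (\<integral>\<^sup>+r. \<integral>\<^sup>+t. H t r \<partial>lborel \<partial>lborel)"
    using lborel_pair.Fubini[of "\<lambda>p. H (fst p) (snd p)"] by simp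
  also have "\<dots> = (\<integral>\<^sup>+r. \<integral>\<^sup>+t. ennreal (cone_density (t,r)) * G (cone_map (t,r)) \<partial>lborel \<partial>lborel)"
  proof (rule nn_integral_cong_AE)
    show "AE r in lborel. (\<integral>\<^sup>+t. H t r \<partial>lborel) = (\<integral>\<^sup>+t. ennreal (cone_density (t,r)) * G (cone_map (t,r)) \<partial>lborel)"
      using AE_lborel_singleton[of "0::real"]
    proof eventually_elim
      case (elim r)
      show ?case
      proof (cases "r > 0")
        case True
        have "(\<integral>\<^sup>+t. H t r \<partial>lborel) = ennreal (r ^ CARD('n)) * (\<integral>\<^sup>+t. H (r *\<^sub>R t) r \<partial>lborel)"
          by (subst nn_integral_lborel_scaleR[OF _ True]) auto
        also have "\<dots> = (\<integral>\<^sup>+t. ennreal (r ^ CARD('n)) * H (r *\<^sub>R t) r \<partial>lborel)"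
          by (subst nn_integral_cmult) auto
        also have "\<dots> = (\<integral>\<^sup>+t. ennreal (cone_density (t,r)) * G (cone_map (t,r)) \<partial>lborel)"
        proof (intro nn_integral_cong)
          fix t :: "real^'n"
          have s: "r - (\<Sum>i\<in>UNIV. (r *\<^sub>R t) $ i) = r * (1 - (\<Sum>i\<in>UNIV. t $ i))"
            by (simp add: sum_distrib_left algebra_simps)
          have "(r *\<^sub>R t, r * (1 - (\<Sum>i\<in>UNIV. t $ i))) \<in> pos_orthant \<longleftrightarrow> t \<in> corner_simplex"
            using True by (auto simp: mem_pos_orthant_iff corner_simplex_def zero_le_mult_iff)
          thus "ennreal (r ^ CARD('n)) * H (r *\<^sub>R t) r = ennreal (cone_density (t,r)) * G (cone_map (t,r))"
            using True unfolding H_def s by (auto simp: cone_density_def cone_map_def indicator_def)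
        qed
        finally show ?thesis .
      next
        case False
        hence r: "r < 0" using elim by auto
        have "H t r = 0" for t
        proof -
          have "(\<Sum>i\<in>UNIV. t $ i) \<ge> 0" if "\<forall>i. t $ i \<ge> 0" using that by (intro sum_nonneg) auto
          hence "(t, r - (\<Sum>i\<in>UNIV. t $ i)) \<notin> pos_orthant" using r by (fastforce simp: mem_pos_orthant_iff)
          thus ?thesis by (simp add: H_def)
        qed
        moreover have "cone_density (t, r) = 0" for t :: "real^'n" using r by (simp add: cone_density_def indicator_def)
        ultimately show ?thesis by simp
      qed
    qed
  qed
  also have "\<dots> = (\<integral>\<^sup>+x. ennreal (cone_density x) * G (cone_map x) \<partial>lborel)"
    using lborel_pair.nn_integral_snd[of "\<lambda>x. ennreal (cone_density x) * G (cone_map x)"]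
    by (simp add: lborel_prod case_prod_beta)
  finally show ?thesis .
qed

text \<open>As an identity of measures the change of variables carries over to complex integrands,
  for integrability and for the value alike.\<close>

lemma distr_cone_map:
  "distr (density lborel (\<lambda>x. ennreal (cone_density x))) borel (cone_map :: (real^'n) \<times> real \<Rightarrow> _) =
     density lborel (\<lambda>x. ennreal (indicator pos_orthant x))"
proof (rule measure_eqI)
  fix A :: "((real^'n) \<times> real) set" assume "A \<in> sets (distr (density lborel (\<lambda>x. ennreal (cone_density x))) borel cone_map)"
  hence [measurable]: "A \<in> sets borel" by simp
  have "cone_map -` A \<in> sets (borel :: ((real^'n) \<times> real) measure)"
    using measurable_sets[OF borel_cone_map, of A] by simp
  hence "emeasure (distr (density lborel (\<lambda>x. ennreal (cone_density x))) borel cone_map) A =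
      (\<integral>\<^sup>+x. ennreal (cone_density x) * indicator A (cone_map x) \<partial>lborel)"
    by (subst emeasure_distr) (auto simp: emeasure_density indicator_def intro!: nn_integral_cong)
  also have "\<dots> = (\<integral>\<^sup>+x. indicator pos_orthant x * indicator A x \<partial>lborel)"
    by (rule nn_integral_orthant[symmetric]) auto
  also have "\<dots> = emeasure (density lborel (\<lambda>x. ennreal (indicator pos_orthant x))) A"
    by (subst emeasure_density) (auto simp: ennreal_indicator)
  finally show "emeasure (distr (density lborel (\<lambda>x. ennreal (cone_density x))) borel cone_map) A =
     emeasure (density lborel (\<lambda>x. ennreal (indicator pos_orthant x))) A" .
qed auto

lemma
  fixes F :: "(real^'n) \<times> real \<Rightarrow> complex"
  assumes [measurable]: "F \<in> borel_measurable borel"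
  shows integrable_orthant_iff:
      "set_integrable lborel pos_orthant F \<longleftrightarrow> integrable lborel (\<lambda>x. cone_density x *\<^sub>R F (cone_map x))"
    and set_integral_orthant:
      "(LINT x:pos_orthant|lborel. F x) = (LINT x|lborel. cone_density x *\<^sub>R F (cone_map x))"
proof -
  have "integrable (density lborel (\<lambda>x. ennreal (indicator pos_orthant x))) F \<longleftrightarrow> set_integrable lborel pos_orthant F"
    unfolding set_integrable_def by (subst integrable_density) auto
  moreover have "integrable (distr (density lborel (\<lambda>x. ennreal (cone_density x))) borel (cone_map :: (real^'n) \<times> real \<Rightarrow> _)) F
      \<longleftrightarrow> integrable lborel (\<lambda>x. cone_density x *\<^sub>R F (cone_map x))"
    by (subst integrable_distr_eq) (auto simp: integrable_density cone_density_nonneg)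
  ultimately show "set_integrable lborel pos_orthant F \<longleftrightarrow> integrable lborel (\<lambda>x. cone_density x *\<^sub>R F (cone_map x))"
    by (simp add: distr_cone_map)
  have "(LINT x|density lborel (\<lambda>x. ennreal (indicator pos_orthant x)). F x) = (LINT x:pos_orthant|lborel. F x)"
    unfolding set_lebesgue_integral_def by (subst integral_density) auto
  moreover have "(LINT x|distr (density lborel (\<lambda>x. ennreal (cone_density x))) borel (cone_map :: (real^'n) \<times> real \<Rightarrow> _). F x)
      = (LINT x|lborel. cone_density x *\<^sub>R F (cone_map x))"
    by (subst integral_distr) (auto simp: integral_density cone_density_nonneg)
  ultimately show "(LINT x:pos_orthant|lborel. F x) = (LINT x|lborel. cone_density x *\<^sub>R F (cone_map x))"
    by (simp add: distr_cone_map)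
qed

section \<open>Gaussian integrals over the orthant\<close>

lemma
  fixes f :: "real \<Rightarrow> complex"
  assumes "integrable lborel f"
  shows integrable_lborel_prod_Basis: "integrable lborel (\<lambda>x::'a::euclidean_space. \<Prod>b\<in>Basis. f (x \<bullet> b))"
    and integral_lborel_prod_Basis:
      "(LINT x|lborel. (\<Prod>b\<in>Basis. f ((x::'a) \<bullet> b))) = (LINT x|lborel. f x) ^ DIM('a)"
proof -
  interpret product_sigma_finite "\<lambda>_::'a. lborel :: real measure" ..
  have [measurable]: "f \<in> borel_measurable borel" using assms by auto
  let ?T = "\<lambda>y. \<Sum>b\<in>(Basis :: 'a set). y b *\<^sub>R b"
  have T: "(\<Prod>b\<in>Basis. f (?T y \<bullet> b)) = (\<Prod>b\<in>Basis. f (y b))" for y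
    by (intro prod.cong refl) simp
  show "integrable lborel (\<lambda>x::'a. \<Prod>b\<in>Basis. f (x \<bullet> b))"
    by (subst lborel_eq, subst integrable_distr_eq)
       (auto simp: T intro!: product_integrable_prod assms)
  show "(LINT x|lborel. (\<Prod>b\<in>Basis. f ((x::'a) \<bullet> b))) = (LINT x|lborel. f x) ^ DIM('a)"
    by (subst lborel_eq, subst integral_distr)
       (use product_integral_prod[of Basis "\<lambda>_. f"] assms in \<open>auto simp: T\<close>)
qed

lemma indicator_pos_orthant:
  "(\<Prod>b\<in>Basis. indicator {0..} (x \<bullet> b)) = (indicator pos_orthant x :: real)"
proof (cases "x \<in> pos_orthant")
  case True
  thus ?thesis by (auto simp: pos_orthant_def indicator_def)
next
  case False
  then obtain b where "b \<in> Basis" "\<not> 0 \<le> x \<bullet> b" by (auto simp: pos_orthant_def)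
  thus ?thesis using False by (auto simp: indicator_def intro!: prod_zero bexI[of _ b])
qed

text \<open>The integral of exp (-w^2 s^2 / 2 + \<i> \<xi> s) over s \<ge> 0, in the closed form of
  \<open>set_integral_gaussian_half_line\<close> with z = \<i> \<xi>.\<close>

definition gauss_laplace :: "complex \<Rightarrow> real \<Rightarrow> complex" where
  "gauss_laplace w \<xi> = complex_of_real (sqrt (2*pi)) / w * exp (- (complex_of_real \<xi>)\<^sup>2 / (2 * w\<^sup>2)) * Phi (\<i> * complex_of_real \<xi> / w)"

text \<open>Fubini for the function \<open>F\<close> of x and \<xi>: integrating out \<xi> is the
  Gaussian Fourier transform and yields \<open>q\<close> on the orthant, up to a constant;
  integrating out \<open>x\<close> yields one factor \<open>gauss_laplace\<close> per
  coordinate.\<close>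

lemma
  fixes w :: complex
  assumes w: "Re w > 0" "Re (w\<^sup>2) > 0"
  defines "q \<equiv> \<lambda>x::'a::euclidean_space. exp (- (w\<^sup>2) * complex_of_real (x \<bullet> x) / 2
              - (complex_of_real (\<Sum>b\<in>Basis. x \<bullet> b))\<^sup>2 / (2 * w\<^sup>2))"
  shows set_integrable_pos_orthant_gaussian: "set_integrable lborel pos_orthant q"
    and set_integral_pos_orthant_gaussian:
     "(LINT x:pos_orthant|lborel. q x) = w / complex_of_real (sqrt (2*pi)) *
        (LINT \<xi>|lborel. exp (- (w\<^sup>2) * complex_of_real \<xi> ^ 2 / 2) * gauss_laplace w \<xi> ^ DIM('a))"
    and integrable_gauss_laplace_power:
     "integrable lborel (\<lambda>\<xi>. exp (- (w\<^sup>2) * complex_of_real \<xi> ^ 2 / 2) * gauss_laplace w \<xi> ^ DIM('a))"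
proof -
  have w0: "w \<noteq> 0" using w by auto
  define g where "g = (\<lambda>\<xi> s::real. indicator {0..} s *\<^sub>R exp (- (w\<^sup>2) * complex_of_real s ^ 2 / 2 + \<i> * complex_of_real \<xi> * complex_of_real s))"
  define e where "e = (\<lambda>\<xi>::real. exp (- (w\<^sup>2) * complex_of_real \<xi> ^ 2 / 2))"
  define S where "S = (\<lambda>x::'a. \<Sum>b\<in>Basis. x \<bullet> b)"
  define F where "F = (\<lambda>(x::'a) \<xi>. e \<xi> * (\<Prod>b\<in>Basis. g \<xi> (x \<bullet> b)))"
  have g: "integrable lborel (g \<xi>)" "(LINT s|lborel. g \<xi> s) = gauss_laplace w \<xi>" for \<xi>
    using set_integrable_gaussian_half_line[OF w, of "\<i> * complex_of_real \<xi>"]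
      set_integral_gaussian_half_line[OF w, of "\<i> * complex_of_real \<xi>"]
    by (simp_all add: g_def set_integrable_def set_lebesgue_integral_def gauss_laplace_def power_mult_distrib)
  have e: "integrable lborel e"
    using has_bochner_integral_gaussian_fourier[OF w, of 0] by (simp add: has_bochner_integral_iff e_def)
  have F_eq: "F x \<xi> = indicator pos_orthant x *\<^sub>R (exp (- (w\<^sup>2) * complex_of_real (x \<bullet> x) / 2) *
                 exp (- (w\<^sup>2) * complex_of_real \<xi> ^ 2 / 2 + \<i> * complex_of_real (S x) * complex_of_real \<xi>))" for x \<xi>
  proof -
    have "(\<Prod>b\<in>Basis. g \<xi> (x \<bullet> b)) =
       complex_of_real (indicator pos_orthant x) * exp (\<Sum>b\<in>Basis. - (w\<^sup>2) * complex_of_real (x \<bullet> b) ^ 2 / 2 + \<i> * complex_of_real \<xi> * complex_of_real (x \<bullet> b))"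
      unfolding g_def scaleR_conv_of_real prod.distrib exp_sum[OF finite_Basis] of_real_prod[symmetric] indicator_pos_orthant ..
    also have "(\<Sum>b\<in>Basis. - (w\<^sup>2) * complex_of_real (x \<bullet> b) ^ 2 / 2 + \<i> * complex_of_real \<xi> * complex_of_real (x \<bullet> b)) =
       - (w\<^sup>2) * complex_of_real (x \<bullet> x) / 2 + \<i> * complex_of_real \<xi> * complex_of_real (S x)"
      unfolding euclidean_inner[of x x]
      by (simp add: S_def sum.distrib sum_distrib_left sum_distrib_right sum_divide_distrib sum_negf power2_eq_square sum_subtractf)
    finally show ?thesis
      unfolding F_def e_def by (simp only: exp_add scaleR_conv_of_real mult_ac)
  qed
  have [measurable]: "(\<lambda>p. F (fst p) (snd p)) \<in> borel_measurable (lborel \<Otimes>\<^sub>M lborel)"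
    unfolding F_eq S_def by measurable
  \<comment> \<open>The phases exp (\<i> \<xi> s) have modulus one, so the norm splits into a
    function of \<xi> and a function of \<open>x\<close>; absolute integrability reduces to Gaussian
    integrals without phase.\<close>
  have normF: "norm (F x \<xi>) = norm (e \<xi>) * norm (\<Prod>b\<in>Basis. g 0 (x \<bullet> b))" for x \<xi>
    by (simp add: F_def norm_mult prod_norm[symmetric] g_def)
  have int: "integrable (lborel \<Otimes>\<^sub>M lborel) (\<lambda>(x, \<xi>). F x \<xi>)"
  proof (rule lborel_pair.Fubini_integrable)
    show "(\<lambda>(x, \<xi>). F x \<xi>) \<in> borel_measurable (lborel \<Otimes>\<^sub>M lborel)"
      by (simp add: case_prod_beta)
    show "integrable lborel (\<lambda>x. LINT \<xi>|lborel. norm (case (x, \<xi>) of (x, \<xi>) \<Rightarrow> F x \<xi>))"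
      using integrable_lborel_prod_Basis[OF g(1)[of 0], where 'a='a] by (simp add: normF integrable_norm)
    show "AE x in lborel. integrable lborel (\<lambda>\<xi>. case (x, \<xi>) of (x, \<xi>) \<Rightarrow> F x \<xi>)"
    proof (intro AE_I2)
      fix x :: 'a
      have "integrable lborel (\<lambda>\<xi>. norm (e \<xi>) * norm (\<Prod>b\<in>Basis. g 0 (x \<bullet> b)))"
        using e by auto
      thus "integrable lborel (\<lambda>\<xi>. case (x, \<xi>) of (x, \<xi>) \<Rightarrow> F x \<xi>)"
      proof (rule Bochner_Integration.integrable_bound)
        show "(\<lambda>\<xi>. case (x, \<xi>) of (x, \<xi>) \<Rightarrow> F x \<xi>) \<in> borel_measurable lborel"
          unfolding F_eq by simp
      qed (simp add: normF)
    qed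
  qed
  have I1: "(LINT \<xi>|lborel. F x \<xi>) = complex_of_real (sqrt (2*pi)) / w * indicator pos_orthant x *\<^sub>R q x" for x
  proof -
    have "(LINT \<xi>|lborel. F x \<xi>) = indicator pos_orthant x *\<^sub>R (exp (- (w\<^sup>2) * complex_of_real (x \<bullet> x) / 2) *
       (complex_of_real (sqrt (2*pi)) / w * exp ((\<i> * complex_of_real (S x))\<^sup>2 / (2 * w\<^sup>2))))"
      using has_bochner_integral_integral_eq[OF has_bochner_integral_gaussian_fourier[OF w, of "\<i> * complex_of_real (S x)"]]
      unfolding F_eq by (simp only: integral_scaleR_right integral_mult_right_zero)
    also have "exp (- (w\<^sup>2) * complex_of_real (x \<bullet> x) / 2) * (complex_of_real (sqrt (2*pi)) / w * exp ((\<i> * complex_of_real (S x))\<^sup>2 / (2 * w\<^sup>2))) =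
      complex_of_real (sqrt (2*pi)) / w * (exp (- (w\<^sup>2) * complex_of_real (x \<bullet> x) / 2) * exp ((\<i> * complex_of_real (S x))\<^sup>2 / (2 * w\<^sup>2)))"
      by (simp only: mult_ac)
    also have "exp (- (w\<^sup>2) * complex_of_real (x \<bullet> x) / 2) * exp ((\<i> * complex_of_real (S x))\<^sup>2 / (2 * w\<^sup>2)) = q x"
      unfolding exp_add[symmetric] q_def S_def by (intro arg_cong[where f=exp]) (simp add: power_mult_distrib)
    finally show ?thesis by simp
  qed
  have I2: "(LINT x|lborel. F x \<xi>) = e \<xi> * gauss_laplace w \<xi> ^ DIM('a)" for \<xi>
    unfolding F_def using integral_lborel_prod_Basis[OF g(1)[of \<xi>], where 'a='a] by (simp add: g(2))
  have "integrable lborel (\<lambda>x. LINT \<xi>|lborel. F x \<xi>)"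
    using lborel_pair.integrable_fst'[OF int] by simp
  hence i: "integrable lborel (\<lambda>x. w / complex_of_real (sqrt (2*pi)) * (complex_of_real (sqrt (2*pi)) / w * indicator pos_orthant x *\<^sub>R q x))"
    unfolding I1 by (rule integrable_mult_right)
  have eq: "w / complex_of_real (sqrt (2*pi)) * (complex_of_real (sqrt (2*pi)) / w * z) = z" for z
    using w0 by simp
  show "set_integrable lborel pos_orthant q"
    using i unfolding set_integrable_def by (simp only: eq mult.assoc mult_scaleR_right mult_scaleR_left)
  have "(LINT \<xi>|lborel. LINT x|lborel. F x \<xi>) = (LINT x|lborel. LINT \<xi>|lborel. F x \<xi>)"
    by (rule lborel_pair.Fubini_integral[OF int])
  thus "(LINT x:pos_orthant|lborel. q x) = w / complex_of_real (sqrt (2*pi)) *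
        (LINT \<xi>|lborel. exp (- (w\<^sup>2) * complex_of_real \<xi> ^ 2 / 2) * gauss_laplace w \<xi> ^ DIM('a))"
    unfolding I1 I2 set_lebesgue_integral_def integral_mult_right_zero using w0 by (simp only: e_def eq)
  have "integrable lborel (\<lambda>\<xi>. LINT x|lborel. F x \<xi>)"
    using lborel_pair.integrable_snd[OF int] by simp
  thus "integrable lborel (\<lambda>\<xi>. exp (- (w\<^sup>2) * complex_of_real \<xi> ^ 2 / 2) * gauss_laplace w \<xi> ^ DIM('a))"
    unfolding I2 e_def .
qed

section \<open>Reduction to the standard simplex\<close>

definition bary :: "real^'n \<Rightarrow> (real^'n) \<times> real" where
  "bary t = (t, 1 - (\<Sum>i\<in>UNIV. t $ i))"

definition bary_sq :: "real^'n \<Rightarrow> real" where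
  "bary_sq t = bary t \<bullet> bary t"

lemma cone_map_eq: "cone_map x = snd x *\<^sub>R bary (fst x)"
  by (simp add: cone_map_def bary_def)

lemma sum_Basis_vec: "(\<Sum>b\<in>Basis. f ((t::real^'n) \<bullet> b)) = (\<Sum>i\<in>UNIV. f (t $ i))"
proof -
  have "(\<Sum>b\<in>Basis. f ((t::real^'n) \<bullet> b)) = (\<Sum>i\<in>UNIV. f (t \<bullet> axis i 1))"
    by (rule sum.reindex_cong[of "\<lambda>i. axis i 1"])
       (auto simp: Basis_vec_def inj_on_def axis_eq_axis)
  thus ?thesis by (simp add: inner_axis)
qed

lemma sum_Basis_vec_real:
  "(\<Sum>b\<in>Basis. f ((x :: (real^'n) \<times> real) \<bullet> b)) = (\<Sum>i\<in>UNIV. f (fst x $ i)) + f (snd x)"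
proof -
  have "(\<Sum>b\<in>Basis. f (x \<bullet> b)) = (\<Sum>b\<in>Basis. f (x \<bullet> (b, 0))) + (\<Sum>b\<in>Basis. f (x \<bullet> (0, b)))"
    by (simp only: Basis_prod_def, subst sum.union_disjoint)
       (auto simp: sum.reindex inj_on_def Basis_prod_def)
  also have "\<dots> = (\<Sum>b\<in>Basis. f (fst x \<bullet> b)) + f (snd x)"
    by (simp add: inner_prod_def)
  finally show ?thesis by (simp add: sum_Basis_vec)
qed

lemma sum_bary: "(\<Sum>b\<in>Basis. bary t \<bullet> b) = 1"
  by (simp add: sum_Basis_vec_real[where f="\<lambda>x. x"] bary_def)

lemma bary_in_pos_orthant: "bary t \<in> pos_orthant \<longleftrightarrow> t \<in> corner_simplex"
  by (auto simp: mem_pos_orthant_iff corner_simplex_def bary_def)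

lemma bary_sq_nonneg: "bary_sq t \<ge> 0"
  by (simp add: bary_sq_def)

lemma continuous_on_bary: "continuous_on A bary"
  unfolding bary_def by (intro continuous_intros)

lemma borel_bary [measurable]: "bary \<in> borel \<rightarrow>\<^sub>M borel"
  by (intro borel_measurable_continuous_onI continuous_on_bary)

lemma borel_bary_sq [measurable]: "bary_sq \<in> borel \<rightarrow>\<^sub>M borel"
  unfolding bary_sq_def by measurable

text \<open>On the cone over \<open>t\<close> the exponent of \<open>q\<close> is -(w^2 Q + 1 / w^2)
  r^2 / 2, so the radial integral is the Gaussian moment of order d. Its parameter has positive real
  part because 1 / w^2 lies in the right half-plane together with w^2.\<close>

lemma corner_simplex_gaussian_identity:
  assumes w: "Re w > 0" "Re (w\<^sup>2) > 0"
  shows "complex_of_real (2 powr ((real CARD('n) - 1) / 2) * Gamma ((real CARD('n) + 1) / 2)) *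
          (LINT t:(corner_simplex :: (real^'n) set)|lborel.
             (w\<^sup>2 * complex_of_real (bary_sq t) + 1 / w\<^sup>2) powr (- (of_nat CARD('n) + 1) / 2)) =
         w / complex_of_real (sqrt (2*pi)) *
          (LINT \<xi>|lborel. exp (- (w\<^sup>2) * complex_of_real \<xi> ^ 2 / 2) * gauss_laplace w \<xi> ^ (CARD('n) + 1))"
proof -
  define K where "K = complex_of_real (2 powr ((real CARD('n) - 1) / 2) * Gamma ((real CARD('n) + 1) / 2))"
  define c where "c = (\<lambda>t::real^'n. w\<^sup>2 * complex_of_real (bary_sq t) + 1 / w\<^sup>2)"
  define q where "q = (\<lambda>x::(real^'n) \<times> real. exp (- (w\<^sup>2) * complex_of_real (x \<bullet> x) / 2
              - (complex_of_real (\<Sum>b\<in>Basis. x \<bullet> b))\<^sup>2 / (2 * w\<^sup>2)))"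
  have w0: "w \<noteq> 0" using w by auto
  have q_meas: "q \<in> borel_measurable borel"
    unfolding q_def by measurable
  have qint: "set_integrable lborel pos_orthant q"
    using set_integrable_pos_orthant_gaussian[OF w] unfolding q_def .
  have c_pos: "Re (c t) > 0" for t
  proof -
    have "Re (inverse (w\<^sup>2)) > 0" using w(2) unfolding inverse_complex.sel by (intro divide_pos_pos) (auto simp: sum_power2_gt_zero_iff)
    moreover have "Re (w\<^sup>2 * complex_of_real (bary_sq t)) \<ge> 0"
      using w bary_sq_nonneg[of t] by (simp only: Re_complex_of_real Im_complex_of_real times_complex.sel) simp
    ultimately show ?thesis unfolding c_def by (simp add: inverse_eq_divide)
  qed
  have q_cone: "q (cone_map (t, r)) = exp (- c t * complex_of_real r ^ 2 / 2)" for t r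
  proof -
    have S: "(\<Sum>b\<in>Basis. cone_map (t, r) \<bullet> b) = r"
      using sum_bary[of t] by (simp add: cone_map_eq flip: sum_distrib_left)
    have N: "cone_map (t, r) \<bullet> cone_map (t, r) = r\<^sup>2 * bary_sq t"
      by (simp add: cone_map_eq bary_sq_def power2_eq_square)
    show ?thesis unfolding q_def S N c_def using w0 by (intro arg_cong[where f=exp]) (simp add: field_simps)
  qed
  have int: "integrable lborel (\<lambda>x. cone_density x *\<^sub>R q (cone_map x))"
    using qint integrable_orthant_iff[OF q_meas] by simp
  have "(LINT x|lborel. cone_density x *\<^sub>R q (cone_map x)) =
        (LINT t|lborel. LINT r|lborel. cone_density (t,r) *\<^sub>R q (cone_map (t,r)))"
    using lborel_pair.integral_fst'[of "\<lambda>x. cone_density x *\<^sub>R q (cone_map x)"] int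
    by (simp add: lborel_prod)
  also have "\<dots> = (LINT t|lborel. K * (indicator corner_simplex t *\<^sub>R c t powr (- (of_nat CARD('n) + 1) / 2)))"
  proof (rule Bochner_Integration.integral_cong[OF refl])
    fix t :: "real^'n"
    have "(LINT r|lborel. cone_density (t,r) *\<^sub>R q (cone_map (t,r))) =
          (LINT r|lborel. indicator corner_simplex t *\<^sub>R (indicator {0..} r *\<^sub>R (complex_of_real r ^ CARD('n) * exp (- c t * complex_of_real r ^ 2 / 2))))"
      unfolding q_cone
    proof (rule integral_cong_AE)
      \<comment> \<open>\<open>cone_density\<close> lives on r > 0, the moment formula on r \<ge>
        0.\<close>
      show "AE r in lborel. cone_density (t,r) *\<^sub>R exp (- c t * complex_of_real r ^ 2 / 2) =
         indicat_real corner_simplex t *\<^sub>R (indicat_real {0..} r *\<^sub>R (complex_of_real r ^ CARD('n) * exp (- c t * complex_of_real r ^ 2 / 2)))"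
        using AE_lborel_singleton[of "0::real"]
        by eventually_elim (auto simp: cone_density_def indicator_def scaleR_conv_of_real)
    qed (simp_all add: cone_density_def indicator_times case_prod_beta)
    also have "\<dots> = indicator corner_simplex t *\<^sub>R (LINT r:{0..}|lborel. complex_of_real r ^ CARD('n) * exp (- c t * complex_of_real r ^ 2 / 2))"
      unfolding set_lebesgue_integral_def by (rule integral_scaleR_right)
    also have "\<dots> = K * (indicator corner_simplex t *\<^sub>R c t powr (- (of_nat CARD('n) + 1) / 2))"
      unfolding set_integral_gaussian_moment[OF c_pos] K_def by (simp only: mult_scaleR_right)
    finally show "(LINT r|lborel. cone_density (t,r) *\<^sub>R q (cone_map (t,r))) = \<dots>" .
  qed
  also have "\<dots> = K * (LINT t:corner_simplex|lborel. c t powr (- (of_nat CARD('n) + 1) / 2))"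
    unfolding set_lebesgue_integral_def by (rule integral_mult_right_zero)
  finally have "K * (LINT t:corner_simplex|lborel. c t powr (- (of_nat CARD('n) + 1) / 2)) = (LINT x:pos_orthant|lborel. q x)"
    using set_integral_orthant[OF q_meas] by simp
  also have "\<dots> = w / complex_of_real (sqrt (2*pi)) *
          (LINT \<xi>|lborel. exp (- (w\<^sup>2) * complex_of_real \<xi> ^ 2 / 2) * gauss_laplace w \<xi> ^ DIM((real^'n) \<times> real))"
    using set_integral_pos_orthant_gaussian[OF w] unfolding q_def .
  also have "DIM((real^'n) \<times> real) = CARD('n) + 1" by simp
  finally show ?thesis unfolding K_def c_def .
qed

section \<open>Integrability of the limiting density\<close>

text \<open>The left side is singular only at the vertices. If s_k is the largest coordinate, then
  s_k \<ge> 1 / (d + 1) and 1 - Q, the sum of s_i (1 - s_i), is at least s_k (1 - s_k). The number m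
  = 1 - s_k dominates each of the d other coordinates, and a d = (d + 1) / 2, so the power of m
  splits into d factors m^(-a), each at most s_i^(-a).\<close>

lemma one_minus_sum_squares_powr_bound:
  fixes s :: "'i \<Rightarrow> real"
  assumes fin: "finite I" and card: "card I = Suc d" and d: "d > 0"
    and pos: "\<And>i. i \<in> I \<Longrightarrow> s i > 0" and sum: "(\<Sum>i\<in>I. s i) = 1"
  defines "a \<equiv> (real d + 1) / (2 * real d)"
  shows "(1 - (\<Sum>i\<in>I. (s i)\<^sup>2)) powr (- (real d + 1) / 2) \<le>
           (real d + 1) powr ((real d + 1) / 2) * (\<Prod>i\<in>I. s i powr (- a))"
proof -
  have ne: "I \<noteq> {}" using card by auto
  obtain k where k: "k \<in> I" "\<And>i. i \<in> I \<Longrightarrow> s i \<le> s k"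
  proof -
    have "Max (s ` I) \<in> s ` I" using fin ne by (intro Max_in) auto
    then obtain k where "k \<in> I" "s k = Max (s ` I)" by auto
    with that[of k] fin show ?thesis by simp
  qed
  have "1 \<le> (\<Sum>i\<in>I. s k)" using k(2) by (subst sum[symmetric]) (intro sum_mono, auto)
  hence sk: "s k \<ge> 1 / (real d + 1)" using card by (simp add: field_simps)
  define m where "m = 1 - s k"
  have m: "m = (\<Sum>i\<in>I-{k}. s i)"
    using sum fin k(1) by (simp add: m_def sum.remove)
  have le1: "s i \<le> m" if "i \<in> I - {k}" for i
    unfolding m using that fin pos by (intro member_le_sum) (auto simp: less_imp_le)
  have cardk: "card (I - {k}) = d" using k card fin by simp
  then obtain j where "j \<in> I - {k}" using d by (metis card_gt_0_iff ex_in_conv)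
  hence m_pos: "m > 0" using le1 pos by fastforce
  have "1 - (\<Sum>i\<in>I. (s i)\<^sup>2) = (\<Sum>i\<in>I. s i * (1 - s i))"
    by (simp add: right_diff_distrib sum_subtractf sum power2_eq_square)
  also have "\<dots> \<ge> s k * (1 - s k)"
  proof (rule member_le_sum)
    fix i assume i: "i \<in> I - {k}"
    have "s i \<le> 1" using member_le_sum[of i I s] i fin pos sum by (auto simp: less_imp_le)
    thus "0 \<le> s i * (1 - s i)" using pos[of i] i by auto
  qed (use fin k in auto)
  also have "s k * (1 - s k) \<ge> 1 / (real d + 1) * m"
    unfolding m_def[symmetric] using m_pos sk by (intro mult_right_mono) auto
  finally have "(1 - (\<Sum>i\<in>I. (s i)\<^sup>2)) powr (- (real d + 1) / 2) \<le> (1 / (real d + 1) * m) powr (- (real d + 1) / 2)"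
    using m_pos by (intro powr_mono2') auto
  also have "\<dots> = (real d + 1) powr ((real d + 1) / 2) * m powr (- (real d + 1) / 2)"
  proof -
    have "(1 / (real d + 1)) powr (- e) = (real d + 1) powr e" for e
      by (simp add: powr_divide powr_minus)
    from this[of "(real d + 1) / 2"]
    have "(1 / (real d + 1)) powr (- (real d + 1) / 2) = (real d + 1) powr ((real d + 1) / 2)"
      by (simp only: minus_divide_left)
    thus ?thesis using m_pos by (subst powr_mult) auto
  qed
  also have "m powr (- (real d + 1) / 2) = (\<Prod>i\<in>I-{k}. m powr (- a))"
  proof -
    have "(\<Prod>i\<in>I-{k}. m powr (- a)) = m powr (- a * real d)"
      using m_pos by (simp add: cardk powr_powr flip: powr_realpow)
    also have "- a * real d = - (real d + 1) / 2" using d by (simp add: a_def field_simps)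
    finally show ?thesis by simp
  qed
  also have "\<dots> \<le> (\<Prod>i\<in>I-{k}. s i powr (- a))"
    using le1 pos d by (intro prod_mono conjI powr_mono2') (auto simp: a_def)
  \<comment> \<open>The missing factor is at least 1; inserting it makes the bound symmetric, so
    that \<open>k\<close> disappears.\<close>
  also have "\<dots> \<le> s k powr (- a) * (\<Prod>i\<in>I-{k}. s i powr (- a))"
  proof -
    have "1 powr (- a) \<le> s k powr (- a)"
      using pos[OF k(1)] m_pos d by (intro powr_mono2') (auto simp: m_def a_def)
    thus ?thesis
      using mult_right_mono[of 1 "s k powr (- a)" "\<Prod>i\<in>I-{k}. s i powr (- a)"]
      by (auto simp: prod_nonneg)
  qed
  also have "\<dots> = (\<Prod>i\<in>I. s i powr (- a))"
    using fin k by (simp add: prod.remove)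
  finally show ?thesis by (simp add: mult_left_mono)
qed

text \<open>Each of the d + 1 barycentric coordinates vanishes only on a hyperplane. Such points
  must be set aside because \<open>0 powr (- a)\<close> is 0, not infinite, and the Dirichlet bound
  would fail there.\<close>

lemma AE_bary_nonzero: "AE t in lborel. \<forall>b\<in>Basis. bary (t :: real^'n) \<bullet> b \<noteq> 0"
proof -
  have hyp: "AE t in lborel. a \<bullet> t \<noteq> b" if "a \<noteq> 0 \<or> b \<noteq> 0" for a :: "real^'n" and b
  proof -
    have "{x. a \<bullet> x = b} \<in> null_sets lebesgue"
      using negligible_hyperplane[OF that] by (simp only: negligible_iff_null_sets)
    hence "AE t in lebesgue. t \<notin> {x. a \<bullet> x = b}" by (rule AE_not_in)
    thus ?thesis by (simp add: AE_completion_iff)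
  qed
  have "AE t in lborel. (t :: real^'n) $ i \<noteq> 0" for i
    using hyp[of "axis i 1" 0] by (simp add: inner_axis' axis_eq_0_iff)
  hence "AE t in lborel. \<forall>i. (t :: real^'n) $ i \<noteq> 0" by (simp add: AE_all_countable)
  moreover have "AE t in lborel. (\<chi> i. 1) \<bullet> (t :: real^'n) \<noteq> 1" by (rule hyp) simp
  ultimately show ?thesis
  proof eventually_elim
    case (elim t)
    have "(\<chi> i. 1) \<bullet> t = (\<Sum>i\<in>UNIV. t $ i)" by (simp add: inner_vec_def)
    with elim show ?case
      by (auto simp: bary_def Basis_prod_def inner_prod_def Basis_vec_def inner_axis)
  qed
qed

text \<open>A product of d + 1 Gamma densities s^(-a) exp (-s) has finite integral over the orthant.
  In polar form this integral is the Dirichlet integral times the positive number Gamma ((d + 1) (1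
  - a)), so the Dirichlet integral is finite too.\<close>

lemma nn_integral_dirichlet_finite:
  assumes a: "a < 1"
  shows "(\<integral>\<^sup>+t. indicator (corner_simplex :: (real^'n) set) t * ennreal (\<Prod>b\<in>Basis. (bary t \<bullet> b) powr (- a)) \<partial>lborel) < \<infinity>"
proof -
  let ?n = "real CARD('n) + 1"
  define f :: "real \<Rightarrow> real" where "f = (\<lambda>s. indicator {0..} s * s powr (- a) / exp s)"
  have [measurable]: "f \<in> borel_measurable borel" unfolding f_def by measurable
  define G where "G = (\<lambda>x::(real^'n) \<times> real. \<Prod>b\<in>Basis. ennreal (f (x \<bullet> b)))"
  have [measurable]: "G \<in> borel_measurable borel" unfolding G_def by measurable
  have "(\<integral>\<^sup>+s. ennreal (f s) \<partial>lborel) = ennreal (Gamma (1 - a))"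
    using Gamma_conv_nn_integral_real[of "1 - a"] a by (simp add: f_def)
  hence "(\<integral>\<^sup>+x. G x \<partial>lborel) < \<infinity>"
    unfolding G_def by (subst nn_integral_lborel_prod) (auto simp: power_less_top_ennreal ennreal_mult_less_top)
  moreover have "(\<integral>\<^sup>+x. indicator pos_orthant x * G x \<partial>lborel) \<le> (\<integral>\<^sup>+x. G x \<partial>lborel)"
    by (intro nn_integral_mono) (auto simp: indicator_def)
  ultimately have "(\<integral>\<^sup>+x. ennreal (cone_density x) * G (cone_map x) \<partial>lborel) < \<infinity>"
    by (simp add: nn_integral_orthant)
  also have "(\<integral>\<^sup>+x. ennreal (cone_density x) * G (cone_map x) \<partial>lborel) =
      (\<integral>\<^sup>+t. \<integral>\<^sup>+r. ennreal (cone_density (t,r)) * G (cone_map (t,r)) \<partial>lborel \<partial>lborel)"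
    using lborel.nn_integral_fst[of "\<lambda>x. ennreal (cone_density x) * G (cone_map x)" "lborel :: (real^'n) measure"]
    by (simp add: lborel_prod)
  also have "\<dots> = (\<integral>\<^sup>+t. (indicator (corner_simplex :: (real^'n) set) t * ennreal (\<Prod>b\<in>Basis. (bary t \<bullet> b) powr (- a)))
         * ennreal (Gamma (?n * (1 - a))) \<partial>lborel)"
  proof (rule nn_integral_cong)
    fix t :: "real^'n"
    have eq: "ennreal (cone_density (t,r)) * G (cone_map (t,r)) =
       (indicator corner_simplex t * ennreal (\<Prod>b\<in>Basis. (bary t \<bullet> b) powr (- a))) *
        ennreal (indicator {0..} r * r powr (?n * (1 - a) - 1) / exp r)" if "r \<noteq> 0" for r
    proof (cases "t \<in> corner_simplex \<and> r > 0")
      case True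
      hence "bary t \<in> pos_orthant" by (simp add: bary_in_pos_orthant)
      hence nn: "\<And>b. b \<in> Basis \<Longrightarrow> bary t \<bullet> b \<ge> 0" by (auto simp: pos_orthant_def)
      have "G (cone_map (t,r)) = ennreal (\<Prod>b\<in>Basis. f (r * (bary t \<bullet> b)))"
        unfolding G_def cone_map_eq by (subst prod_ennreal) (auto simp: f_def)
      also have "(\<Prod>b\<in>Basis. f (r * (bary t \<bullet> b))) = (\<Prod>b\<in>(Basis :: ((real^'n) \<times> real) set). r powr (- a) * (bary t \<bullet> b) powr (- a) * exp (- (r * (bary t \<bullet> b))))"
        using True nn by (intro prod.cong) (auto simp: f_def powr_mult exp_minus field_simps)
      also have "\<dots> = r powr (- a * ?n) * (\<Prod>b\<in>Basis. (bary t \<bullet> b) powr (- a)) * exp (- r)"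
      proof -
        have "(\<Prod>b\<in>(Basis :: ((real^'n) \<times> real) set). exp (- (r * (bary t \<bullet> b)))) = exp (\<Sum>b\<in>Basis. - (r * (bary t \<bullet> b)))"
          by (simp add: exp_sum)
        also have "(\<Sum>b\<in>Basis. - (r * (bary t \<bullet> b))) = - r"
          using sum_bary[of t] by (simp add: sum_negf flip: sum_distrib_left)
        finally have "(\<Prod>b\<in>(Basis :: ((real^'n) \<times> real) set). exp (- (r * (bary t \<bullet> b)))) = exp (- r)" .
        moreover have "(\<Prod>b\<in>(Basis :: ((real^'n) \<times> real) set). r powr (- a)) = r powr (- a * ?n)"
        proof -
          have "(\<Prod>b\<in>(Basis :: ((real^'n) \<times> real) set). r powr (- a)) = (r powr (- a)) powr ?n"
            using True powr_realpow[of "r powr (-a)" "CARD('n) + 1"] by (simp add: add.commute)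
          thus ?thesis by (simp add: powr_powr)
        qed
        ultimately show ?thesis by (simp only: prod.distrib)
      qed
      also have "ennreal (cone_density (t,r)) * ennreal \<dots> = ennreal (r ^ CARD('n) * (r powr (- a * ?n) * (\<Prod>b\<in>Basis. (bary t \<bullet> b) powr (- a)) * exp (- r)))"
        using True by (simp add: cone_density_def ennreal_mult')
      \<comment> \<open>The exponent of r collects d from the Jacobian and -a from each of d + 1
        factors.\<close>
      also have "r ^ CARD('n) * (r powr (- a * ?n) * (\<Prod>b\<in>Basis. (bary t \<bullet> b) powr (- a)) * exp (- r)) =
          (\<Prod>b\<in>Basis. (bary t \<bullet> b) powr (- a)) * (r powr (?n * (1 - a) - 1) / exp r)"
      proof -
        have "r ^ CARD('n) * r powr (- a * ?n) = r powr (real CARD('n) + (- a * ?n))"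
          using True powr_realpow[of r "CARD('n)"] by (simp only: powr_add)
        also have "real CARD('n) + (- a * ?n) = ?n * (1 - a) - 1" by (simp add: algebra_simps)
        finally show ?thesis by (simp add: exp_minus divide_inverse)
      qed
      finally show ?thesis using True by (simp add: prod_nonneg flip: ennreal_mult')
    next
      case False
      thus ?thesis using that by (auto simp: cone_density_def indicator_def)
    qed
    have "(\<integral>\<^sup>+r. ennreal (cone_density (t,r)) * G (cone_map (t,r)) \<partial>lborel) =
      (\<integral>\<^sup>+r. (indicator corner_simplex t * ennreal (\<Prod>b\<in>Basis. (bary t \<bullet> b) powr (- a))) *
        ennreal (indicator {0..} r * r powr (?n * (1 - a) - 1) / exp r) \<partial>lborel)"
      by (rule nn_integral_cong_AE, rule eventually_mono[OF AE_lborel_singleton[of "0::real"]]) (rule eq)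
    also have "\<dots> = (indicator corner_simplex t * ennreal (\<Prod>b\<in>Basis. (bary t \<bullet> b) powr (- a))) * ennreal (Gamma (?n * (1 - a)))"
      using a by (subst Gamma_conv_nn_integral_real, simp, subst nn_integral_cmult) auto
    finally show "(\<integral>\<^sup>+r. ennreal (cone_density (t,r)) * G (cone_map (t,r)) \<partial>lborel) = \<dots>" .
  qed
  also have "\<dots> = (\<integral>\<^sup>+t. indicator (corner_simplex :: (real^'n) set) t * ennreal (\<Prod>b\<in>Basis. (bary t \<bullet> b) powr (- a)) \<partial>lborel)
         * ennreal (Gamma (?n * (1 - a)))"
    by (rule nn_integral_multc) auto
  finally show ?thesis
  proof (rule contrapos_pp)
    assume "\<not> (\<integral>\<^sup>+t. indicator (corner_simplex :: (real^'n) set) t * ennreal (\<Prod>b\<in>Basis. (bary t \<bullet> b) powr (- a)) \<partial>lborel) < \<infinity>"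
    moreover have "Gamma (?n * (1 - a)) > 0" using a by (intro Gamma_real_pos) auto
    ultimately show "\<not> (\<integral>\<^sup>+t. indicator (corner_simplex :: (real^'n) set) t * ennreal (\<Prod>b\<in>Basis. (bary t \<bullet> b) powr (- a)) \<partial>lborel)
         * ennreal (Gamma (?n * (1 - a))) < \<infinity>"
      by (simp add: less_top[symmetric] ennreal_top_mult)
  qed
qed

lemma bary_sq_le_1:
  fixes t :: "real^'n"
  assumes "t \<in> corner_simplex"
  shows "bary_sq t \<le> 1"
proof -
  have nn: "\<And>b. b \<in> Basis \<Longrightarrow> bary t \<bullet> b \<ge> 0"
    using assms by (auto simp: pos_orthant_def simp flip: bary_in_pos_orthant)
  have "bary_sq t = (\<Sum>b\<in>Basis. (bary t \<bullet> b) * (bary t \<bullet> b))"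
    unfolding bary_sq_def by (rule euclidean_inner)
  also have "\<dots> \<le> (\<Sum>b\<in>Basis. bary t \<bullet> b)"
  proof (rule sum_mono)
    fix b :: "(real^'n) \<times> real" assume b: "b \<in> Basis"
    have "bary t \<bullet> b \<le> (\<Sum>b\<in>Basis. bary t \<bullet> b)" using b nn by (intro member_le_sum) auto
    thus "(bary t \<bullet> b) * (bary t \<bullet> b) \<le> bary t \<bullet> b"
      using nn[OF b] by (simp add: sum_bary mult_left_le_one_le)
  qed
  finally show ?thesis by (simp add: sum_bary)
qed

lemma set_integrable_bary_sq:
  assumes d: "CARD('n) \<ge> 2"
  shows "set_integrable lborel (corner_simplex :: (real^'n) set) (\<lambda>t. (1 - bary_sq t) powr (- (real CARD('n) + 1) / 2))"
proof -
  define a where "a = (real CARD('n) + 1) / (2 * real CARD('n))"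
  define C where "C = (real CARD('n) + 1) powr ((real CARD('n) + 1) / 2)"
  \<comment> \<open>(d + 1) / (2 d) < 1 holds exactly when d > 1.\<close>
  have "a < 1" using d by (simp add: a_def)
  note fin = nn_integral_dirichlet_finite[OF this, where 'n='n]
  have "integrable lborel (\<lambda>t::real^'n. indicat_real corner_simplex t * (\<Prod>b\<in>Basis. (bary t \<bullet> b) powr (- a)))"
  proof (rule integrableI_nonneg)
    show "(\<integral>\<^sup>+t. ennreal (indicat_real corner_simplex (t::real^'n) * (\<Prod>b\<in>Basis. (bary t \<bullet> b) powr (- a))) \<partial>lborel) < \<infinity>"
      using fin by (simp add: ennreal_mult' ennreal_indicator)
  qed (auto intro!: prod_nonneg mult_nonneg_nonneg AE_I2)
  hence "integrable lborel (\<lambda>t::real^'n. C * (indicat_real corner_simplex t * (\<Prod>b\<in>Basis. (bary t \<bullet> b) powr (- a))))"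
    by (rule integrable_mult_right)
  thus ?thesis
    unfolding set_integrable_def
  proof (rule Bochner_Integration.integrable_bound)
    show "AE t::real^'n in lborel. norm (indicat_real corner_simplex t *\<^sub>R (1 - bary_sq t) powr (- (real CARD('n) + 1) / 2)) \<le>
       norm (C * (indicat_real corner_simplex t * (\<Prod>b\<in>Basis. (bary t \<bullet> b) powr (- a))))"
      using AE_bary_nonzero
    proof eventually_elim
      case (elim t)
      show ?case
      proof (cases "t \<in> corner_simplex")
        case True
        hence nn: "\<And>b. b \<in> Basis \<Longrightarrow> bary t \<bullet> b > 0"
          using elim by (force simp: pos_orthant_def order_less_le simp flip: bary_in_pos_orthant)
        have sq: "bary_sq t = (\<Sum>b\<in>Basis. (bary t \<bullet> b)\<^sup>2)"
          unfolding bary_sq_def by (subst euclidean_inner) (simp add: power2_eq_square)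
        have "(1 - bary_sq t) powr (- (real CARD('n) + 1) / 2) \<le> C * (\<Prod>b\<in>Basis. (bary t \<bullet> b) powr (- a))"
          unfolding sq C_def a_def
          by (rule one_minus_sum_squares_powr_bound) (use nn sum_bary in auto)
        moreover have "C * (\<Prod>b\<in>Basis. (bary t \<bullet> b) powr (- a)) \<ge> 0"
          by (auto simp: C_def intro!: prod_nonneg mult_nonneg_nonneg)
        ultimately show ?thesis using True by simp
      qed simp
    qed
  qed auto
qed

section \<open>Uniform tail bounds for the oscillating integrals\<close>

lemma
  fixes b :: real
  assumes b: "b > 0"
  shows set_integrable_power_exp_scaled: "set_integrable lborel {0..} (\<lambda>s. s ^ k * exp (- b * s))"
    and set_integral_power_exp_scaled: "(LINT s:{0..}|lborel. s ^ k * exp (- b * s)) = fact k / b ^ Suc k"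
proof -
  define h :: "real \<Rightarrow> real" where "h = (\<lambda>s. indicator {0..} s *\<^sub>R (s ^ k * exp (- s)))"
  have h: "integrable lborel h"
    using set_integrable_power_exp[of k] by (simp add: set_integrable_def h_def)
  have "(LINT s|lborel. h s) = fact k"
  proof -
    have "ennreal (LINT s|lborel. h s) = (\<integral>\<^sup>+s. ennreal (h s) \<partial>lborel)"
      by (rule nn_integral_eq_integral[symmetric, OF h]) (auto simp: h_def indicator_def)
    also have "\<dots> = (\<integral>\<^sup>+x. ennreal (x^k * exp (-x)) * indicator {0 ..} x \<partial>lborel)"
      by (intro nn_integral_cong) (auto simp: indicator_def h_def)
    also have "\<dots> = ennreal (fact k)" by (subst nn_intergal_power_times_exp_Ici) simp
    finally show ?thesis
      by (subst (asm) ennreal_inj) (auto simp: h_def indicator_def intro!: Bochner_Integration.integral_nonneg)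
  qed
  moreover have "(LINT s|lborel. h s) = b * (LINT s|lborel. h (b * s))"
    using lborel_integral_real_affine[of b h 0] b by simp
  moreover have hb: "h (b * s) = b ^ k * (indicator {0..} s *\<^sub>R (s ^ k * exp (- b * s)))" for s
    using b by (auto simp: h_def indicator_def power_mult_distrib zero_le_mult_iff)
  ultimately have "fact k = b * (b ^ k * (LINT s:{0..}|lborel. s ^ k * exp (- b * s)))"
    by (simp add: set_lebesgue_integral_def)
  thus "(LINT s:{0..}|lborel. s ^ k * exp (- b * s)) = fact k / b ^ Suc k"
    using b by (simp add: field_simps)
  have "integrable lborel (\<lambda>s. h (b * s))"
    using lborel_integrable_real_affine[OF h, of b 0] b by simp
  hence "integrable lborel (\<lambda>s. 1 / b ^ k * h (b * s))" by (rule integrable_mult_right)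
  also have "(\<lambda>s. 1 / b ^ k * h (b * s)) = (\<lambda>s. indicator {0..} s *\<^sub>R (s ^ k * exp (- b * s)))"
    unfolding hb using b by auto
  finally show "set_integrable lborel {0..} (\<lambda>s. s ^ k * exp (- b * s))"
    unfolding set_integrable_def .
qed

text \<open>Mills' ratio, the normal tail divided by the density, taken at \<open>-z\<close> and
  continued to the plane. It decays along rays into the left half-plane and grows like a Gaussian
  along the positive axis.\<close>

definition mills :: "complex \<Rightarrow> complex" where
  "mills z = complex_of_real (sqrt (2*pi)) * exp (z\<^sup>2 / 2) * Phi z"

lemma mills_has_field_derivative: "(mills has_field_derivative z * mills z + 1) (at z)"
proof -
  have "exp (z\<^sup>2 / 2) * exp (- z\<^sup>2 / 2) = 1" by (simp flip: exp_add)
  hence "complex_of_real (sqrt (2*pi)) * (exp (z\<^sup>2 / 2) * (exp (- z\<^sup>2 / 2) / complex_of_real (sqrt (2*pi)))) = 1"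
    by simp
  thus ?thesis unfolding mills_def
    by (auto intro!: derivative_eq_intros simp: algebra_simps)
qed

lemma continuous_on_mills [continuous_intros]:
  "continuous_on A f \<Longrightarrow> continuous_on A (\<lambda>x. mills (f x))"
  unfolding mills_def by (intro continuous_intros) auto

lemma mills_eq_integral:
  "mills z = (LINT s:{0..}|lborel. exp (- (complex_of_real s ^ 2) / 2 + z * complex_of_real s))"
  using set_integral_gaussian_half_line[of 1 z] by (simp add: mills_def)

lemma mills_plus_mills_minus: "mills z + mills (-z) = complex_of_real (sqrt (2*pi)) * exp (z\<^sup>2 / 2)"
  by (simp add: mills_def Phi_minus algebra_simps)

text \<open>The left side is the derivative of \<open>mills\<close>. The cancellation between
  \<open>z * mills z\<close> and 1 is visible only in this first moment, which decays one order
  faster than \<open>mills\<close> itself.\<close>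

lemma mills_ode_eq_integral:
  "z * mills z + 1 = (LINT s:{0..}|lborel. complex_of_real s * exp (- (complex_of_real s ^ 2) / 2 + z * complex_of_real s))"
proof -
  define E where "E = (\<lambda>s::real. exp (- (complex_of_real s ^ 2) / 2 + z * complex_of_real s))"
  have i0: "set_integrable lborel {0..} E"
    using set_integrable_power_gaussian[of 1 0 z] by (simp add: E_def)
  have i1: "set_integrable lborel {0..} (\<lambda>s. complex_of_real s * E s)"
    using set_integrable_power_gaussian[of 1 1 z] by (simp add: E_def)
  have i2: "set_integrable lborel {0..} (\<lambda>s. z * E s)"
    by (rule set_integrable_mult_right) (rule i0)
  have "(LINT s:{0..}|lborel. z * E s - complex_of_real s * E s) = 0 - E 0"
  proof (rule set_integral_FTC_atLeast)
    fix s :: real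
    have "((\<lambda>s. exp (- (s ^ 2) / 2 + z * s)) has_field_derivative z * E s - complex_of_real s * E s) (at (complex_of_real s))"
      by (auto intro!: derivative_eq_intros simp: E_def algebra_simps)
    thus "(E has_vector_derivative z * E s - complex_of_real s * E s) (at s)"
      unfolding E_def by (rule has_vector_derivative_real_field)
  next
    have "((\<lambda>s::real. exp (- (s ^ 2) / 2 + Re z * s)) \<longlongrightarrow> 0) at_top" by real_asymp
    moreover have "(\<lambda>s::real. exp (- (s ^ 2) / 2 + Re z * s)) = (\<lambda>s. norm (E s))"
      by (auto simp: E_def simp flip: of_real_power)
    ultimately show "(E \<longlongrightarrow> 0) at_top" by (simp add: tendsto_norm_zero_iff)
  next
    show "set_integrable lborel {0..} (\<lambda>s. z * E s - complex_of_real s * E s)"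
      by (intro set_integral_diff(1) i1 i2)
  qed (auto simp: E_def intro!: continuous_intros)
  hence "z * (LINT s:{0..}|lborel. E s) - (LINT s:{0..}|lborel. complex_of_real s * E s) = -1"
    by (subst (asm) set_integral_diff(2)[OF i2 i1]) (simp only: set_integral_mult_right, simp add: E_def)
  thus ?thesis unfolding mills_eq_integral E_def by (simp add: algebra_simps)
qed

text \<open>The exponent is majorised by a line a - b s, which turns the moment into a Gamma
  integral. The line is left open because bounded and decaying estimates call for different
  ones.\<close>

lemma norm_gaussian_half_line_moment_le:
  assumes b: "b > 0" and le: "\<And>s. s \<ge> 0 \<Longrightarrow> - s\<^sup>2 / 2 + Re z * s \<le> a - b * s"
  shows "norm (LINT s:{0..}|lborel. complex_of_real s ^ k * exp (- (complex_of_real s ^ 2) / 2 + z * complex_of_real s))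
          \<le> exp a * (fact k / b ^ Suc k)"
proof -
  have int: "set_integrable lborel {0..} (\<lambda>s. complex_of_real s ^ k * exp (- (complex_of_real s ^ 2) / 2 + z * complex_of_real s))"
    using set_integrable_power_gaussian[of 1 k z] by simp
  have int2: "set_integrable lborel {0..} (\<lambda>s. exp a * (s ^ k * exp (- b * s)))"
    by (intro set_integrable_mult_right set_integrable_power_exp_scaled b)
  have "norm (LINT s:{0..}|lborel. complex_of_real s ^ k * exp (- (complex_of_real s ^ 2) / 2 + z * complex_of_real s))
     \<le> (LINT s:{0..}|lborel. norm (complex_of_real s ^ k * exp (- (complex_of_real s ^ 2) / 2 + z * complex_of_real s)))"
    by (rule set_integral_norm_bound) (rule int)
  also have "\<dots> \<le> (LINT s:{0..}|lborel. exp a * (s ^ k * exp (- b * s)))"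
  proof (rule set_integral_mono)
    show "set_integrable lborel {0..} (\<lambda>s. norm (complex_of_real s ^ k * exp (- (complex_of_real s ^ 2) / 2 + z * complex_of_real s)))"
      by (rule set_integrable_norm) (rule int)
    fix s :: real assume s: "s \<in> {0..}"
    have "norm (complex_of_real s ^ k * exp (- (complex_of_real s ^ 2) / 2 + z * complex_of_real s)) = s ^ k * exp (- s\<^sup>2 / 2 + Re z * s)"
      using s by (simp add: norm_mult norm_power flip: of_real_power)
    also have "\<dots> \<le> s ^ k * exp (a - b * s)"
      using s le by (intro mult_left_mono) auto
    finally show "norm (complex_of_real s ^ k * exp (- (complex_of_real s ^ 2) / 2 + z * complex_of_real s)) \<le> exp a * (s ^ k * exp (- b * s))"
      by (simp add: exp_diff exp_minus field_simps)
  qed (rule int2)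
  also have "\<dots> = exp a * (fact k / b ^ Suc k)"
    by (simp only: set_integral_mult_right set_integral_power_exp_scaled[OF b])
  finally show ?thesis .
qed

lemma norm_mills_le:
  assumes "Re z \<le> 0"
  shows "norm (mills z) \<le> 3"
proof -
  \<comment> \<open>The tangent of -s^2 / 2 at s = 1; the resulting exp (1/2) is rounded up to
    3.\<close>
  have "- s\<^sup>2 / 2 + Re z * s \<le> 1 / 2 - 1 * s" if "s \<ge> 0" for s
  proof -
    have "Re z * s \<le> 0" using assms that by (simp add: mult_nonpos_nonneg)
    moreover have "0 \<le> (s - 1)\<^sup>2" by simp
    ultimately show ?thesis by (simp add: power2_eq_square algebra_simps)
  qed
  from norm_gaussian_half_line_moment_le[OF _ this, of 0]
  have "norm (mills z) \<le> exp (1/2)" by (simp add: mills_eq_integral)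
  also have "\<dots> \<le> exp (1::real)" by simp
  also have "\<dots> \<le> 3" by (rule exp_le)
  finally show ?thesis .
qed

text \<open>The Gaussian factor is discarded: the decay exp (-y s / 2) alone has moments 2 / y and 4
  / y^2.\<close>

lemma
  assumes y: "y > 0" and z: "Re z \<le> - y / 2"
  shows norm_mills_le_inverse: "norm (mills z) \<le> 2 / y"
    and norm_mills_ode_le: "norm (z * mills z + 1) \<le> 4 / y\<^sup>2"
proof -
  have le: "- s\<^sup>2 / 2 + Re z * s \<le> 0 - (y/2) * s" if "s \<ge> 0" for s
  proof -
    have "Re z * s \<le> - (y / 2 * s)" using mult_right_mono[OF z that] by simp
    thus ?thesis using zero_le_power2[of s] by linarith
  qed
  show "norm (mills z) \<le> 2 / y"
    using norm_gaussian_half_line_moment_le[of "y/2" z 0 0] le y by (simp add: mills_eq_integral)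
  show "norm (z * mills z + 1) \<le> 4 / y\<^sup>2"
    using norm_gaussian_half_line_moment_le[of "y/2" z 0 1] le y
    by (simp add: mills_ode_eq_integral power2_eq_square)
qed

text \<open>Interchange of the limits in \<open>n\<close> and in the upper end \<open>B\<close>: the
  tails are C / B uniformly in \<open>n\<close>, while convergence in \<open>n\<close> is needed
  only for fixed \<open>B\<close>. The tail bound for \<open>T\<close> also provides the existence
  of the limit.\<close>

lemma uniform_tail_swap:
  fixes T :: "real \<Rightarrow> complex" and S :: "nat \<Rightarrow> real \<Rightarrow> complex"
  assumes tailT: "\<And>B B'. 1 \<le> B \<Longrightarrow> B \<le> B' \<Longrightarrow> norm (T B' - T B) \<le> C / B"
    and tailS: "\<And>n B B'. 1 \<le> B \<Longrightarrow> B \<le> B' \<Longrightarrow> norm (S n B' - S n B) \<le> C / B"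
    and limS: "\<And>n. (S n \<longlongrightarrow> J n) at_top"
    and conv: "\<And>B. 1 \<le> B \<Longrightarrow> (\<lambda>n. S n B) \<longlonglongrightarrow> T B"
  shows "\<exists>L. (T \<longlongrightarrow> L) at_top \<and> J \<longlonglongrightarrow> L"
proof -
  have C: "C \<ge> 0" using tailT[of 1 1] by simp
  have small: "\<exists>B\<ge>1. C / B < e" if "e > 0" for e
  proof (intro exI conjI)
    show "1 \<le> C / e + 1" using C that by simp
    have "C < (C / e + 1) * e" using that C by (simp add: field_simps)
    moreover have "C / e + 1 > 0" using C that by (auto intro: add_nonneg_pos)
    ultimately show "C / (C / e + 1) < e" by (simp add: pos_divide_less_eq mult.commute)
  qed
  \<comment> \<open>The candidate limit is found along integer \<open>B\<close>; the tail bound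
    extends it to real \<open>B\<close>.\<close>
  have "Cauchy (\<lambda>n. T (real n))"
  proof (rule CauchyI')
    fix e :: real assume "e > 0"
    then obtain B where B: "B \<ge> 1" "C / B < e" using small by blast
    show "\<exists>M. \<forall>m\<ge>M. \<forall>n>m. dist (T (real m)) (T (real n)) < e"
    proof (intro exI[of _ "nat \<lceil>B\<rceil>"] allI impI)
      fix m n assume mn: "nat \<lceil>B\<rceil> \<le> m" "m < n"
      hence m: "B \<le> real m" by linarith
      have "norm (T (real n) - T (real m)) \<le> C / real m" using mn m B by (intro tailT) auto
      also have "\<dots> \<le> C / B" using m B C by (intro divide_left_mono) auto
      finally show "dist (T (real m)) (T (real n)) < e" using B by (simp add: dist_norm norm_minus_commute)
    qed
  qed
  then obtain L where L: "(\<lambda>n. T (real n)) \<longlonglongrightarrow> L" using Cauchy_convergent convergent_def by blast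
  have TL: "norm (L - T B) \<le> C / B" if "B \<ge> 1" for B
  proof (rule tendsto_upperbound)
    show "(\<lambda>n. norm (T (real n) - T B)) \<longlonglongrightarrow> norm (L - T B)" by (intro tendsto_intros L)
    have "eventually (\<lambda>n. real n \<ge> B) sequentially" by real_asymp
    thus "eventually (\<lambda>n. norm (T (real n) - T B) \<le> C / B) sequentially"
      by eventually_elim (intro tailT that)
  qed simp
  have JS: "norm (J n - S n B) \<le> C / B" if "B \<ge> 1" for B n
  proof (rule tendsto_upperbound)
    show "((\<lambda>B'. norm (S n B' - S n B)) \<longlongrightarrow> norm (J n - S n B)) at_top" by (intro tendsto_intros limS)
    show "eventually (\<lambda>B'. norm (S n B' - S n B) \<le> C / B) at_top"
      using eventually_ge_at_top[of B] by eventually_elim (intro tailS that)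
  qed simp
  have "(T \<longlongrightarrow> L) at_top"
  proof (rule LIM_zero_cancel, rule Lim_null_comparison)
    show "eventually (\<lambda>B. norm (T B - L) \<le> C / B) at_top"
      using eventually_ge_at_top[of 1] by eventually_elim (use TL in \<open>simp add: norm_minus_commute\<close>)
    show "((\<lambda>B. C / B) \<longlongrightarrow> 0) at_top" by real_asymp
  qed
  moreover have "J \<longlonglongrightarrow> L"
  proof (rule LIMSEQ_I)
    fix e :: real assume e: "e > 0"
    then obtain B where B: "B \<ge> 1" "C / B < e / 3" using small[of "e/3"] by auto
    obtain N where N: "\<And>n. n \<ge> N \<Longrightarrow> norm (S n B - T B) < e / 3"
      using LIMSEQ_D[OF conv[OF B(1)], of "e/3"] e by auto
    show "\<exists>N. \<forall>n\<ge>N. norm (J n - L) < e"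
    proof (intro exI[of _ N] allI impI)
      fix n assume "n \<ge> N"
      have "J n - L = (J n - S n B) + (S n B - T B) + (T B - L)" by simp
      also have "norm \<dots> \<le> norm (J n - S n B) + norm (S n B - T B) + norm (T B - L)"
        by (meson add_mono norm_triangle_ineq order_trans order_refl)
      also have "\<dots> < e" using JS[OF B(1), of n] TL[OF B(1)] N[OF \<open>n \<ge> N\<close>] B(2)
        by (simp add: norm_minus_commute)
      finally show "norm (J n - L) < e" .
    qed
  qed
  ultimately show ?thesis by blast
qed

section \<open>Integration by parts for oscillating Gaussians\<close>

lemma has_integral_inverse_square:
  assumes "0 < B" "B \<le> B'"
  shows "((\<lambda>y::real. A / y\<^sup>2) has_integral (A / B - A / B')) {B..B'}"
proof -
  have "((\<lambda>y::real. A / y\<^sup>2) has_integral ((- A / B') - (- A / B))) {B..B'}"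
    by (rule fundamental_theorem_of_calculus)
       (use assms in \<open>auto simp: has_real_derivative_iff_has_vector_derivative[symmetric] power2_eq_square intro!: derivative_eq_intros\<close>)
  thus ?thesis by (simp add: algebra_simps)
qed

lemma norm_integral_inverse_square_le:
  fixes g :: "real \<Rightarrow> complex"
  assumes B: "0 < B" "B \<le> B'" and g: "g integrable_on {B..B'}"
    and le: "\<And>y. y \<in> {B..B'} \<Longrightarrow> norm (g y) \<le> A / y\<^sup>2" and A: "A \<ge> 0"
  shows "norm (integral {B..B'} g) \<le> A / B"
proof -
  have "norm (integral {B..B'} g) \<le> integral {B..B'} (\<lambda>y. A / y\<^sup>2)"
    using has_integral_inverse_square[OF B] le by (intro integral_norm_bound_integral g) auto
  also have "\<dots> = A / B - A / B'" using has_integral_inverse_square[OF B] by (rule integral_unique)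
  also have "\<dots> \<le> A / B" using A B by simp
  finally show ?thesis .
qed

lemma norm_oscillatory_integral_le:
  fixes \<phi> \<phi>' :: "real \<Rightarrow> complex"
  assumes c: "Re c \<ge> 0" "norm c \<ge> 1" and B: "1 \<le> B" "B \<le> B'"
    and der: "\<And>y. y \<in> {B..B'} \<Longrightarrow> (\<phi> has_vector_derivative \<phi>' y) (at y within {B..B'})"
    and cont: "continuous_on {B..B'} \<phi>'"
    and bound: "\<And>y. y \<in> {B..B'} \<Longrightarrow> norm (\<phi> y) \<le> M" "\<And>y. y \<in> {B..B'} \<Longrightarrow> norm (\<phi>' y) \<le> M / y"
  shows "norm (integral {B..B'} (\<lambda>y. exp (- c * complex_of_real y ^ 2 / 2) * \<phi> y)) \<le> 4 * M / B"
proof -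
  define E where "E = (\<lambda>y::real. exp (- c * complex_of_real y ^ 2 / 2))"
  define G where "G = (\<lambda>y. - (E y * \<phi> y / (c * complex_of_real y)))"
  define R where "R = (\<lambda>y. E y * (\<phi>' y / y - \<phi> y / y\<^sup>2) / c)"
  have c0: "c \<noteq> 0" using c by auto
  have "norm (\<phi> B) \<le> M" using bound(1) B by auto
  hence M: "M \<ge> 0" by (rule order_trans[OF norm_ge_zero])
  have E_le: "norm (E y) \<le> 1" for y using c by (simp add: E_def flip: of_real_power)
  have cont\<phi>: "continuous_on {B..B'} \<phi>"
    unfolding continuous_on_eq_continuous_within using der has_vector_derivative_continuous by blast
  have E_der: "(E has_vector_derivative (- c * y * E y)) (at y within {B..B'})" for y
  proof -
    have "((\<lambda>y. exp (- c * y ^ 2 / 2)) has_field_derivative (- c * complex_of_real y * E y)) (at (complex_of_real y))"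
      by (auto intro!: derivative_eq_intros simp: E_def)
    thus ?thesis unfolding E_def by (rule has_vector_derivative_real_field)
  qed
  have inv_der: "((\<lambda>y. 1 / complex_of_real y) has_vector_derivative (- 1 / complex_of_real (y\<^sup>2))) (at y within {B..B'})" if "y \<in> {B..B'}" for y
  proof (rule has_vector_derivative_real_field)
    show "((\<lambda>y. 1 / y) has_field_derivative (- 1 / complex_of_real (y\<^sup>2))) (at (complex_of_real y))"
      using that B by (auto intro!: derivative_eq_intros simp: power2_eq_square)
  qed
  have G_der: "(G has_vector_derivative (E y * \<phi> y - R y)) (at y within {B..B'})" if y: "y \<in> {B..B'}" for y
  proof -
    have y0: "y \<noteq> 0" using y B by auto
    have "((\<lambda>y. (- 1 / c) * (E y * \<phi> y * (1 / complex_of_real y))) has_vector_derivative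
        (- 1 / c) * (E y * \<phi> y * (- 1 / complex_of_real (y\<^sup>2)) + (E y * \<phi>' y + (- c * y * E y) * \<phi> y) * (1 / complex_of_real y))) (at y within {B..B'})"
      by (intro has_vector_derivative_mult_right has_vector_derivative_mult E_der der y inv_der)
    also have "(\<lambda>y. (- 1 / c) * (E y * \<phi> y * (1 / complex_of_real y))) = G"
      by (auto simp: G_def field_simps)
    also have "(- 1 / c) * (E y * \<phi> y * (- 1 / complex_of_real (y\<^sup>2)) + (E y * \<phi>' y + (- c * y * E y) * \<phi> y) * (1 / complex_of_real y)) = E y * \<phi> y - R y"
      using c0 y0 by (simp add: R_def field_simps power2_eq_square)
    finally show ?thesis .
  qed
  have int1: "((\<lambda>y. E y * \<phi> y - R y) has_integral (G B' - G B)) {B..B'}"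
    by (rule fundamental_theorem_of_calculus) (use B G_der in auto)
  have contR: "continuous_on {B..B'} R"
    unfolding R_def E_def using B c0 by (intro continuous_intros cont cont\<phi>) auto
  have intR: "R integrable_on {B..B'}" by (rule integrable_continuous_real) (rule contR)
  have "((\<lambda>y. (E y * \<phi> y - R y) + R y) has_integral (G B' - G B + integral {B..B'} R)) {B..B'}"
    by (intro has_integral_add int1 integrable_integral intR)
  hence "integral {B..B'} (\<lambda>y. E y * \<phi> y) = G B' - G B + integral {B..B'} R"
    by (simp add: integral_unique)
  also have "norm \<dots> \<le> norm (G B') + norm (G B) + norm (integral {B..B'} R)"
    by (meson add_mono norm_triangle_ineq norm_triangle_ineq4 order_trans order_refl)
  also have "\<dots> \<le> M / B + M / B + 2 * M / B"
  proof (intro add_mono)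
    have G_le: "norm (G y) \<le> M / B" if y: "y \<in> {B..B'}" for y
    proof -
      have "norm (G y) = norm (E y) * norm (\<phi> y) / (norm c * y)"
        using y B by (simp add: G_def norm_mult norm_divide)
      also have "\<dots> \<le> (1 * M) / (1 * B)"
        using y B c E_le[of y] bound(1)[OF y] M by (intro frac_le mult_mono mult_nonneg_nonneg) auto
      finally show ?thesis by simp
    qed
    show "norm (G B') \<le> M / B" "norm (G B) \<le> M / B" using G_le B by auto
    show "norm (integral {B..B'} R) \<le> 2 * M / B"
    proof (rule norm_integral_inverse_square_le)
      fix y assume y: "y \<in> {B..B'}"
      have "norm (R y) = norm (E y) * norm (\<phi>' y / y - \<phi> y / y\<^sup>2) / norm c"
        by (simp add: R_def norm_mult norm_divide)
      also have "\<dots> \<le> 1 * (norm (\<phi>' y / y) + norm (\<phi> y / y\<^sup>2)) / 1"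
        using c E_le[of y] by (intro frac_le mult_mono norm_triangle_ineq4) auto
      also have "norm (\<phi>' y / y) = norm (\<phi>' y) / y" using y B by (simp add: norm_divide)
      also have "\<dots> \<le> (M / y) / y" using bound(2)[OF y] y B by (intro divide_right_mono) auto
      also have "norm (\<phi> y / y\<^sup>2) = norm (\<phi> y) / y\<^sup>2" by (simp add: norm_divide norm_power)
      also have "\<dots> \<le> M / y\<^sup>2" using bound(1)[OF y] by (intro divide_right_mono) auto
      finally show "norm (R y) \<le> 2 * M / y\<^sup>2" by (simp add: power2_eq_square)
    qed (use B M intR in auto)
  qed
  finally show ?thesis unfolding E_def by (simp add: field_simps)
qed

text \<open>The integrand of the Fourier side, with n = d + 1 factors in the application. At arg w =
  \<pi> / 4 its first exponential has modulus one.\<close>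

definition osc :: "nat \<Rightarrow> complex \<Rightarrow> real \<Rightarrow> complex" where
  "osc n w y = exp (- (w\<^sup>2) * complex_of_real y ^ 2 / 2) * gauss_laplace w y ^ n"

lemma gauss_laplace_eq_mills: "gauss_laplace w y = mills (\<i> * complex_of_real y / w) / w"
  by (simp add: gauss_laplace_def mills_def power_mult_distrib power_divide field_simps)

lemma continuous_on_osc:
  assumes "w \<noteq> 0" shows "continuous_on A (osc n w)" "continuous_on A (\<lambda>y. osc n w (-y))"
  unfolding osc_def gauss_laplace_eq_mills using assms by (intro continuous_intros; simp)+

lemma tendsto_osc:
  assumes "w \<noteq> 0" "X \<longlonglongrightarrow> w"
  shows "(\<lambda>m. osc n (X m) y) \<longlonglongrightarrow> osc n w y"
proof -
  have "isCont mills z" for z using mills_has_field_derivative by (rule DERIV_isCont)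
  hence "(\<lambda>m. mills (\<i> * complex_of_real y / X m)) \<longlonglongrightarrow> mills (\<i> * complex_of_real y / w)"
    by (rule isCont_tendsto_compose) (intro tendsto_intros assms)
  thus ?thesis unfolding osc_def gauss_laplace_eq_mills
    by (intro tendsto_intros assms) auto
qed

lemma osc_neg: "osc n w (-y) = exp (- (w\<^sup>2) * complex_of_real y ^ 2 / 2) * (mills (- (\<i> * complex_of_real y / w)) / w) ^ n"
  by (simp add: osc_def gauss_laplace_eq_mills)

text \<open>For y > 0 and Im w > 0 the point \<i> y / w lies in the right half-plane, where
  \<open>mills\<close> need not decay. The reflection formula replaces \<open>mills\<close> there by
  a Gaussian minus its value at the opposite point, which does decay. In the binomial expansion
  \<open>k\<close> counts the Gaussian factors, and they change the rate w^2 to w^2 + k /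
  w^2.\<close>

lemma osc_binomial:
  assumes "w \<noteq> 0"
  shows "osc n w y = (\<Sum>k\<le>n. of_nat (n choose k) * complex_of_real (sqrt (2*pi)) ^ k / w ^ n *
    (exp (- (w\<^sup>2 + of_nat k / w\<^sup>2) * complex_of_real y ^ 2 / 2) * (- mills (- (\<i> * complex_of_real y / w))) ^ (n - k)))"
proof -
  define a where "a = complex_of_real (sqrt (2*pi)) * exp (- (complex_of_real y ^ 2) / (2 * w\<^sup>2))"
  define b where "b = - mills (- (\<i> * complex_of_real y / w))"
  have ab: "mills (\<i> * complex_of_real y / w) = a + b"
    using mills_plus_mills_minus[of "\<i> * complex_of_real y / w"]
    by (simp add: a_def b_def power_mult_distrib power_divide eq_diff_eq mult.commute)
  have "osc n w y = exp (- (w\<^sup>2) * complex_of_real y ^ 2 / 2) * (a + b) ^ n / w ^ n"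
    by (simp add: osc_def gauss_laplace_eq_mills power_divide ab)
  also have "\<dots> = (\<Sum>k\<le>n. exp (- (w\<^sup>2) * complex_of_real y ^ 2 / 2) * (of_nat (n choose k) * a ^ k * b ^ (n - k)) / w ^ n)"
    unfolding binomial_ring sum_distrib_left sum_divide_distrib ..
  also have "\<dots> = (\<Sum>k\<le>n. of_nat (n choose k) * complex_of_real (sqrt (2*pi)) ^ k / w ^ n *
    (exp (- (w\<^sup>2 + of_nat k / w\<^sup>2) * complex_of_real y ^ 2 / 2) * b ^ (n - k)))"
  proof (rule sum.cong[OF refl])
    fix k
    have "a ^ k = complex_of_real (sqrt (2*pi)) ^ k * exp (of_nat k * (- (complex_of_real y ^ 2) / (2 * w\<^sup>2)))"
      by (simp only: a_def power_mult_distrib exp_of_nat_mult)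
    moreover have "exp (- (w\<^sup>2) * complex_of_real y ^ 2 / 2) * exp (of_nat k * (- (complex_of_real y ^ 2) / (2 * w\<^sup>2))) =
      exp (- (w\<^sup>2 + of_nat k / w\<^sup>2) * complex_of_real y ^ 2 / 2)"
      unfolding exp_add[symmetric] using assms by (intro arg_cong[where f=exp]) (simp add: field_simps)
    ultimately show "exp (- (w\<^sup>2) * complex_of_real y ^ 2 / 2) * (of_nat (n choose k) * a ^ k * b ^ (n - k)) / w ^ n =
      of_nat (n choose k) * complex_of_real (sqrt (2*pi)) ^ k / w ^ n *
    (exp (- (w\<^sup>2 + of_nat k / w\<^sup>2) * complex_of_real y ^ 2 / 2) * b ^ (n - k))"
      by (simp add: mult_ac)
  qed
  finally show ?thesis unfolding b_def .
qed

text \<open>The unit vectors with \<pi> / 6 \<le> arg w \<le> \<pi> / 4 satisfy these conditions,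
  including the limiting direction, so all estimates below survive the passage to the boundary. The
  bound on \<open>Im w\<close> gives -\<i> y / w a real part of at most -y / 2, uniformly in
  \<open>w\<close>.\<close>

locale stokes_sector =
  fixes w :: complex
  assumes norm_w: "norm w = 1" and Re_w2: "Re (w\<^sup>2) \<ge> 0" and Im_w: "Im w \<ge> 1/2"
begin

lemma w_nonzero: "w \<noteq> 0" using norm_w by auto

lemma inverse_w: "1 / w = cnj w"
  using norm_w by (simp add: complex_div_cnj[of 1 w])

lemma Re_arg: "y \<ge> 0 \<Longrightarrow> Re (- (\<i> * complex_of_real y / w)) \<le> - y / 2"
proof -
  assume y: "y \<ge> 0"
  have "- (\<i> * complex_of_real y / w) = - (\<i> * complex_of_real y * (1 / w))" by simp
  also have "Re \<dots> = - (y * Im w)" unfolding inverse_w by simp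
  also have "\<dots> \<le> - y / 2" using mult_left_mono[OF Im_w y] by simp
  finally show ?thesis .
qed

lemma Re_arg_le_0: "y \<ge> 0 \<Longrightarrow> Re (- (\<i> * complex_of_real y / w)) \<le> 0"
  using Re_arg[of y] by linarith

text \<open>On the unit circle 1 / w^2 is the conjugate of w^2, so both have the same nonnegative
  real part. The lower bound on the norm says nothing for k \<le> 1, and rightly so: at w^2 = \<i>
  the rate for k = 1 is zero and the oscillation is lost.\<close>

lemma norm_exp_le: "norm (exp (- (w\<^sup>2 + of_nat k / w\<^sup>2) * complex_of_real y ^ 2 / 2)) \<le> 1"
  and Re_rate: "Re (w\<^sup>2 + of_nat k / w\<^sup>2) \<ge> 0"
  and norm_rate: "norm (w\<^sup>2 + of_nat k / w\<^sup>2) \<ge> real k - 1"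
proof -
  have "of_nat k / w\<^sup>2 = of_nat k * (cnj w)\<^sup>2"
    by (simp add: inverse_w[symmetric] power_divide)
  moreover have "Re ((cnj w)\<^sup>2) = Re (w\<^sup>2)" by (simp add: power2_eq_square)
  ultimately show *: "Re (w\<^sup>2 + of_nat k / w\<^sup>2) \<ge> 0" using Re_w2 by simp
  have "Re (- c * complex_of_real y ^ 2 / 2) = - (Re c * y\<^sup>2 / 2)" for c
    by (simp flip: of_real_power)
  hence "Re (- (w\<^sup>2 + of_nat k / w\<^sup>2) * complex_of_real y ^ 2 / 2) = - (Re (w\<^sup>2 + of_nat k / w\<^sup>2) * y\<^sup>2 / 2)"
    by blast
  also have "\<dots> \<le> 0" using * by simp
  finally show "norm (exp (- (w\<^sup>2 + of_nat k / w\<^sup>2) * complex_of_real y ^ 2 / 2)) \<le> 1" by simp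
  have "norm (of_nat k / w\<^sup>2 :: complex) = real k" "norm (w\<^sup>2) = 1"
    using norm_w by (simp_all add: norm_divide norm_power)
  thus "norm (w\<^sup>2 + of_nat k / w\<^sup>2) \<ge> real k - 1"
    using norm_diff_ineq[of "of_nat k / w\<^sup>2" "w\<^sup>2"] by (simp add: add.commute)
qed

lemma norm_osc_neg_le:
  assumes "y \<ge> 0"
  shows "norm (osc n w (-y)) \<le> norm (mills (- (\<i> * complex_of_real y / w))) ^ n"
proof -
  have "norm (osc n w (-y)) = norm (exp (- (w\<^sup>2 + of_nat 0 / w\<^sup>2) * complex_of_real y ^ 2 / 2)) *
     norm (mills (- (\<i> * complex_of_real y / w))) ^ n"
    by (simp add: osc_neg norm_mult norm_power norm_divide norm_w)
  also have "\<dots> \<le> 1 * norm (mills (- (\<i> * complex_of_real y / w))) ^ n"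
    by (intro mult_right_mono norm_exp_le) auto
  finally show ?thesis by simp
qed

text \<open>The bound depends neither on \<open>w\<close> nor on \<open>y\<close>, so it serves as
  the dominating constant on bounded intervals.\<close>

lemma norm_osc_bounded:
  assumes "y \<ge> 0"
  shows "norm (osc n w y + osc n w (-y)) \<le> (\<Sum>k\<le>n. real (n choose k) * sqrt (2*pi) ^ k * 3 ^ (n - k)) + 3 ^ n"
proof -
  have m: "norm (mills (- (\<i> * complex_of_real y / w))) \<le> 3"
    by (intro norm_mills_le Re_arg_le_0 assms)
  have "norm (osc n w y) \<le> (\<Sum>k\<le>n. real (n choose k) * sqrt (2*pi) ^ k * 3 ^ (n - k))"
    unfolding osc_binomial[OF w_nonzero]
  proof (rule sum_norm_le)
    fix k
    have "norm (of_nat (n choose k) * complex_of_real (sqrt (2*pi)) ^ k / w ^ n *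
    (exp (- (w\<^sup>2 + of_nat k / w\<^sup>2) * complex_of_real y ^ 2 / 2) * (- mills (- (\<i> * complex_of_real y / w))) ^ (n - k)))
     = real (n choose k) * sqrt (2*pi) ^ k * (norm (exp (- (w\<^sup>2 + of_nat k / w\<^sup>2) * complex_of_real y ^ 2 / 2)) * norm (mills (- (\<i> * complex_of_real y / w))) ^ (n - k))"
      by (simp only: norm_mult norm_divide norm_power norm_w norm_minus_cancel norm_of_nat norm_of_real) simp
    also have "\<dots> \<le> real (n choose k) * sqrt (2*pi) ^ k * (1 * 3 ^ (n - k))"
      by (intro mult_left_mono mult_mono norm_exp_le power_mono m) auto
    finally show "norm (of_nat (n choose k) * complex_of_real (sqrt (2*pi)) ^ k / w ^ n *
    (exp (- (w\<^sup>2 + of_nat k / w\<^sup>2) * complex_of_real y ^ 2 / 2) * (- mills (- (\<i> * complex_of_real y / w))) ^ (n - k)))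
       \<le> real (n choose k) * sqrt (2*pi) ^ k * 3 ^ (n - k)" by simp
  qed
  moreover have "norm (osc n w (-y)) \<le> 3 ^ n"
    using norm_osc_neg_le[OF assms, of n] power_mono[OF m, of n] by simp
  ultimately show ?thesis by (intro order_trans[OF norm_triangle_ineq] add_mono)
qed

text \<open>Two mechanisms cover all terms. With at least two decaying factors the term is O(1 /
  y^2) in modulus. With at most one, k \<ge> n - 1 \<ge> 2, so the rate has norm at least 1 and the
  oscillation gives the decay. The non-oscillating case k = 1 falls under the former because n \<ge>
  3.\<close>

lemma osc_term_tail:
  assumes n: "n \<ge> 3" and k: "k \<le> n" and B: "1 \<le> B" "B \<le> B'"
  shows "norm (integral {B..B'} (\<lambda>y. exp (- (w\<^sup>2 + of_nat k / w\<^sup>2) * complex_of_real y ^ 2 / 2) *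
           (- mills (- (\<i> * complex_of_real y / w))) ^ (n - k))) \<le> (2 ^ n + 16) / B"
proof (cases "n - k \<ge> 2")
  case True
  have "norm (integral {B..B'} (\<lambda>y. exp (- (w\<^sup>2 + of_nat k / w\<^sup>2) * complex_of_real y ^ 2 / 2) *
           (- mills (- (\<i> * complex_of_real y / w))) ^ (n - k))) \<le> 2 ^ n / B"
  proof (rule norm_integral_inverse_square_le)
    show "(\<lambda>y. exp (- (w\<^sup>2 + of_nat k / w\<^sup>2) * complex_of_real y ^ 2 / 2) *
           (- mills (- (\<i> * complex_of_real y / w))) ^ (n - k)) integrable_on {B..B'}"
      using w_nonzero by (intro integrable_continuous_real continuous_intros) auto
    fix y assume y: "y \<in> {B..B'}"
    have "norm (exp (- (w\<^sup>2 + of_nat k / w\<^sup>2) * complex_of_real y ^ 2 / 2) *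
           (- mills (- (\<i> * complex_of_real y / w))) ^ (n - k)) \<le> 1 * (2 / y) ^ (n - k)"
      unfolding norm_mult norm_power norm_minus_cancel
      using y B by (intro mult_mono norm_exp_le power_mono norm_mills_le_inverse Re_arg) auto
    also have "\<dots> = 2 ^ (n - k) / y ^ (n - k)" by (simp add: power_divide)
    also have "\<dots> \<le> 2 ^ n / y ^ 2"
      using y B True by (intro frac_le power_increasing) auto
    finally show "norm (exp (- (w\<^sup>2 + of_nat k / w\<^sup>2) * complex_of_real y ^ 2 / 2) *
           (- mills (- (\<i> * complex_of_real y / w))) ^ (n - k)) \<le> 2 ^ n / y ^ 2" .
  qed (use B in auto)
  also have "\<dots> \<le> (2 ^ n + 16) / B" using B by (intro divide_right_mono) auto
  finally show ?thesis .
next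
  case False
  define j where "j = n - k"
  have j: "j \<le> 1" using False by (auto simp: j_def)
  have "real k - 1 \<ge> 1" using False n k by linarith
  hence rate: "norm (w\<^sup>2 + of_nat k / w\<^sup>2) \<ge> 1" using norm_rate[of k] by linarith
  define z where "z = (\<lambda>y::real. - (\<i> * complex_of_real y / w))"
  define \<phi>' where "\<phi>' = (\<lambda>y. if j = 0 then 0 else (z y * mills (z y) + 1) * (\<i> / w))"
  \<comment> \<open>M = 4 covers the bounds 3 and 1 for the factor itself and 4 / y^2 \<le> 4 / y
    for its derivative; with the 4 of the integration by parts this is the 16.\<close>
  have "norm (integral {B..B'} (\<lambda>y. exp (- (w\<^sup>2 + of_nat k / w\<^sup>2) * complex_of_real y ^ 2 / 2) *
           (- mills (z y)) ^ j)) \<le> 4 * 4 / B"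
  proof (rule norm_oscillatory_integral_le[where \<phi>' = \<phi>'])
    fix y assume y: "y \<in> {B..B'}"
    show "((\<lambda>y. (- mills (z y)) ^ j) has_vector_derivative \<phi>' y) (at y within {B..B'})"
    proof (cases "j = 0")
      case False
      hence j1: "j = 1" using j by simp
      have "((\<lambda>y. - mills (- (\<i> * y / w))) has_field_derivative (z y * mills (z y) + 1) * (\<i> / w)) (at (complex_of_real y))"
        using w_nonzero by (auto intro!: derivative_eq_intros DERIV_chain2[OF mills_has_field_derivative] simp: z_def)
      from has_vector_derivative_real_field[OF this]
      show ?thesis using False by (simp add: j1 \<phi>'_def z_def)
    qed (simp add: \<phi>'_def)
    show "norm ((- mills (z y)) ^ j) \<le> 4"
    proof -
      have "norm (mills (z y)) \<le> 3" unfolding z_def using y B by (intro norm_mills_le Re_arg_le_0) auto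
      thus ?thesis using j by (cases j) auto
    qed
    show "norm (\<phi>' y) \<le> 4 / y"
    proof -
      have "norm (z y * mills (z y) + 1) \<le> 4 / y\<^sup>2"
        unfolding z_def using y B by (intro norm_mills_ode_le Re_arg) auto
      also have "\<dots> \<le> 4 / y" using y B by (intro divide_left_mono) (auto simp: power2_eq_square)
      finally have "norm (z y * mills (z y) + 1) \<le> 4 / y" .
      thus ?thesis using y B norm_w by (auto simp: \<phi>'_def norm_mult norm_divide)
    qed
  next
    show "continuous_on {B..B'} \<phi>'"
      unfolding \<phi>'_def z_def using w_nonzero by (cases "j = 0") (auto intro!: continuous_intros)
  qed (use B rate Re_rate in auto)
  also have "\<dots> \<le> (2 ^ n + 16) / B" using B by (intro divide_right_mono) auto
  finally show ?thesis by (simp add: j_def z_def)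
qed

text \<open>Only the side \<open>y\<close> needs the expansion. On the side \<open>-y\<close> all
  \<open>n\<close> factors decay, which accounts for the separate summand 2^n.\<close>

lemma osc_tail:
  assumes n: "n \<ge> 3" and B: "1 \<le> B" "B \<le> B'"
  shows "norm (integral {B..B'} (\<lambda>y. osc n w y + osc n w (-y))) \<le>
          ((\<Sum>k\<le>n. real (n choose k) * sqrt (2*pi) ^ k * (2 ^ n + 16)) + 2 ^ n) / B"
proof -
  define tm where "tm = (\<lambda>k y. exp (- (w\<^sup>2 + of_nat k / w\<^sup>2) * complex_of_real y ^ 2 / 2) * (- mills (- (\<i> * complex_of_real y / w))) ^ (n - k))"
  define coef where "coef = (\<lambda>k. of_nat (n choose k) * complex_of_real (sqrt (2*pi)) ^ k / w ^ n)"
  have osc: "osc n w y = (\<Sum>k\<le>n. coef k * tm k y)" for y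
    by (simp only: osc_binomial[OF w_nonzero] coef_def tm_def)
  have int_tm: "tm k integrable_on {B..B'}" for k
    unfolding tm_def using w_nonzero by (intro integrable_continuous_real continuous_intros) auto
  have int: "(\<lambda>y. osc n w y) integrable_on {B..B'}" "(\<lambda>y. osc n w (-y)) integrable_on {B..B'}"
    by (intro integrable_continuous_real continuous_on_osc w_nonzero)+
  have "integral {B..B'} (\<lambda>y. osc n w y) = (\<Sum>k\<le>n. integral {B..B'} (\<lambda>y. coef k * tm k y))"
    unfolding osc by (intro integral_sum integrable_on_mult_right int_tm) auto
  also have "\<dots> = (\<Sum>k\<le>n. coef k * integral {B..B'} (tm k))"
    by simp
  also have "norm \<dots> \<le> (\<Sum>k\<le>n. real (n choose k) * sqrt (2*pi) ^ k * ((2 ^ n + 16) / B))"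
  proof (rule sum_norm_le)
    fix k assume k: "k \<in> {..n}"
    have "norm (coef k) = real (n choose k) * sqrt (2*pi) ^ k"
      by (simp add: coef_def norm_mult norm_divide norm_power norm_w)
    moreover have "norm (integral {B..B'} (tm k)) \<le> (2 ^ n + 16) / B"
      unfolding tm_def using osc_term_tail[OF n _ B] k by auto
    ultimately show "norm (coef k * integral {B..B'} (tm k)) \<le> real (n choose k) * sqrt (2*pi) ^ k * ((2 ^ n + 16) / B)"
      by (simp only: norm_mult) (erule mult_left_mono, simp)
  qed
  finally have 1: "norm (integral {B..B'} (\<lambda>y. osc n w y)) \<le> (\<Sum>k\<le>n. real (n choose k) * sqrt (2*pi) ^ k * (2 ^ n + 16)) / B"
    by (simp add: sum_divide_distrib)
  have 2: "norm (integral {B..B'} (\<lambda>y. osc n w (-y))) \<le> 2 ^ n / B"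
  proof (rule norm_integral_inverse_square_le)
    fix y assume y: "y \<in> {B..B'}"
    have "norm (osc n w (-y)) \<le> norm (mills (- (\<i> * complex_of_real y / w))) ^ n"
      using y B by (intro norm_osc_neg_le) auto
    also have "\<dots> \<le> (2 / y) ^ n"
      using y B by (intro power_mono norm_mills_le_inverse Re_arg) auto
    also have "\<dots> = 2 ^ n / y ^ n" by (simp add: power_divide)
    also have "\<dots> \<le> 2 ^ n / y ^ 2"
      using y B n by (intro frac_le power_increasing) auto
    finally show "norm (osc n w (-y)) \<le> 2 ^ n / y ^ 2" .
  qed (use B int in auto)
  have "integral {B..B'} (\<lambda>y. osc n w y + osc n w (-y)) = integral {B..B'} (\<lambda>y. osc n w y) + integral {B..B'} (\<lambda>y. osc n w (-y))"
    by (rule integral_add[OF int])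
  also have "norm \<dots> \<le> (\<Sum>k\<le>n. real (n choose k) * sqrt (2*pi) ^ k * (2 ^ n + 16)) / B + 2 ^ n / B"
    using 1 2 by (intro order_trans[OF norm_triangle_ineq] add_mono)
  finally show ?thesis by (simp add: add_divide_distrib)
qed

end

text \<open>Folding the line onto y \<ge> 0 turns both sides into limits of integrals over {0..B}.
  This is needed because at \<open>w\<close> itself there may be no absolutely convergent integral,
  only the improper one.\<close>

lemma osc_limit:
  assumes n: "n \<ge> 3" and w: "stokes_sector w" and X: "\<And>m. stokes_sector (X m)"
    and lim: "X \<longlonglongrightarrow> w"
    and int: "\<And>m. integrable lborel (osc n (X m))"
  shows "\<exists>L. ((\<lambda>B. integral {0..B} (\<lambda>y. osc n w y + osc n w (-y))) \<longlongrightarrow> L) at_top \<and>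
             (\<lambda>m. LINT y|lborel. osc n (X m) y) \<longlonglongrightarrow> L"
proof (rule uniform_tail_swap)
  let ?F = "\<lambda>w y. osc n w y + osc n w (-y)"
  have Fint: "?F w integrable_on {a..b}" if "w \<noteq> 0" for w a b
    by (intro integrable_continuous_real continuous_intros continuous_on_osc that)
  have tail: "norm (integral {0..B'} (?F w) - integral {0..B} (?F w)) \<le>
       ((\<Sum>k\<le>n. real (n choose k) * sqrt (2*pi) ^ k * (2 ^ n + 16)) + 2 ^ n) / B"
    if "stokes_sector w" "1 \<le> B" "B \<le> B'" for w B B'
  proof -
    interpret stokes_sector w by fact
    have "integral {0..B} (?F w) + integral {B..B'} (?F w) = integral {0..B'} (?F w)"
      using that by (intro Henstock_Kurzweil_Integration.integral_combine Fint w_nonzero) auto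
    hence "integral {0..B'} (?F w) - integral {0..B} (?F w) = integral {B..B'} (?F w)"
      by (simp add: algebra_simps)
    thus ?thesis using osc_tail[OF n that(2,3)] by simp
  qed
  show "norm (integral {0..B'} (?F w) - integral {0..B} (?F w)) \<le>
       ((\<Sum>k\<le>n. real (n choose k) * sqrt (2*pi) ^ k * (2 ^ n + 16)) + 2 ^ n) / B"
    if "1 \<le> B" "B \<le> B'" for B B' using tail[OF w that] .
  show "norm (integral {0..B'} (?F (X m)) - integral {0..B} (?F (X m))) \<le>
       ((\<Sum>k\<le>n. real (n choose k) * sqrt (2*pi) ^ k * (2 ^ n + 16)) + 2 ^ n) / B"
    if "1 \<le> B" "B \<le> B'" for B B' m using tail[OF X that] .
  show "((\<lambda>B. integral {0..B} (?F (X m))) \<longlongrightarrow> (LINT y|lborel. osc n (X m) y)) at_top" for m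
  proof -
    have i1: "set_integrable lborel {0..} (osc n (X m))"
      using integrable_mult_indicator[OF _ int[of m], of "{0..}"] by (simp add: set_integrable_def)
    have "integrable lborel (\<lambda>y. osc n (X m) (-y))"
      using lborel_integrable_real_affine[OF int[of m], of "-1" 0] by simp
    hence i2: "set_integrable lborel {0..} (\<lambda>y. osc n (X m) (-y))"
      using integrable_mult_indicator[of "{0..}" lborel "\<lambda>y. osc n (X m) (-y)"] by (simp add: set_integrable_def)
    have i: "set_integrable lborel {0..} (?F (X m))" by (rule set_integral_add(1)[OF i1 i2])
    have "(LINT y|lborel. osc n (X m) y) = (LINT y:{0..}|lborel. osc n (X m) y) + (LINT y:{0..}|lborel. osc n (X m) (-y))"
      using has_bochner_integral_split_half_lines[OF _ i1 i2] int[of m]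
      by (auto simp: has_bochner_integral_iff)
    also have "\<dots> = (LINT y:{0..}|lborel. ?F (X m) y)"
      by (rule set_integral_add(2)[OF i1 i2, symmetric])
    finally have eq: "(LINT y|lborel. osc n (X m) y) = (LINT y:{0..}|lborel. ?F (X m) y)" .
    have "((\<lambda>B. LINT y:{0..B}|lborel. ?F (X m) y) \<longlongrightarrow> (LINT y|lborel. osc n (X m) y)) at_top"
      unfolding eq by (intro tendsto_set_lebesgue_integral_at_top i) auto
    moreover have "(LINT y:{0..B}|lborel. ?F (X m) y) = integral {0..B} (?F (X m))" for B
      by (rule set_borel_integral_eq_integral(2)) (rule set_integrable_subset[OF i], auto)
    ultimately show ?thesis by simp
  qed
  show "(\<lambda>m. integral {0..B} (?F (X m))) \<longlonglongrightarrow> integral {0..B} (?F w)" for B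
  proof (rule dominated_convergence(2))
    show "?F (X m) integrable_on {0..B}" for m
      by (rule Fint) (rule stokes_sector.w_nonzero[OF X])
    show "(\<lambda>y. (\<Sum>k\<le>n. real (n choose k) * sqrt (2*pi) ^ k * 3 ^ (n - k)) + 3 ^ n) integrable_on {0..B}"
      by (rule integrable_const_ivl)
    show "norm (?F (X m) y) \<le> (\<Sum>k\<le>n. real (n choose k) * sqrt (2*pi) ^ k * 3 ^ (n - k)) + 3 ^ n"
      if "y \<in> {0..B}" for m y
      by (rule stokes_sector.norm_osc_bounded[OF X]) (use that in auto)
    show "(\<lambda>m. ?F (X m) y) \<longlonglongrightarrow> ?F w y" if "y \<in> {0..B}" for y
      by (intro tendsto_add tendsto_osc lim stokes_sector.w_nonzero[OF w])
  qed
qed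

section \<open>The regular simplex\<close>

text \<open>Adding the row of ones to other rows leaves the determinant unchanged, so the set
  \<open>F\<close> may be built up one index at a time. For empty \<open>F\<close> the row of ones
  is a unit row plus a combination of the other rows.\<close>

lemma det_identity_with_ones_row:
  fixes F :: "'n::finite set"
  assumes "k \<notin> F"
  shows "det (\<chi> i. if i = k then (\<chi> j. 1) else if i \<in> F then axis i 1 + (\<chi> j. 1) else axis i 1 :: real^'n^'n) = 1"
  using finite[of F] assms
proof (induction F rule: finite_induct)
  case empty
  let ?I = "mat 1 :: real^'n^'n"
  have row: "row j ?I = axis j 1" for j by (simp add: row_def mat_def axis_def vec_eq_iff)
  have "(\<Sum>j\<in>UNIV-{k}. axis j 1) \<in> vec.span {row j ?I |j. j \<noteq> k}"
    unfolding row by (intro vec.span_sum vec.span_base) auto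
  from det_row_span[OF this]
  have "det (\<chi> i. if i = k then axis k 1 + (\<Sum>j\<in>UNIV-{k}. axis j 1) else axis i 1 :: real^'n^'n) = 1"
    by (simp only: row det_I)
  moreover have "axis k 1 + (\<Sum>j\<in>UNIV-{k}. axis j 1) = ((\<chi> j. 1) :: real^'n)"
  proof -
    have "axis k 1 + (\<Sum>j\<in>UNIV-{k}. axis j 1) = (\<Sum>j\<in>UNIV. axis j 1 :: real^'n)"
      by (subst sum.remove[of UNIV k]) auto
    also have "\<dots> = (\<chi> j. 1)" by (simp add: vec_eq_iff axis_def)
    finally show ?thesis .
  qed
  ultimately show ?case by (simp only: empty_iff if_False)
next
  case (insert m F)
  define A where "A = (\<chi> i. if i = k then (\<chi> j. 1) else if i \<in> F then axis i 1 + (\<chi> j. 1) else axis i 1 :: real^'n^'n)"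
  have row: "row i A = (if i = k then (\<chi> j. 1) else if i \<in> F then axis i 1 + (\<chi> j. 1) else axis i 1)" for i
    by (simp add: A_def row_def vec_eq_iff)
  have "det (\<chi> i. if i = m then row m A + 1 *s row k A else row i A) = det A"
    by (rule det_row_operation) (use insert in auto)
  also have "(\<chi> i. if i = m then row m A + 1 *s row k A else row i A) =
     (\<chi> i. if i = k then (\<chi> j. 1) else if i \<in> insert m F then axis i 1 + (\<chi> j. 1) else axis i 1 :: real^'n^'n)"
    unfolding row using insert by (auto simp: vec_eq_iff)
  also have "det A = 1" unfolding A_def using insert by auto
  finally show ?case .
qed

text \<open>Up to scaling this is the Gram matrix of the edges at a vertex of a regular simplex.
  Linearity in one row splits off a determinant with a row of ones, which is 1; thus each row adds
  1.\<close>

lemma det_identity_plus_ones: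
  "det (\<chi> i. axis i 1 + (\<chi> j. 1) :: real^'n^'n::finite) = 1 + real CARD('n)"
proof -
  have "det (\<chi> i. if i \<in> F then axis i 1 + (\<chi> j. 1) else axis i 1 :: real^'n^'n) = 1 + real (card F)" for F :: "'n set"
    using finite[of F]
  proof (induction F rule: finite_induct)
    case empty
    have "(\<chi> i. axis i 1 :: real^'n^'n) = mat 1" by (simp add: mat_def axis_def vec_eq_iff)
    thus ?case by simp
  next
    case (insert k F)
    define c where "c = (\<lambda>i. if i \<in> F then axis i 1 + (\<chi> j. 1) else axis i 1 :: real^'n)"
    have "(\<chi> i. if i \<in> insert k F then axis i 1 + (\<chi> j. 1) else axis i 1 :: real^'n^'n) = (\<chi> i. if i = k then axis i 1 + (\<chi> j. 1) else c i)"
      by (auto simp: vec_eq_iff c_def)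
    also have "det \<dots> = det (\<chi> i. if i = k then axis i 1 else c i) + det (\<chi> i. if i = k then (\<chi> j. 1) else c i)"
      by (rule det_row_add)
    also have "(\<chi> i. if i = k then axis i 1 else c i) = (\<chi> i. c i)"
      using insert by (auto simp: vec_eq_iff c_def)
    also have "det \<dots> = 1 + real (card F)" unfolding c_def by (rule insert.IH)
    also have "det (\<chi> i. if i = k then (\<chi> j. 1) else c i) = 1"
      unfolding c_def by (rule det_identity_with_ones_row) (use insert in auto)
    finally show ?case using insert by simp
  qed
  from this[of UNIV] show ?thesis by simp
qed

text \<open>Lebesgue measure is determined by its values on boxes, and the preimage of a box has its
  volume divided by the absolute value of the determinant. As an identity of measures this applies
  to every integrand.\<close>

lemma lborel_linear_image:
  fixes A :: "real^'m::{finite,wellorder} \<Rightarrow> real^'m::_"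
  assumes lin: "linear A" and inj: "inj A"
  shows "lborel = density (distr lborel borel A) (\<lambda>_. ennreal \<bar>det (matrix A)\<bar>)"
proof (rule lborel_eqI)
  obtain B where B: "linear B" "\<And>x. B (A x) = x" "\<And>x. A (B x) = x"
    using linear_injective_isomorphism[OF lin inj] by blast
  have [measurable]: "A \<in> borel \<rightarrow>\<^sub>M borel"
    by (intro borel_measurable_continuous_onI linear_continuous_on) (simp add: lin linear_linear linear_conv_bounded_linear[symmetric])
  fix l u :: "real^'m::_"
  assume le: "\<And>b. b \<in> Basis \<Longrightarrow> l \<bullet> b \<le> u \<bullet> b"
  define T where "T = A -` box l u"
  have T: "T = B ` box l u" by (auto simp: T_def image_iff B) (metis B(2))
  have bT: "bounded T" unfolding T using B(1) by (intro bounded_linear_image bounded_box) (simp add: linear_conv_bounded_linear)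
  have oT: "open T" unfolding T_def
    by (intro open_vimage open_box linear_continuous_on) (simp add: lin linear_conv_bounded_linear[symmetric])
  have lT: "T \<in> lmeasurable" using bT oT by (rule lmeasurable_open)
  have AT: "A ` T = box l u" by (simp add: T image_image B)
  have "measure lebesgue (box l u) = \<bar>det (matrix A)\<bar> * measure lebesgue T"
    using measure_linear_image[OF lin lT] by (simp add: AT)
  moreover have "T \<in> sets borel" using oT by simp
  moreover have "emeasure lborel T = ennreal (measure lborel T)"
    using emeasure_bounded_finite[OF bT] by (intro emeasure_eq_ennreal_measure) simp
  moreover have "measure lborel (box l u) = (\<Prod>b\<in>Basis. (u - l) \<bullet> b)"
    using le by (simp add: measure_lborel_box_eq inner_diff_left)
  ultimately show "emeasure (density (distr lborel borel A) (\<lambda>_. ennreal \<bar>det (matrix A)\<bar>)) (box l u) = (\<Prod>b\<in>Basis. (u - l) \<bullet> b)"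
    by (simp add: emeasure_density_const emeasure_distr T_def[symmetric] measure_completion flip: ennreal_mult')
qed simp

text \<open>Affine maps commute with convex hulls; this one sends 0 to \<open>v0\<close> and the
  unit vectors to the points \<open>v i\<close>.\<close>

lemma convex_hull_simplex_image:
  fixes v0 :: "real^'n" and v :: "'n \<Rightarrow> real^'n"
  shows "convex hull (insert v0 (range v)) = (\<lambda>t. v0 + (\<Sum>i\<in>UNIV. t $ i *\<^sub>R (v i - v0))) ` corner_simplex"
proof -
  define A where "A = (\<lambda>t::real^'n. \<Sum>i\<in>UNIV. t $ i *\<^sub>R (v i - v0))"
  have lin: "linear A"
    by (intro linearI) (auto simp: A_def sum.distrib scaleR_add_left scaleR_sum_right)
  have "corner_simplex = convex hull (insert 0 (Basis :: (real^'n) set))"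
    unfolding std_simplex corner_simplex_def sum_Basis_vec[where f="\<lambda>x. x"]
    by (auto simp: Basis_vec_def inner_axis)
  hence "(\<lambda>t. v0 + A t) ` corner_simplex = (\<lambda>x. v0 + x) ` (convex hull (A ` (insert 0 Basis)))"
    by (simp only: image_image convex_hull_linear_image[OF lin, symmetric])
  also have "\<dots> = convex hull ((\<lambda>x. v0 + x) ` A ` insert 0 Basis)"
    by (rule convex_hull_translation[symmetric])
  also have "(\<lambda>x. v0 + x) ` A ` insert 0 Basis = insert v0 (range v)"
  proof -
    have "A (axis i 1) = v i - v0" for i
      unfolding A_def by (simp add: axis_def if_distrib[of "\<lambda>c. c *\<^sub>R _"] sum.delta cong: if_cong)
    hence "range (\<lambda>i. v0 + A (axis i 1)) = range v" by simp
    moreover have Basis_eq: "Basis = range (\<lambda>i::'n. axis i (1::real))" by (auto simp: Basis_vec_def)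
    ultimately have "(\<lambda>x. v0 + A x) ` Basis = range v" unfolding Basis_eq image_image by simp
    moreover have "A 0 = 0" using lin by (rule linear_0)
    ultimately show ?thesis by (simp add: image_image)
  qed
  finally show ?thesis unfolding A_def by simp
qed

text \<open>Equal norms and equal distances make all inner products of distinct vertices equal. The
  d + 1 vectors are linearly dependent, and pairing a relation with each vertex shows that its
  coefficients all agree. So the vertices sum to zero, which fixes the common value.\<close>

lemma regular_simplex_inner:
  fixes V :: "(real^'n) set"
  assumes V: "regular_simplex_vertices V" and norm: "\<forall>v\<in>V. norm v = R" and R: "R > 0"
    and u: "u \<in> V" and v: "v \<in> V"
  shows "u \<bullet> v = R\<^sup>2 * (if u = v then 1 else - 1 / real CARD('n))"
proof -
  from V obtain s where fin: "finite V" and card: "card V = CARD('n) + 1" and s: "s > 0"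
    and dist: "\<And>u v. u \<in> V \<Longrightarrow> v \<in> V \<Longrightarrow> u \<noteq> v \<Longrightarrow> dist u v = s"
    unfolding regular_simplex_vertices_def by blast
  \<comment> \<open>With this \<open>a\<close> the Gram matrix is (R^2 - a) J + a I, where J is the
    matrix of ones.\<close>
  define a where "a = s\<^sup>2 / 2"
  have a: "a > 0" using s by (simp add: a_def)
  have inner: "u \<bullet> v = (R\<^sup>2 - a) + (if u = v then a else 0)" if "u \<in> V" "v \<in> V" for u v
  proof (cases "u = v")
    case True
    thus ?thesis using norm that by (simp add: dot_square_norm)
  next
    case False
    have "s\<^sup>2 = (norm (u - v))\<^sup>2" using dist[OF that False] by (simp add: dist_norm)
    also have "\<dots> = R\<^sup>2 + R\<^sup>2 - 2 * (u \<bullet> v)"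
    proof -
      have "u \<bullet> u = R\<^sup>2" "v \<bullet> v = R\<^sup>2" using norm that by (auto simp: dot_square_norm)
      thus ?thesis by (simp add: power2_norm_eq_inner inner_diff_left inner_diff_right inner_commute)
    qed
    finally show ?thesis using False by (simp add: a_def field_simps)
  qed
  have "dependent V" using card fin by (intro dependent_biggerset) auto
  then obtain c where c: "\<exists>v\<in>V. c v \<noteq> 0" "(\<Sum>v\<in>V. c v *\<^sub>R v) = 0"
    using dependent_finite[OF fin] by auto
  define k where "k = - (R\<^sup>2 - a) * (\<Sum>v\<in>V. c v) / a"
  have ck: "c w = k" if w: "w \<in> V" for w
  proof -
    have "0 = (\<Sum>v\<in>V. c v *\<^sub>R v) \<bullet> w" by (simp add: c)
    also have "\<dots> = (\<Sum>v\<in>V. c v * ((R\<^sup>2 - a) + (if v = w then a else 0)))"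
      using w by (simp add: inner_sum_left inner cong: sum.cong)
    also have "\<dots> = (R\<^sup>2 - a) * (\<Sum>v\<in>V. c v) + (\<Sum>v\<in>V. c v * (if v = w then a else 0))"
      by (simp add: distrib_left sum.distrib sum_distrib_right mult.commute)
    also have "(\<Sum>v\<in>V. c v * (if v = w then a else 0)) = c w * a"
      using w fin by (simp add: if_distrib sum.delta cong: if_cong)
    finally show ?thesis using a by (simp add: k_def field_simps)
  qed
  have k0: "k \<noteq> 0" using c(1) ck by auto
  have "k * a = - (R\<^sup>2 - a) * (\<Sum>v\<in>V. c v)" using a by (simp add: k_def)
  also have "(\<Sum>v\<in>V. c v) = (real CARD('n) + 1) * k" using ck card by simp
  finally have "k * a = k * (- (R\<^sup>2 - a) * (real CARD('n) + 1))" by (simp only: mult_ac)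
  hence "a = - (R\<^sup>2 - a) * (real CARD('n) + 1)" using k0 by (simp only: mult_cancel_left) simp
  hence "R\<^sup>2 - a = - R\<^sup>2 / real CARD('n)" by (simp add: field_simps)
  moreover from this have "R\<^sup>2 - a + a = R\<^sup>2" "R\<^sup>2 * (- 1 / real CARD('n)) = - R\<^sup>2 / real CARD('n)" by simp_all
  ultimately show ?thesis using inner[OF u v] by (cases "u = v") simp_all
qed

text \<open>In barycentric coordinates 1 + \<kappa> |y|^2 equals (1 + 1/d) (1 - Q), because the Gram
  matrix is known. The Jacobian contributes (1 + 1/d) to the power (d + 1) / 2, which cancels
  against the constant of the density and leaves sqrt d and the power of |\<kappa>|.\<close>

lemma hyp_vol_ideal_simplex:
  fixes V :: "(real^'m::{finite,wellorder}) set"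
  assumes \<kappa>: "\<kappa> < 0" and V: "regular_simplex_vertices V" and norm: "\<forall>v\<in>V. norm v = 1 / sqrt (- \<kappa>)"
  shows "hyp_vol \<kappa> (convex hull V) = \<bar>\<kappa>\<bar> powr (- (real CARD('m) / 2)) * sqrt (real CARD('m)) *
           (LINT t:(corner_simplex :: (real^'m::_) set)|lborel. (1 - bary_sq t) powr (- (real CARD('m) + 1) / 2))"
proof -
  define d where "d = real CARD('m)"
  define R where "R = 1 / sqrt (- \<kappa>)"
  have d: "d > 0" by (simp add: d_def)
  have R: "R > 0" "\<kappa> * R\<^sup>2 = -1" using \<kappa> by (auto simp: R_def power_divide)
  define a where "a = R\<^sup>2 * (1 + 1 / d)"
  have a: "a > 0" using R d by (simp add: a_def add_pos_pos)
  obtain v0 where v0: "v0 \<in> V" using V unfolding regular_simplex_vertices_def by fastforce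
  have "card (V - {v0}) = CARD('m)" "finite (V - {v0})"
    using V v0 by (auto simp: regular_simplex_vertices_def)
  then obtain v :: "'m \<Rightarrow> real^'m::_" where v: "bij_betw v UNIV (V - {v0})"
    using finite_same_card_bij[of "UNIV :: 'm::_ set" "V - {v0}"] by auto
  have Veq: "V = insert v0 (range v)" using v v0 by (auto simp: bij_betw_def)
  have vV: "v i \<in> V" "v i \<noteq> v0" for i using v by (auto simp: bij_betw_def)
  have v_eq: "v i = v j \<longleftrightarrow> i = j" for i j using v by (auto simp: bij_betw_def inj_on_def)
  have inner: "x \<bullet> y = (R\<^sup>2 - a) + (if x = y then a else 0)" if "x \<in> V" "y \<in> V" for x y
    using regular_simplex_inner[OF V _ R(1) that] norm by (auto simp: R_def[symmetric] a_def d_def field_simps)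
  define A where "A = (\<lambda>t::real^'m::_. \<Sum>i\<in>UNIV. t $ i *\<^sub>R (v i - v0))"
  have lin: "linear A"
    by (intro linearI) (auto simp: A_def sum.distrib scaleR_add_left scaleR_sum_right)
  have gram: "(v i - v0) \<bullet> (v j - v0) = a * (1 + (if i = j then 1 else 0))" for i j
    using vV v0 v_eq[of i j] by (auto simp: inner_diff_left inner_diff_right inner)
  have gram': "(v j - v0) \<bullet> (v i - v0) = a * (1 + (if i = j then 1 else 0))" for i j
    using gram[of j i] by (simp add: eq_commute[of j i])
  have normA: "A t \<bullet> A t = a * ((\<Sum>i\<in>UNIV. t $ i)\<^sup>2 + (\<Sum>i\<in>UNIV. (t $ i)\<^sup>2))" for t
  proof -
    have "A t \<bullet> A t = (\<Sum>i\<in>UNIV. \<Sum>j\<in>UNIV. t $ i * (t $ j * (a * (1 + (if i = j then 1 else 0)))))"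
      by (simp add: A_def inner_sum_left inner_sum_right gram' sum_distrib_left)
    also have "\<dots> = (\<Sum>i\<in>UNIV. \<Sum>j\<in>UNIV. a * (t $ i * t $ j) + (if i = j then a * (t $ i)\<^sup>2 else 0))"
      by (intro sum.cong refl) (auto simp: algebra_simps power2_eq_square)
    also have "\<dots> = a * ((\<Sum>i\<in>UNIV. t $ i)\<^sup>2 + (\<Sum>i\<in>UNIV. (t $ i)\<^sup>2))"
      by (simp add: sum.distrib sum.delta power2_eq_square sum_product distrib_left flip: sum_distrib_left)
    finally show ?thesis .
  qed
  have inj: "inj A"
  proof (rule linear_injective_0[THEN iffD2, OF lin], intro allI impI)
    fix t assume "A t = 0"
    hence "a * ((\<Sum>i\<in>UNIV. t $ i)\<^sup>2 + (\<Sum>i\<in>UNIV. (t $ i)\<^sup>2)) = 0" using normA[of t] by simp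
    hence "(\<Sum>i\<in>UNIV. (t $ i)\<^sup>2) = 0"
      using a by (simp add: add_nonneg_eq_0_iff sum_nonneg)
    thus "t = 0" by (simp add: sum_nonneg_eq_0_iff vec_eq_iff)
  qed
  \<comment> \<open>Only inner products of the edges are known, so the determinant is found up to
    sign from the Gram matrix a (I + J).\<close>
  have detA: "\<bar>det (matrix A)\<bar> = sqrt (a powr d * (1 + d))"
  proof -
    have mA: "column i (matrix A) = v i - v0" for i
    proof -
      have "A (axis i 1) = v i - v0"
        unfolding A_def by (simp add: axis_def if_distrib[of "\<lambda>c. c *\<^sub>R _"] sum.delta cong: if_cong)
      thus ?thesis by (simp add: matrix_def column_def vec_eq_iff)
    qed
    have "transpose (matrix A) ** matrix A = (\<chi> i. a *s (axis i 1 + (\<chi> j. 1)))"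
      by (auto simp: vec_eq_iff matrix_mult_transpose_dot_column mA gram axis_def inner_commute)
    hence "det (transpose (matrix A)) * det (matrix A) = a ^ CARD('m) * (1 + d)"
      by (simp only: det_mul[symmetric] det_rows_mul det_identity_plus_ones d_def prod_constant)
    hence "(det (matrix A))\<^sup>2 = a powr d * (1 + d)"
      using a by (simp add: det_transpose power2_eq_square d_def powr_realpow)
    thus ?thesis by (metis real_sqrt_abs)
  qed
  define g where "g = (\<lambda>y::real^'m::_. indicat_real (convex hull V) y *\<^sub>R (1 + \<kappa> * (norm y)\<^sup>2) powr (- (d + 1) / 2))"
  have hull: "convex hull V = (\<lambda>t. v0 + A t) ` corner_simplex"
    unfolding Veq convex_hull_simplex_image A_def ..
  have "finite V" using V by (simp add: regular_simplex_vertices_def)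
  hence [measurable]: "convex hull V \<in> sets borel"
    by (intro borel_compact finite_imp_compact_convex_hull)
  have [measurable]: "g \<in> borel_measurable borel" unfolding g_def by measurable
  have [measurable]: "A \<in> borel \<rightarrow>\<^sub>M borel"
    by (intro borel_measurable_continuous_onI linear_continuous_on) (simp add: lin linear_conv_bounded_linear[symmetric])
  have g_eq: "g (v0 + A t) = (1 + 1 / d) powr (- (d + 1) / 2) * (indicat_real corner_simplex t *\<^sub>R (1 - bary_sq t) powr (- (d + 1) / 2))" for t
  proof (cases "t \<in> corner_simplex")
    case True
    define S where "S = (\<Sum>i\<in>UNIV. t $ i)"
    have "v0 \<bullet> (v i - v0) = - a" for i
      using vV(1)[of i] vV(2)[of i] v0 by (simp add: inner_diff_right inner)
    hence v0A: "v0 \<bullet> A t = - a * S"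
      by (simp add: A_def inner_sum_right S_def sum_negf sum_distrib_left mult.commute)
    have b: "bary_sq t = (\<Sum>i\<in>UNIV. (t $ i)\<^sup>2) + (1 - S)\<^sup>2"
      by (simp add: bary_sq_def bary_def inner_prod_def inner_vec_def power2_eq_square S_def)
    have "(norm (v0 + A t))\<^sup>2 = v0 \<bullet> v0 + 2 * (v0 \<bullet> A t) + A t \<bullet> A t"
      by (simp add: power2_norm_eq_inner inner_add_left inner_add_right inner_commute)
    also have "\<dots> = R\<^sup>2 - a * (1 - bary_sq t)"
      using inner[OF v0 v0] unfolding v0A normA b S_def[symmetric] by (simp add: power2_eq_square algebra_simps)
    finally have "1 + \<kappa> * (norm (v0 + A t))\<^sup>2 = 1 + \<kappa> * (R\<^sup>2 - R\<^sup>2 * (1 + 1 / d) * (1 - bary_sq t))"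
      by (simp only: a_def)
    also have "\<dots> = 1 + \<kappa> * R\<^sup>2 - (\<kappa> * R\<^sup>2) * (1 + 1 / d) * (1 - bary_sq t)"
      by (simp only: right_diff_distrib mult.assoc add_diff_eq)
    also have "\<dots> = (1 + 1 / d) * (1 - bary_sq t)" by (simp add: R algebra_simps)
    finally have "(1 + \<kappa> * (norm (v0 + A t))\<^sup>2) powr (- (d + 1) / 2) = ((1 + 1 / d) * (1 - bary_sq t)) powr (- (d + 1) / 2)"
      by simp
    also have "\<dots> = (1 + 1 / d) powr (- (d + 1) / 2) * (1 - bary_sq t) powr (- (d + 1) / 2)"
      by (rule powr_mult)
    finally show ?thesis using True by (simp add: g_def hull)
  next
    case False
    hence "v0 + A t \<notin> convex hull V" by (auto simp: hull inj_eq[OF inj])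
    thus ?thesis using False by (simp add: g_def)
  qed
  have "hyp_vol \<kappa> (convex hull V) = (LINT y|lborel. g y)"
    by (simp add: hyp_vol_def set_lebesgue_integral_def g_def d_def)
  also have "\<dots> = (LINT y|distr lborel borel ((+) v0). g y)"
    by (simp only: lborel_distr_plus)
  also have "\<dots> = (LINT y|lborel. g (v0 + y))"
    by (subst integral_distr) auto
  also have "\<dots> = (LINT y|density (distr lborel borel A) (\<lambda>_. ennreal \<bar>det (matrix A)\<bar>). g (v0 + y))"
    by (simp only: lborel_linear_image[OF lin inj, symmetric])
  also have "\<dots> = \<bar>det (matrix A)\<bar> * (LINT t|lborel. g (v0 + A t))"
    by (subst integral_density) (auto simp: integral_distr)
  also have "\<dots> = \<bar>det (matrix A)\<bar> * (1 + 1 / d) powr (- (d + 1) / 2) * (LINT t:(corner_simplex :: (real^'m::_) set)|lborel. (1 - bary_sq t) powr (- (d + 1) / 2))"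
    unfolding g_eq set_lebesgue_integral_def by simp
  also have "\<bar>det (matrix A)\<bar> * (1 + 1 / d) powr (- (d + 1) / 2) = \<bar>\<kappa>\<bar> powr (- (d / 2)) * sqrt d"
  proof -
    have b0: "1 + 1 / d > 0" using d by (simp add: add_pos_pos)
    have R2: "R\<^sup>2 = 1 / \<bar>\<kappa>\<bar>" using \<kappa> by (simp add: R_def power_divide)
    have "a powr d = \<bar>\<kappa>\<bar> powr (- d) * (1 + 1 / d) powr d"
      unfolding a_def R2 powr_mult powr_divide by (simp add: powr_minus divide_inverse)
    moreover have "1 + d = d * (1 + 1 / d)" using d by (simp add: field_simps)
    ultimately have "a powr d * (1 + d) = \<bar>\<kappa>\<bar> powr (- d) * d * (1 + 1 / d) powr (d + 1)"
      using b0 by (simp add: powr_add)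
    hence "\<bar>det (matrix A)\<bar> = (\<bar>\<kappa>\<bar> powr (- d) * d * (1 + 1 / d) powr (d + 1)) powr (1/2)"
      unfolding detA using d b0 \<kappa> by (simp add: powr_half_sqrt)
    also have "\<dots> = \<bar>\<kappa>\<bar> powr (- (d / 2)) * d powr (1/2) * (1 + 1 / d) powr ((d + 1) / 2)"
      using d b0 \<kappa> by (simp add: powr_mult powr_powr)
    finally have "\<bar>det (matrix A)\<bar> * (1 + 1 / d) powr (- (d + 1) / 2) =
       \<bar>\<kappa>\<bar> powr (- (d / 2)) * d powr (1/2) * ((1 + 1 / d) powr ((d + 1) / 2) * (1 + 1 / d) powr (- ((d + 1) / 2)))"
      by (simp only: minus_divide_left mult.assoc)
    also have "(1 + 1 / d) powr ((d + 1) / 2) * (1 + 1 / d) powr (- ((d + 1) / 2)) = 1"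
      using b0 by (simp only: powr_minus) simp
    finally show ?thesis using d by (simp add: powr_half_sqrt)
  qed
  finally show ?thesis unfolding d_def .
qed

section \<open>The limit\<close>

text \<open>Equality would make every s_i (1 - s_i) vanish, hence every s_i equal to 1, against
  their sum being 1. Strictness keeps the limiting base -\<i> (1 - Q) away from 0 and from the
  branch cut.\<close>

lemma bary_sq_less_1:
  fixes t :: "real^'n"
  assumes t: "t \<in> corner_simplex" and nz: "\<forall>b\<in>Basis. bary t \<bullet> b \<noteq> 0"
  shows "bary_sq t < 1"
proof (rule ccontr)
  assume "\<not> bary_sq t < 1"
  hence eq: "bary_sq t = 1" using bary_sq_le_1[OF t] by simp
  have nn: "\<And>b. b \<in> Basis \<Longrightarrow> bary t \<bullet> b > 0"
    using t nz by (force simp: pos_orthant_def order_less_le simp flip: bary_in_pos_orthant)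
  have le: "bary t \<bullet> b \<le> 1" if "b \<in> Basis" for b
    using member_le_sum[of b Basis "\<lambda>b. bary t \<bullet> b"] that nn by (auto simp: sum_bary less_imp_le)
  have "(\<Sum>b\<in>Basis. (bary t \<bullet> b) * (1 - bary t \<bullet> b)) = 1 - bary_sq t"
    unfolding bary_sq_def by (subst (3) euclidean_inner) (simp add: right_diff_distrib sum_subtractf sum_bary)
  hence "(\<Sum>b\<in>Basis. (bary t \<bullet> b) * (1 - bary t \<bullet> b)) = 0" using eq by simp
  hence "\<forall>b\<in>Basis. (bary t \<bullet> b) * (1 - bary t \<bullet> b) = 0"
    by (subst (asm) sum_nonneg_eq_0_iff) (use nn le in \<open>auto simp: less_imp_le\<close>)
  hence "\<forall>b\<in>Basis. bary t \<bullet> b = 1" using nz by auto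
  hence "(\<Sum>b\<in>(Basis :: ((real^'n) \<times> real) set). bary t \<bullet> b) = real CARD('n) + 1" by simp
  thus False by (simp add: sum_bary)
qed

lemma stokes_sector_cis:
  assumes "pi / 6 \<le> \<theta>" "\<theta> \<le> pi / 4"
  shows "stokes_sector (cis \<theta>)"
proof
  show "norm (cis \<theta>) = 1" by simp
  have "(cis \<theta>)\<^sup>2 = cis (2 * \<theta>)" by (simp add: Complex.DeMoivre)
  thus "Re ((cis \<theta>)\<^sup>2) \<ge> 0" using assms pi_gt_zero by (simp add: cos_ge_zero)
  have "sin (pi / 6) \<le> sin \<theta>" using assms pi_gt_zero by (intro sin_monotone_2pi_le) auto
  thus "Im (cis \<theta>) \<ge> 1 / 2" by (simp add: sin_30)
qed

text \<open>Since |w| = 1, the reverse triangle inequality gives |w^2 Q + 1 / w^2| \<ge> 1 - Q for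
  every \<open>w\<close> in question; so the limiting integrand dominates the whole family.\<close>

lemma corner_simplex_limit_identity:
  assumes d: "CARD('n) \<ge> 2"
  defines "\<omega> \<equiv> cis (pi / 4)"
  shows "\<exists>L. ((\<lambda>B. integral {0..B} (\<lambda>y. osc (CARD('n) + 1) \<omega> y + osc (CARD('n) + 1) \<omega> (-y))) \<longlongrightarrow> L) at_top \<and>
     complex_of_real (2 powr ((real CARD('n) - 1) / 2) * Gamma ((real CARD('n) + 1) / 2)) *
       (\<omega> ^ (CARD('n) + 1) * complex_of_real (LINT t:(corner_simplex :: (real^'n) set)|lborel. (1 - bary_sq t) powr (- (real CARD('n) + 1) / 2))) =
     \<omega> / complex_of_real (sqrt (2*pi)) * L"
proof -
  define n where "n = CARD('n) + 1"
  define e where "e = - (real CARD('n) + 1) / 2"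
  have e: "e < 0" by (simp add: e_def)
  have e_eq: "- (of_nat CARD('n) + 1) / 2 = complex_of_real e" by (simp add: e_def)
  define K where "K = complex_of_real (2 powr ((real CARD('n) - 1) / 2) * Gamma ((real CARD('n) + 1) / 2))"
  \<comment> \<open>The angles start at \<pi> / 4 - \<pi> / 12 = \<pi> / 6 and increase to \<pi> / 4
    without reaching it, so the Gaussian identities apply to each \<open>X m\<close>.\<close>
  define \<theta> where "\<theta> = (\<lambda>m::nat. pi / 4 - (pi / 12) / (real m + 1))"
  define X where "X = (\<lambda>m. cis (\<theta> m))"
  have \<theta>: "pi / 6 \<le> \<theta> m" "\<theta> m < pi / 4" for m
  proof -
    have "(pi / 12) / (real m + 1) \<le> (pi / 12) / 1" by (intro divide_left_mono) auto
    thus "pi / 6 \<le> \<theta> m" by (simp add: \<theta>_def)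
    show "\<theta> m < pi / 4" by (simp add: \<theta>_def)
  qed
  have sector: "stokes_sector (X m)" for m unfolding X_def using \<theta>[of m] by (intro stokes_sector_cis) auto
  have sector_\<omega>: "stokes_sector \<omega>" unfolding \<omega>_def using pi_gt_zero by (intro stokes_sector_cis) auto
  have "\<theta> \<longlonglongrightarrow> pi / 4" unfolding \<theta>_def by real_asymp
  hence X_lim: "X \<longlonglongrightarrow> \<omega>" unfolding X_def \<omega>_def cis_conv_exp
    by (intro tendsto_intros)
  have X_pos: "Re (X m) > 0" "Re ((X m)\<^sup>2) > 0" for m
  proof -
    have t: "0 < \<theta> m" "2 * \<theta> m < pi / 2" using \<theta>[of m] pi_gt_zero by linarith+
    thus "Re (X m) > 0" by (simp add: X_def cos_gt_zero)
    show "Re ((X m)\<^sup>2) > 0" using t by (simp add: X_def Complex.DeMoivre cos_gt_zero)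
  qed
  have norm_X: "norm (X m) = 1" "X m \<noteq> 0" for m by (auto simp: X_def)
  have osc_int: "integrable lborel (osc n (X m))" for m
    using integrable_gauss_laplace_power[OF X_pos, where 'a="(real^'n) \<times> real"] by (simp add: osc_def[abs_def] n_def)
  obtain L where L: "((\<lambda>B. integral {0..B} (\<lambda>y. osc n \<omega> y + osc n \<omega> (-y))) \<longlongrightarrow> L) at_top"
    "(\<lambda>m. LINT y|lborel. osc n (X m) y) \<longlonglongrightarrow> L"
    using osc_limit[OF _ sector_\<omega> sector X_lim osc_int] d by (auto simp: n_def)
  define c where "c = (\<lambda>w t::real^'n. w\<^sup>2 * complex_of_real (bary_sq t) + 1 / w\<^sup>2)"
  have \<omega>2: "\<omega>\<^sup>2 = \<i>" by (simp add: \<omega>_def Complex.DeMoivre)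
  have "(\<lambda>m. LINT t:(corner_simplex :: (real^'n) set)|lborel. c (X m) t powr complex_of_real e) \<longlonglongrightarrow>
        (LINT t:(corner_simplex :: (real^'n) set)|lborel. \<omega> ^ n * complex_of_real ((1 - bary_sq t) powr e))"
    unfolding set_lebesgue_integral_def
  proof (rule integral_dominated_convergence)
    show "integrable lborel (\<lambda>t::real^'n. indicator corner_simplex t *\<^sub>R (1 - bary_sq t) powr e)"
      using set_integrable_bary_sq[OF d] unfolding set_integrable_def e_def .
    show "(\<lambda>t::real^'n. indicator corner_simplex t *\<^sub>R (\<omega> ^ n * complex_of_real ((1 - bary_sq t) powr e))) \<in> borel_measurable lborel"
      by measurable
    have cont: "continuous_on UNIV (bary_sq :: real^'n \<Rightarrow> real)"
      unfolding bary_sq_def by (intro continuous_intros continuous_on_bary)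
    show "(\<lambda>t::real^'n. indicator corner_simplex t *\<^sub>R c (X m) t powr complex_of_real e) \<in> borel_measurable lborel" for m
    proof -
      have pos: "Re (c (X m) t) > 0" for t
      proof -
        have inv: "1 / (X m)\<^sup>2 = cnj ((X m)\<^sup>2)"
          using stokes_sector.inverse_w[OF sector[of m]] by (simp add: power_one_over[symmetric])
        have "Re (c (X m) t) = Re ((X m)\<^sup>2) * bary_sq t + Re ((X m)\<^sup>2)"
          unfolding c_def inv by (simp del: complex_cnj_power)
        also have "\<dots> > 0" using X_pos(2)[of m] bary_sq_nonneg[of t] by (intro add_nonneg_pos) auto
        finally show ?thesis .
      qed
      have "continuous_on UNIV (c (X m))"
        unfolding c_def by (intro continuous_intros cont)
      moreover have "c (X m) t \<noteq> 0" "Re (c (X m) t) \<ge> 0" for t using pos[of t] by auto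
      ultimately have "continuous_on UNIV (\<lambda>t. c (X m) t powr complex_of_real e)"
        by (intro continuous_on_powr_complex continuous_on_const) auto
      hence "(\<lambda>t. c (X m) t powr complex_of_real e) \<in> borel_measurable borel"
        by (rule borel_measurable_continuous_onI)
      thus ?thesis by measurable
    qed
    show "AE t in lborel. (\<lambda>m. indicat_real corner_simplex t *\<^sub>R c (X m) t powr complex_of_real e) \<longlonglongrightarrow>
       indicat_real corner_simplex t *\<^sub>R (\<omega> ^ n * complex_of_real ((1 - bary_sq (t :: real^'n)) powr e))"
      using AE_bary_nonzero
    proof eventually_elim
      case (elim t)
      show ?case
      proof (cases "t \<in> corner_simplex")
        case True
        define r where "r = 1 - bary_sq t"
        have r: "r > 0" using bary_sq_less_1[OF True elim] by (simp add: r_def)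
        have c\<omega>: "c \<omega> t = complex_of_real r * (- \<i>)"
          by (simp add: c_def \<omega>2 r_def algebra_simps)
        have "(\<lambda>m. c (X m) t) \<longlonglongrightarrow> c \<omega> t"
          unfolding c_def using \<omega>2 by (intro tendsto_intros X_lim) auto
        hence "(\<lambda>m. c (X m) t powr complex_of_real e) \<longlonglongrightarrow> c \<omega> t powr complex_of_real e"
          using r by (intro tendsto_powr_complex tendsto_const) (auto simp: c\<omega> complex_nonpos_Reals_iff)
        also have "c \<omega> t powr complex_of_real e = complex_of_real (r powr e) * (- \<i>) powr complex_of_real e"
          unfolding c\<omega> using r by (subst powr_times_real_left) (auto simp: powr_of_real)
        \<comment> \<open>On the principal branch the power -(d + 1) / 2 of exp (-\<i> \<pi> / 2) is
          exp (\<i> \<pi> (d + 1) / 4).\<close>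
        also have "(- \<i>) powr complex_of_real e = \<omega> ^ n"
        proof -
          have "Ln (- \<i>) = - (\<i> * complex_of_real pi / 2)" using Ln_minus_ii by simp
          hence "(- \<i>) powr complex_of_real e = exp (complex_of_real e * (- (\<i> * complex_of_real pi / 2)))"
            by (simp add: powr_def)
          also have "complex_of_real e * (- (\<i> * complex_of_real pi / 2)) = of_nat n * (\<i> * complex_of_real (pi / 4))"
            by (simp add: e_def n_def field_simps)
          finally show ?thesis by (simp only: \<omega>_def exp_of_nat_mult cis_conv_exp)
        qed
        finally show ?thesis using True by (simp add: r_def mult.commute)
      qed simp
    qed
    show "AE t in lborel. norm (indicat_real corner_simplex t *\<^sub>R c (X m) t powr complex_of_real e) \<le>
        indicat_real corner_simplex (t :: real^'n) *\<^sub>R (1 - bary_sq t) powr e" for m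
      using AE_bary_nonzero
    proof eventually_elim
      case (elim t)
      show ?case
      proof (cases "t \<in> corner_simplex")
        case True
        have lt: "bary_sq t < 1" by (rule bary_sq_less_1[OF True elim])
        have "norm (1 / (X m)\<^sup>2) = 1" "norm ((X m)\<^sup>2 * complex_of_real (bary_sq t)) = bary_sq t"
          using bary_sq_nonneg[of t] by (simp_all add: norm_divide norm_power norm_X norm_mult)
        hence "norm (c (X m) t) \<ge> 1 - bary_sq t"
          using norm_diff_ineq[of "1 / (X m)\<^sup>2" "(X m)\<^sup>2 * complex_of_real (bary_sq t)"] by (simp add: c_def add.commute)
        hence "norm (c (X m) t) powr e \<le> (1 - bary_sq t) powr e"
          using lt e by (intro powr_mono2') auto
        thus ?thesis using True by (simp add: norm_powr_real_powr')
      qed simp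
    qed
  qed
  hence lhs: "(\<lambda>m. K * (LINT t:(corner_simplex :: (real^'n) set)|lborel. c (X m) t powr complex_of_real e)) \<longlonglongrightarrow>
        K * (\<omega> ^ n * complex_of_real (LINT t:(corner_simplex :: (real^'n) set)|lborel. (1 - bary_sq t) powr e))"
    by (intro tendsto_mult tendsto_const) (simp only: set_integral_mult_right set_integral_complex_of_real)
  have "K * (LINT t:(corner_simplex :: (real^'n) set)|lborel. c (X m) t powr complex_of_real e) =
     X m / complex_of_real (sqrt (2*pi)) * (LINT y|lborel. osc n (X m) y)" for m
    using corner_simplex_gaussian_identity[OF X_pos, where 'n='n] unfolding c_def K_def e_eq osc_def n_def .
  moreover have "(\<lambda>m. X m / complex_of_real (sqrt (2*pi)) * (LINT y|lborel. osc n (X m) y)) \<longlonglongrightarrow> \<omega> / complex_of_real (sqrt (2*pi)) * L"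
    by (intro tendsto_intros X_lim L) simp
  ultimately have "K * (\<omega> ^ n * complex_of_real (LINT t:(corner_simplex :: (real^'n) set)|lborel. (1 - bary_sq t) powr e)) =
     \<omega> / complex_of_real (sqrt (2*pi)) * L"
    using LIMSEQ_unique[OF lhs] by simp
  with L(1) show ?thesis unfolding K_def n_def e_def by blast
qed

section \<open>Comparison with the ray integral\<close>

text \<open>On the ray \<i> (1 - \<i>) = 1 + \<i> = sqrt 2 \<omega>, so sqrt (2 / d) is the scale at
  which the arguments of \<open>Phi\<close> agree. It is also the scale at which the exponents
  agree: with u = s y, both exp (\<i> d u^2 / 2) and exp (-x^2 / 2) become exp (\<i> y^2).\<close>

lemma ray_integrand_eq:
  fixes d :: nat and y :: real
  assumes d: "d > 0"
  defines "\<omega> \<equiv> cis (pi / 4)" and "s \<equiv> sqrt (2 / real d)"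
  shows "(Phi (\<i> * ((1 - \<i>) * complex_of_real y) / sqrt (real d)) ^ (d + 1) + Phi (- \<i> * ((1 - \<i>) * complex_of_real y) / sqrt (real d)) ^ (d + 1)) *
            exp (- (((1 - \<i>) * complex_of_real y)\<^sup>2) / 2) * (1 - \<i>) =
         (1 - \<i>) * (\<omega> / complex_of_real (sqrt (2*pi))) ^ (d + 1) * (osc (d + 1) \<omega> (s * y) + osc (d + 1) \<omega> (- (s * y)))"
proof -
  define u where "u = s * y"
  define p where "p = complex_of_real (sqrt (2*pi))"
  have p0: "p \<noteq> 0" by (simp add: p_def)
  have \<omega>2: "\<omega>\<^sup>2 = \<i>" by (simp add: \<omega>_def Complex.DeMoivre)
  have \<omega>0: "\<omega> \<noteq> 0" by (simp add: \<omega>_def)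
  have i\<omega>: "\<i> / \<omega> = \<omega>" using \<omega>2 \<omega>0 by (simp add: field_simps power2_eq_square)
  have one_ii: "1 + \<i> = complex_of_real (sqrt 2) * \<omega>"
    by (simp add: \<omega>_def complex_eq_iff cos_45 sin_45)
  have arg: "\<i> * ((1 - \<i>) * complex_of_real y) / sqrt (real d) = \<omega> * complex_of_real u"
  proof -
    have "\<i> * ((1 - \<i>) * complex_of_real y) = (1 + \<i>) * complex_of_real y"
      by (simp add: algebra_simps)
    also have "\<dots> = complex_of_real (sqrt 2) * \<omega> * complex_of_real y" by (simp only: one_ii)
    finally show ?thesis by (simp add: u_def s_def real_sqrt_divide mult.commute)
  qed
  have arg': "- \<i> * ((1 - \<i>) * complex_of_real y) / sqrt (real d) = - (\<omega> * complex_of_real u)"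
    using arg by simp
  have osc: "(\<omega> / p) ^ (d + 1) * osc (d + 1) \<omega> v = Phi (\<omega> * complex_of_real v) ^ (d + 1) * exp (\<i> * of_nat d * complex_of_real v ^ 2 / 2)" for v
  proof -
    have "\<i> * complex_of_real v / \<omega> = \<omega> * complex_of_real v" using i\<omega> by (metis times_divide_eq_left)
    hence gl: "gauss_laplace \<omega> v = p / \<omega> * exp (\<i> * complex_of_real v ^ 2 / 2) * Phi (\<omega> * complex_of_real v)"
      by (simp add: gauss_laplace_def \<omega>2 p_def)
    have "(\<omega> / p) ^ (d + 1) * osc (d + 1) \<omega> v = ((\<omega> / p) ^ (d + 1) * (p / \<omega>) ^ (d + 1)) *
        (exp (- \<i> * complex_of_real v ^ 2 / 2) * exp (\<i> * complex_of_real v ^ 2 / 2) ^ (d + 1)) * Phi (\<omega> * complex_of_real v) ^ (d + 1)"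
      unfolding osc_def gl \<omega>2 power_mult_distrib by (simp only: mult_ac)
    also have "(\<omega> / p) ^ (d + 1) * (p / \<omega>) ^ (d + 1) = 1"
      using p0 \<omega>0 by (simp flip: power_mult_distrib)
    also have "exp (- \<i> * complex_of_real v ^ 2 / 2) * exp (\<i> * complex_of_real v ^ 2 / 2) ^ (d + 1) = exp (\<i> * of_nat d * complex_of_real v ^ 2 / 2)"
      unfolding exp_of_nat_mult[symmetric] exp_add[symmetric]
      by (intro arg_cong[where f=exp]) (simp add: field_simps)
    finally show ?thesis by simp
  qed
  have "\<i> * of_nat d * complex_of_real u ^ 2 / 2 = \<i> * complex_of_real (real d * u\<^sup>2 / 2)" by simp
  also have "real d * u\<^sup>2 / 2 = y\<^sup>2" using d by (simp add: u_def s_def power_mult_distrib)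
  also have "\<i> * complex_of_real (y\<^sup>2) = - (((1 - \<i>) * complex_of_real y)\<^sup>2) / 2"
    by (simp add: power_mult_distrib power2_eq_square algebra_simps)
  finally have ex: "exp (\<i> * of_nat d * complex_of_real u ^ 2 / 2) = exp (- (((1 - \<i>) * complex_of_real y)\<^sup>2) / 2)" by simp
  have "(\<omega> / p) ^ (d + 1) * (osc (d + 1) \<omega> u + osc (d + 1) \<omega> (- u)) =
     (Phi (\<omega> * complex_of_real u) ^ (d + 1) + Phi (- (\<omega> * complex_of_real u)) ^ (d + 1)) * exp (- (((1 - \<i>) * complex_of_real y)\<^sup>2) / 2)"
    unfolding distrib_left osc ex[symmetric] by (simp add: distrib_right)
  thus ?thesis unfolding arg arg' u_def p_def by (simp only: mult_ac)
qed

text \<open>The Gamma factor of the radial moment cancels the one in the surface area of the sphere;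
  what remains are the d + 1 Gaussian normalisations.\<close>

lemma omega_times_moment_constant:
  "omega (d + 1) * (2 powr ((real d - 1) / 2) * Gamma ((real d + 1) / 2)) = sqrt (2*pi) ^ (d + 1)"
proof -
  define g where "g = Gamma ((real d + 1) / 2)"
  have "g > 0" unfolding g_def by (intro Gamma_real_pos) auto
  moreover have "omega (d + 1) = 2 * pi powr ((real d + 1) / 2) / g"
    by (simp add: omega_def g_def add.commute)
  ultimately have "omega (d + 1) * (2 powr ((real d - 1) / 2) * Gamma ((real d + 1) / 2)) = 2 * 2 powr ((real d - 1) / 2) * pi powr ((real d + 1) / 2)"
    by (simp add: g_def[symmetric])
  also have "2 * 2 powr ((real d - 1) / 2) = 2 powr (1 + (real d - 1) / 2)" by (simp only: powr_add) simp
  also have "1 + (real d - 1) / 2 = (real d + 1) / 2" by (simp add: field_simps)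
  also have "2 powr ((real d + 1) / 2) * pi powr ((real d + 1) / 2) = (2 * pi) powr ((1/2) * (real (d + 1)))"
    by (simp add: powr_mult add.commute)
  also have "\<dots> = ((2*pi) powr (1/2)) powr real (d + 1)" by (simp only: powr_powr)
  also have "\<dots> = sqrt (2*pi) ^ (d + 1)"
    by (subst powr_realpow) (auto simp: powr_half_sqrt)
  finally show ?thesis .
qed

lemma ideal_simplex_volume_wellorder:
  fixes V :: "(real^'m::{finite,wellorder}) set" and \<kappa> :: real
  assumes d: "CARD('m) \<ge> 2" and \<kappa>: "\<kappa> < 0"
    and V: "regular_simplex_vertices V" "\<forall>v\<in>V. norm v = 1 / sqrt (- \<kappa>)"
  shows "\<exists>L. ray_integral_tendsto (1 - \<i>)
              (\<lambda>x. (Phi (\<i> * x / sqrt (real CARD('m))) ^ (CARD('m) + 1)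
                    + Phi (- \<i> * x / sqrt (real CARD('m))) ^ (CARD('m) + 1)) * exp (- (x^2) / 2)) L
           \<and> complex_of_real (hyp_vol \<kappa> (convex hull V)) =
               complex_of_real (omega (CARD('m) + 1)) / (\<i> ^ CARD('m) * complex_of_real (\<bar>\<kappa>\<bar> powr (real CARD('m) / 2)))
               * (1 / complex_of_real (sqrt (2 * pi))) * L"
proof -
  define d where "d = CARD('m)"
  define \<omega> where "\<omega> = cis (pi / 4)"
  define s where "s = sqrt (2 / real d)"
  define p where "p = complex_of_real (sqrt (2*pi))"
  define K where "K = 2 powr ((real d - 1) / 2) * Gamma ((real d + 1) / 2)"
  define M where "M = (LINT t:(corner_simplex :: (real^'m::_) set)|lborel. (1 - bary_sq t) powr (- (real d + 1) / 2))"
  define C where "C = (1 - \<i>) * (\<omega> / p) ^ (d + 1)"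
  have d0: "d > 0" by (simp add: d_def)
  have s: "s > 0" using d0 by (simp add: s_def)
  have p0: "p \<noteq> 0" by (simp add: p_def)
  have \<omega>0: "\<omega> \<noteq> 0" by (simp add: \<omega>_def)
  have \<omega>2: "\<omega>\<^sup>2 = \<i>" by (simp add: \<omega>_def Complex.DeMoivre)
  define G where "G = (\<lambda>u. osc (d + 1) \<omega> u + osc (d + 1) \<omega> (-u))"
  have "\<exists>L. ((\<lambda>B. integral {0..B} G) \<longlongrightarrow> L) at_top \<and>
      complex_of_real K * (\<omega> ^ (d + 1) * complex_of_real M) = \<omega> / p * L"
    unfolding d_def \<omega>_def p_def K_def M_def G_def by (rule corner_simplex_limit_identity[OF assms(1)])
  then obtain L where lim: "((\<lambda>B. integral {0..B} G) \<longlongrightarrow> L) at_top"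
    and eq: "complex_of_real K * (\<omega> ^ (d + 1) * complex_of_real M) = \<omega> / p * L"
    by blast
  have "ray_integral_tendsto (1 - \<i>)
              (\<lambda>x. (Phi (\<i> * x / sqrt (real d)) ^ (d + 1)
                    + Phi (- \<i> * x / sqrt (real d)) ^ (d + 1)) * exp (- (x^2) / 2)) (C * (L / s))"
    unfolding ray_integral_tendsto_def
  proof (rule Lim_transform_eventually)
    show "((\<lambda>B. C * (integral {0..s * B} G / s)) \<longlongrightarrow> C * (L / s)) at_top"
    proof (intro tendsto_intros)
      show "((\<lambda>B. integral {0..s * B} G) \<longlongrightarrow> L) at_top"
        by (rule filterlim_compose[OF lim]) (use s in real_asymp)
    qed (use s in auto)
    show "eventually (\<lambda>B. C * (integral {0..s * B} G / s) =
       integral {0..B} (\<lambda>y. (Phi (\<i> * ((1 - \<i>) * complex_of_real y) / sqrt (real d)) ^ (d + 1)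
                    + Phi (- \<i> * ((1 - \<i>) * complex_of_real y) / sqrt (real d)) ^ (d + 1)) * exp (- (((1 - \<i>) * complex_of_real y)^2) / 2) * (1 - \<i>))) at_top"
      using eventually_ge_at_top[of 0]
    proof eventually_elim
      case (elim B)
      have "G integrable_on {0..s * B}"
        unfolding G_def by (intro integrable_continuous_real continuous_intros continuous_on_osc \<omega>0)
      hence "((\<lambda>y. G (s * y)) has_integral (1 / \<bar>s\<bar>) *\<^sub>R integral {0..s * B} G) ((\<lambda>x. x / s) ` {0..s * B})"
        using s by (intro has_integral_stretch_real integrable_integral) auto
      also have "(\<lambda>x. x / s) ` {0..s * B} = {0..B}"
        using s elim by (auto simp: field_simps image_iff intro!: bexI[of _ "s * _"])
      finally have "((\<lambda>y. C * G (s * y)) has_integral C * ((1 / \<bar>s\<bar>) *\<^sub>R integral {0..s * B} G)) {0..B}"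
        by (rule has_integral_mult_right)
      moreover have "(1 / \<bar>s\<bar>) *\<^sub>R integral {0..s * B} G = integral {0..s * B} G / s"
        using s by (simp add: scaleR_conv_of_real)
      ultimately have "integral {0..B} (\<lambda>y. C * G (s * y)) = C * (integral {0..s * B} G / s)"
        by (metis integral_unique)
      thus ?case
        unfolding ray_integrand_eq[OF d0] G_def C_def p_def \<omega>_def s_def by (rule sym)
    qed
  qed
  moreover have "complex_of_real (hyp_vol \<kappa> (convex hull V)) =
               complex_of_real (omega (d + 1)) / (\<i> ^ d * complex_of_real (\<bar>\<kappa>\<bar> powr (real d / 2)))
               * (1 / p) * (C * (L / s))"
  proof -
    define k where "k = complex_of_real (\<bar>\<kappa>\<bar> powr (real d / 2))"
    have k0: "k \<noteq> 0" using \<kappa> by (simp add: k_def)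
    have "hyp_vol \<kappa> (convex hull V) = \<bar>\<kappa>\<bar> powr (- (real d / 2)) * sqrt (real d) * M"
      using hyp_vol_ideal_simplex[OF \<kappa> V] unfolding M_def d_def .
    hence vol: "complex_of_real (hyp_vol \<kappa> (convex hull V)) = complex_of_real (sqrt (real d)) * complex_of_real M / k"
      by (simp only: powr_minus of_real_mult of_real_inverse k_def[symmetric]) (simp add: field_simps)
    \<comment> \<open>The Jacobian 1 - \<i> of the ray and the scale \<open>s\<close> combine to
      sqrt d / \<omega>, which supplies the sqrt d of the volume formula.\<close>
    have Cs: "C / s = complex_of_real (sqrt (real d)) / \<omega> * (\<omega> / p) ^ (d + 1)"
    proof -
      have "(1 - \<i>) * \<omega> = complex_of_real (sqrt 2)"
        by (simp add: \<omega>_def complex_eq_iff cos_45 sin_45)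
      hence "1 - \<i> = complex_of_real (sqrt 2) / \<omega>"
        using \<omega>0 by (simp add: eq_divide_eq)
      moreover have "complex_of_real s = complex_of_real (sqrt 2) / complex_of_real (sqrt (real d))"
        by (simp add: s_def real_sqrt_divide)
      ultimately show ?thesis using d0 by (simp add: C_def)
    qed
    have L: "L = p / \<omega> * (complex_of_real K * (\<omega> ^ (d + 1) * complex_of_real M))"
      unfolding eq using p0 \<omega>0 by simp
    have om: "complex_of_real (omega (d + 1)) * complex_of_real K = p ^ (d + 1)"
      unfolding K_def p_def of_real_mult[symmetric] of_real_power[symmetric] omega_times_moment_constant ..
    have regroup: "W / (I * k) * (1 / p) * (S / \<omega> * a * (p / \<omega> * (Q * (b * N)))) = (W * Q) / (I * k) * (S * N) * (a * b / \<omega>\<^sup>2)" for W I S Q N a b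
      using p0 \<omega>0 by (simp add: power2_eq_square)
    have "complex_of_real (omega (d + 1)) / (\<i> ^ d * k) * (1 / p) * (C * (L / s)) =
       complex_of_real (omega (d + 1)) / (\<i> ^ d * k) * (1 / p) * ((C / s) * L)" by simp
    also have "\<dots> = (complex_of_real (omega (d + 1)) * complex_of_real K) / (\<i> ^ d * k) * (complex_of_real (sqrt (real d)) * complex_of_real M) *
        ((\<omega> / p) ^ (d + 1) * \<omega> ^ (d + 1) / \<omega>\<^sup>2)"
      unfolding Cs L by (rule regroup)
    \<comment> \<open>Counting eighth roots of unity: \<omega> occurs to the power 2 (d + 1) - 2 = 2
      d, that is as \<i>^d, and cancels the \<i>^d of the formula.\<close>
    also have "(\<omega> / p) ^ (d + 1) * \<omega> ^ (d + 1) = (\<omega>\<^sup>2) ^ (d + 1) / p ^ (d + 1)"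
      by (simp only: power_divide times_divide_eq_left power_mult_distrib[symmetric] power2_eq_square)
    also have "(\<omega>\<^sup>2) ^ (d + 1) / p ^ (d + 1) / \<omega>\<^sup>2 = \<i> ^ d / p ^ (d + 1)" by (simp add: \<omega>2)
    also have "complex_of_real (omega (d + 1)) * complex_of_real K / (\<i> ^ d * k) * (complex_of_real (sqrt (real d)) * complex_of_real M) * (\<i> ^ d / p ^ (d + 1))
       = complex_of_real (sqrt (real d)) * complex_of_real M / k"
    proof -
      have "P / (I * k) * N * (I / P) = N / k" if "P \<noteq> 0" "I \<noteq> 0" for P I N
        using that k0 by (simp add: field_simps)
      thus ?thesis unfolding om using p0 by simp
    qed
    finally show ?thesis unfolding vol k_def by simp
  qed
  ultimately show ?thesis unfolding d_def p_def by (intro exI conjI)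
qed

text \<open>The linear change of variables formula of \<^theory>\<open>HOL-Analysis.Change_Of_Vars\<close> needs a
  well-ordered index type, so an arbitrary finite index type is replaced by a copy that has one.\<close>

typedef ('a::finite) idx = "{..<CARD('a)}"
  by (intro exI[of _ 0]) simp

instance idx :: (finite) finite
proof
  have "(UNIV :: 'a idx set) = Abs_idx ` {..<CARD('a)}"
    by (rule type_definition.univ[OF type_definition_idx])
  thus "finite (UNIV :: 'a idx set)" by (metis finite_imageI finite_lessThan)
qed

instantiation idx :: (finite) wellorder
begin

definition less_eq_idx :: "'a idx \<Rightarrow> 'a idx \<Rightarrow> bool" where
  "less_eq_idx x y \<longleftrightarrow> Rep_idx x \<le> Rep_idx y"

definition less_idx :: "'a idx \<Rightarrow> 'a idx \<Rightarrow> bool" where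
  "less_idx x y \<longleftrightarrow> Rep_idx x < Rep_idx y"

instance
proof
  fix P :: "'a idx \<Rightarrow> bool" and a :: "'a idx"
  assume step: "\<And>x. (\<And>y. y < x \<Longrightarrow> P y) \<Longrightarrow> P x"
  show "P a"
  proof (induction a rule: measure_induct_rule[of Rep_idx])
    case (less x)
    show ?case by (rule step, rule less) (simp only: less_idx_def)
  qed
qed (auto simp: less_eq_idx_def less_idx_def Rep_idx_inject)

end

lemma CARD_idx: "CARD('a::finite idx) = CARD('a)"
  by (simp add: type_definition.card[OF type_definition_idx])

text \<open>Renaming coordinates maps boxes to boxes with the same side lengths, and Lebesgue
  measure is determined by boxes.\<close>

lemma distr_lborel_reindex:
  fixes \<pi> :: "'m::finite \<Rightarrow> 'n::finite"
  assumes \<pi>: "bij \<pi>"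
  shows "distr lborel borel (\<lambda>x::real^'n. \<chi> j. x $ \<pi> j) = (lborel :: (real^'m) measure)"
proof (rule lborel_eqI[symmetric])
  let ?\<rho> = "\<lambda>x::real^'n. (\<chi> j. x $ \<pi> j)"
  have [measurable]: "?\<rho> \<in> borel \<rightarrow>\<^sub>M borel"
    by (intro borel_measurable_continuous_onI continuous_intros)
  fix l u :: "real^'m"
  assume le: "\<And>b. b \<in> Basis \<Longrightarrow> l \<bullet> b \<le> u \<bullet> b"
  have le': "l $ j \<le> u $ j" for j
    using le[of "axis j 1"] by (simp add: axis_in_Basis_iff inner_axis)
  define l' where "l' = (\<chi> i. l $ inv \<pi> i)"
  define u' where "u' = (\<chi> i. u $ inv \<pi> i)"
  have inv: "\<pi> (inv \<pi> i) = i" "inv \<pi> (\<pi> j) = j" for i j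
    using \<pi> by (simp_all add: bij_is_surj surj_f_inv_f bij_is_inj)
  have prod: "(\<Prod>b\<in>Basis. (y - x) \<bullet> b) = (\<Prod>i\<in>UNIV. y $ i - x $ i)" for x y :: "real^'k::finite"
    by (rule prod.reindex_cong[of "\<lambda>i. axis i 1"])
       (auto simp: Basis_vec_def inj_on_def axis_eq_axis inner_axis)
  have "?\<rho> -` box l u = box l' u'"
  proof (intro set_eqI)
    fix x
    have "x \<in> ?\<rho> -` box l u \<longleftrightarrow> (\<forall>j. l $ j < x $ \<pi> j \<and> x $ \<pi> j < u $ j)" by (simp add: mem_box_cart)
    also have "\<dots> \<longleftrightarrow> (\<forall>i. l $ inv \<pi> i < x $ i \<and> x $ i < u $ inv \<pi> i)" by (metis inv)
    finally show "x \<in> ?\<rho> -` box l u \<longleftrightarrow> x \<in> box l' u'" by (simp add: mem_box_cart l'_def u'_def)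
  qed
  hence "emeasure (distr lborel borel ?\<rho>) (box l u) = emeasure lborel (box l' u')"
    by (simp add: emeasure_distr)
  also have "\<dots> = (\<Prod>b\<in>Basis. (u' - l') \<bullet> b)"
    by (rule emeasure_lborel_box) (auto simp: Basis_vec_def inner_axis l'_def u'_def le')
  also have "(\<Prod>b\<in>Basis. (u' - l') \<bullet> b) = (\<Prod>j\<in>UNIV. u $ j - l $ j)"
    unfolding prod l'_def u'_def
    using prod.reindex_bij_betw[OF bij_imp_bij_inv[OF \<pi>], of "\<lambda>j. u $ j - l $ j"] by simp
  also have "\<dots> = (\<Prod>b\<in>Basis. (u - l) \<bullet> b)" unfolding prod ..
  finally show "emeasure (distr lborel borel ?\<rho>) (box l u) = (\<Prod>b\<in>Basis. (u - l) \<bullet> b)" .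
qed simp

theorem mainTheorem3:
  fixes V :: "(real^'n) set" and \<kappa> :: real
  assumes "CARD('n) \<ge> 2"
    and "\<kappa> < 0"
    and "regular_simplex_vertices V"
    and "\<forall>v\<in>V. norm v = 1 / sqrt (- \<kappa>)"
  shows "\<exists>L. ray_integral_tendsto (1 - \<i>)
              (\<lambda>x. (Phi (\<i> * x / sqrt (real CARD('n))) ^ (CARD('n) + 1)
                    + Phi (- \<i> * x / sqrt (real CARD('n))) ^ (CARD('n) + 1)) * exp (- (x^2) / 2)) L
           \<and> complex_of_real (hyp_vol \<kappa> (convex hull V)) =
               complex_of_real (omega (CARD('n) + 1)) / (\<i> ^ CARD('n) * complex_of_real (\<bar>\<kappa>\<bar> powr (real CARD('n) / 2)))
               * (1 / complex_of_real (sqrt (2 * pi))) * L"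
proof -
  \<comment> \<open>Renaming the coordinates along \<pi> is a linear isometry that preserves the
    measure, so regularity, the norms of the vertices and the hyperbolic volume pass to the
    well-ordered copy.\<close>
  obtain \<pi> :: "'n idx \<Rightarrow> 'n" where \<pi>: "bij \<pi>"
    using finite_same_card_bij[of "UNIV :: 'n idx set" "UNIV :: 'n set"] by (auto simp: CARD_idx)
  define \<rho> where "\<rho> = (\<lambda>x::real^'n. (\<chi> j. x $ \<pi> j))"
  have lin: "linear \<rho>" by (intro linearI) (auto simp: \<rho>_def vec_eq_iff)
  have norm: "norm (\<rho> x) = norm x" for x
    unfolding norm_vec_def L2_set_def \<rho>_def
    using sum.reindex_bij_betw[of \<pi> UNIV UNIV "\<lambda>i. (norm (x $ i))\<^sup>2"] \<pi> by simp
  have dist: "dist (\<rho> x) (\<rho> y) = dist x y" for x y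
    using norm[of "x - y"] linear_diff[OF lin, of x y] by (simp add: dist_norm)
  have inj: "inj \<rho>" by (rule injI) (metis dist dist_eq_0_iff)
  have [measurable]: "\<rho> \<in> borel \<rightarrow>\<^sub>M borel"
    unfolding \<rho>_def by (intro borel_measurable_continuous_onI continuous_intros)
  define V' where "V' = \<rho> ` V"
  have fin: "finite V" using assms(3) by (simp add: regular_simplex_vertices_def)
  hence [measurable]: "convex hull V' \<in> sets borel"
    unfolding V'_def by (intro borel_compact finite_imp_compact_convex_hull) auto
  have reg: "regular_simplex_vertices V'"
    using assms(3) inj unfolding regular_simplex_vertices_def V'_def
    by (auto simp: CARD_idx card_image inj_on_subset dist dest: injD) (metis inj_eq)
  have hull: "convex hull V' = \<rho> ` (convex hull V)"
    unfolding V'_def by (rule convex_hull_linear_image[OF lin, symmetric])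
  have "hyp_vol \<kappa> (convex hull V') =
     (LINT y|distr lborel borel \<rho>. indicat_real (convex hull V') y *\<^sub>R (1 + \<kappa> * (norm y)\<^sup>2) powr (- (real CARD('n) + 1) / 2))"
    unfolding hyp_vol_def set_lebesgue_integral_def CARD_idx \<rho>_def distr_lborel_reindex[OF \<pi>] ..
  also have "\<dots> = (LINT x|lborel. indicat_real (convex hull V') (\<rho> x) *\<^sub>R (1 + \<kappa> * (norm (\<rho> x))\<^sup>2) powr (- (real CARD('n) + 1) / 2))"
    by (subst integral_distr) auto
  also have "\<dots> = hyp_vol \<kappa> (convex hull V)"
    unfolding hyp_vol_def set_lebesgue_integral_def norm hull indicator_def
    by (simp add: inj_image_mem_iff[OF inj])
  finally have "hyp_vol \<kappa> (convex hull V) = hyp_vol \<kappa> (convex hull V')" ..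
  moreover have "\<forall>v\<in>V'. norm v = 1 / sqrt (- \<kappa>)" using assms(4) by (auto simp: V'_def norm)
  ultimately show ?thesis
    using ideal_simplex_volume_wellorder[OF _ assms(2) reg] assms(1) by (simp only: CARD_idx)
qed

end
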